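(* Let $\mathbb F$ be an arbitrary field and let $L$ be a three-dimensional non-Lie left Leibniz algebra over $\mathbb F$. Then $L$ has a basis $a_1,a_2,a_3$ in which its multiplication is one of the sixteen types $L_1,\dots,L_{16}$ below (for some admissible parameter values; products of basis elements not displayed are zero). For every algebra of each of these types, $D=\operatorname{Der}(L)$, identified with its set of matrices in the basis $a_1,a_2,a_3$, is exactly the displayed set, where the parameters listed in the tuple in front of the matrix range over all of $\mathbb F$. The dimension and internal structure of $D$ are as stated, where $u,v,w,z,t$ denote the derivations obtained by setting, respectively, the first, second, third, fourth, fifth parameter of the tuple equal to $1$ and all the others equal to $0$ (as many letters as there are parameters, used in the order $u,v,w,z,t$). $L_1$: $[a_1,a_1]=a_3$. $(a,b,c,d,e)$: $\begin{pmatrix} a&0&0 \\ b&d&0 \\ c&e&2a \end{pmatrix}$; $\dim D=5$; $D=(\mathbb Fv\oplus\mathbb Fw\oplus\mathbb Ft)\rtimes(\mathbb Fu\oplus\mathbb Fz)$, $\mathbb Fu\oplus\mathbb Fz$ is abelian and $[v,t]=-w$. $L_2$: $[a_1,a_1]=[a_1,a_2]=a_3$. $(a,b,c,d)$: $\begin{pmatrix} a&0&0 \\ b&a+b&0 \\ c&d&2a+b \end{pmatrix}$; $\dim D=4$; $D=(\mathbb Fw\oplus\mathbb Fz)\rtimes(\mathbb Fu\oplus\mathbb Fv)$ with both summands abelian. $L_3(\alpha)$, $\alpha\in\mathbb F$, $\alpha\neq 0,-1$: $[a_1,a_1]=[a_2,a_1]=a_3$, $[a_1,a_2]=\alpha a_3$.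 $(a,b,c,d)$: $\begin{pmatrix} a&0&0 \\ b&a+(1+\alpha)b&0 \\ c&d&2a+(1+\alpha)b \end{pmatrix}$; $\dim D=4$; $D=(\mathbb Fw\oplus\mathbb Fz)\rtimes(\mathbb Fu\oplus\mathbb Fv)$ with both summands abelian. $L_4$: $[a_1,a_1]=[a_2,a_1]=a_3$, $[a_1,a_2]=-a_3$. If $\operatorname{char}\mathbb F\ne2$: $(a,b,c,d)$: $\begin{pmatrix} a&0&0 \\ b&a&0 \\ c&d&2a \end{pmatrix}$; $\dim D=4$; $D=(\mathbb Fw\oplus\mathbb Fz)\rtimes(\mathbb Fu\oplus\mathbb Fv)$ with both summands abelian. If $\operatorname{char}\mathbb F=2$: $(a,p,b,c,d)$: $\begin{pmatrix} a&p&0 \\ b&a+p&0 \\ c&d&0 \end{pmatrix}$; $\dim D=5$; $D=(\mathbb Fz\oplus\mathbb Ft)\rtimes H$ with $H=\mathbb Fu\oplus\mathbb Fv\oplus\mathbb Fw$ and $H=(\mathbb F(u+w)\rtimes\mathbb Fv)\oplus\mathbb Fu$. $L_5(\beta)$, $\beta\in\mathbb F$ such that $X^2+\beta$ has no root in $\mathbb F$: $[a_1,a_1]=a_3$, $[a_2,a_2]=\beta a_3$. If $\operatorname{char}\mathbb F\ne2$: $(a,b,c,d)$: $\begin{pmatrix} a&-\beta b&0 \\ b&a&0 \\ c&d&2a \end{pmatrix}$; $\dim D=4$; $D=(\mathbb Fw\oplus\mathbb Fz)\rtimes(\mathbb Fu\oplus\mathbb Fv)$ with both summands abelian. If $\operatorname{char}\mathbb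 F=2$: $(a,b,c,d,e)$: $\begin{pmatrix} a&\beta b&0 \\ b&e&0 \\ c&d&0 \end{pmatrix}$; $\dim D=5$; $D=(\mathbb Fw\oplus\mathbb Fz)\rtimes H$ with $H=\mathbb Fu\oplus\mathbb Fv\oplus\mathbb Ft$ and $H=(\mathbb Fv\rtimes\mathbb Fu)\oplus\mathbb F(u+t)$. $L_6(\delta)$, $\delta\in\mathbb F$ such that $X^2+X+\delta$ has no root in $\mathbb F$: $[a_1,a_1]=[a_1,a_2]=a_3$, $[a_2,a_2]=\delta a_3$. $(a,b,c,d)$: $\begin{pmatrix} a&-\delta b&0 \\ b&a+b&0 \\ c&d&2a+b \end{pmatrix}$; $\dim D=4$; $D=(\mathbb Fw\oplus\mathbb Fz)\rtimes(\mathbb Fu\oplus\mathbb Fv)$ with both summands abelian. $L_7$: $[a_1,a_1]=a_3$, $[a_1,a_2]=a_2$, $[a_2,a_1]=-a_2$. $(a,b,c)$: $\begin{pmatrix} 0&0&0 \\ a&b&0 \\ c&0&0 \end{pmatrix}$; $\dim D=3$; $D=(\mathbb Fu\rtimes\mathbb Fv)\oplus\mathbb Fw$, $[v,u]=u$, $\mathbb Fw\le\zeta(D)$. $L_8(\lambda)$, only when $\operatorname{char}\mathbb F=2$, $\lambda\in\mathbb F$: $[a_1,a_1]=\lambda a_3$, $[a_1,a_2]=[a_2,a_1]=a_2$, $[a_2,a_2]=a_3$. $(a,b,c)$: $\begin{pmatrix} 0&0&0 \\ a&b&0 \\ c&a&0 \end{pmatrix}$; $\dim D=3$; $D=(\mathbb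 Fu\rtimes\mathbb Fv)\oplus\mathbb Fw$, $[v,u]=u$, $\mathbb Fw\le\zeta(D)$. $L_9$: $[a_1,a_1]=[a_1,a_3]=a_3$. $(a,b,c)$: $\begin{pmatrix} 0&0&0 \\ a&b&0 \\ c&0&c \end{pmatrix}$; $\dim D=3$; $D=(\mathbb Fu\rtimes\mathbb Fv)\oplus\mathbb Fw$, $[v,u]=u$, $\mathbb Fw\le\zeta(D)$. $L_{10}(r)$, $r\in\mathbb F^\times$: $[a_1,a_1]=a_3$, $[a_1,a_2]=a_2$, $[a_2,a_1]=-a_2$, $[a_1,a_3]=ra_3$. $(a,b,c)$: $\begin{pmatrix} 0&0&0 \\ a&b&0 \\ c&0&rc \end{pmatrix}$; $\dim D=3$; $D=(\mathbb Fu\rtimes\mathbb Fv)\oplus\mathbb Fw$, $[v,u]=u$, $\mathbb Fw\le\zeta(D)$. $L_{11}$, only when $\operatorname{char}\mathbb F\neq2$: $[a_2,a_2]=a_3$, $[a_1,a_2]=a_2$, $[a_2,a_1]=-a_2$, $[a_1,a_3]=2a_3$. $(a,b)$: $\begin{pmatrix} 0&0&0 \\ a&b&0 \\ 0&-a&2b \end{pmatrix}$; $\dim D=2$; $D=\mathbb Fu\rtimes\mathbb Fv$, $[v,u]=u$. $L_{12}$: $[a_1,a_1]=a_2$, $[a_1,a_2]=a_3$. $(a,b,c)$: $\begin{pmatrix} a&0&0 \\ b&2a&0 \\ c&b&3a \end{pmatrix}$; $\dim D=3$; $D=(\mathbb Fv\oplus\mathbb Fw)\rtimes\mathbb Fu$,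 $[u,v]=v$, $[u,w]=2w$. $L_{13}$: $[a_1,a_1]=a_2$, $[a_1,a_2]=a_2+a_3$. $(a,b)$: $\begin{pmatrix} 0&0&0 \\ a&a&0 \\ b&a&0 \end{pmatrix}$; $\dim D=2$; $D=\mathbb Fu\oplus\mathbb Fv$ is abelian. $L_{14}(\rho)$, $\rho\in\mathbb F^\times$: $[a_1,a_1]=[a_1,a_2]=a_2$, $[a_1,a_3]=\rho a_3$. If $\rho\ne1$: $(a,b)$: $\begin{pmatrix} 0&0&0 \\ a&a&0 \\ 0&0&b \end{pmatrix}$; $\dim D=2$; $D=\mathbb Fu\oplus\mathbb Fv$ is abelian. If $\rho=1$: $(a,b,c,d)$: $\begin{pmatrix} 0&0&0 \\ a&a&c \\ b&b&d \end{pmatrix}$; $\dim D=4$; $D\cong\mathfrak{gl}_2(\mathbb F)$. $L_{15}$: $[a_1,a_1]=a_2$, $[a_1,a_2]=a_2+a_3$, $[a_1,a_3]=a_3$. If $\operatorname{char}\mathbb F\ne2$: $(a,b)$: $\begin{pmatrix} 0&0&0 \\ a&a&0 \\ b&a+b&a \end{pmatrix}$; $\dim D=2$; $D=\mathbb Fu\oplus\mathbb Fv$ is abelian. If $\operatorname{char}\mathbb F=2$: $(s,a,b)$: $\begin{pmatrix} s&0&0 \\ a&a&s \\ b&a+b&s+a \end{pmatrix}$; $\dim D=3$; $D=(\mathbb Fv\rtimes\mathbb Fu)\oplus\mathbb F(v+w)$, $[u,v]=v$, $\mathbb F(v+w)\le\zeta(D)$. $L_{16}(\beta,\gamma)$,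 $\beta,\gamma\in\mathbb F$ such that $X^2-\gamma X-\beta$ is irreducible over $\mathbb F$: $[a_1,a_1]=a_2$, $[a_1,a_2]=a_3$, $[a_1,a_3]=\beta a_2+\gamma a_3$. If $\operatorname{char}\mathbb F\ne2$ or $\gamma\neq0$: $(a,b)$: $\begin{pmatrix} 0&0&0 \\ a&\beta b&\beta(a+\gamma b) \\ b&a+\gamma b&\gamma a+(\beta+\gamma^2)b \end{pmatrix}$; $\dim D=2$; $D=\mathbb Fu\oplus\mathbb Fv$ is abelian. If $\operatorname{char}\mathbb F=2$ and $\gamma=0$: $(s,a,b)$: $\begin{pmatrix} s&0&0 \\ a&\beta b&\beta a \\ b&a&s+\beta b \end{pmatrix}$; $\dim D=3$; $D=(\mathbb Fv\rtimes\mathbb Fu)\oplus\mathbb Fw$, $[u,v]=v$, $\mathbb Fw\le\zeta(D)$.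
   Context: A left Leibniz algebra over a field $\mathbb F$ is an $\mathbb F$-vector space $L$ with a bilinear product $[\cdot,\cdot]$ satisfying $[x,[y,z]]=[[x,y],z]+[y,[x,z]]$ for all $x,y,z\in L$. It is non-Lie if it is not a Lie algebra, i.e. $[x,x]\ne0$ for some $x\in L$. A derivation of $L$ is a linear map $d:L\to L$ with $d([x,y])=[d(x),y]+[x,d(y)]$ for all $x,y\in L$; the set $\operatorname{Der}(L)$ of all derivations is a Lie algebra under $[d_1,d_2]=d_1d_2-d_2d_1$. Matrices act on column vectors: the $j$-th column of the matrix of $d$ consists of the coordinates of $d(a_j)$ in the basis $a_1,a_2,a_3$; $D=\operatorname{Der}(L)$ is identified with its image in the algebra $M_3(\mathbb F)$ of $3\times3$ matrices. $\mathbb F^\times=\mathbb F\setminus\{0\}$, and $\zeta(D)$ denotes the center of $D$. The notation $D=I\rtimes H$ means that $I$ is an ideal of $D$, $H$ is a subalgebra, $D=I+H$ and $I\cap H=0$. *)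

theory Defs
  imports "HOL-Analysis.Analysis" "HOL-Computational_Algebra.Polynomial"
begin

section \<open>Leibniz algebras and their derivations\<close>

locale nonassoc_algebra = vector_space scale
  for scale :: "'a::field \<Rightarrow> 'v::ab_group_add \<Rightarrow> 'v" +
  fixes br :: "'v \<Rightarrow> 'v \<Rightarrow> 'v"
  assumes linear_left: "\<And>y. Vector_Spaces.linear scale scale (\<lambda>x. br x y)"
    and linear_right: "\<And>x. Vector_Spaces.linear scale scale (\<lambda>y. br x y)"
begin

definition derivations :: "('v \<Rightarrow> 'v) set" where
  "derivations =
     {d. Vector_Spaces.linear scale scale d \<and> (\<forall>x y. d (br x y) = br (d x) y + br x (d y))}"

definition ordered_basis :: "(3 \<Rightarrow> 'v) \<Rightarrow> bool" where
  "ordered_basis b \<longleftrightarrow> inj b \<and> independent (range b) \<and> span (range b) = UNIV"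

text \<open>\<open>C i j\<close> is the coordinate vector of the product of the \<open>i\<close>-th and \<open>j\<close>-th basis vectors.\<close>

definition has_mult_table :: "(3 \<Rightarrow> 'v) \<Rightarrow> (3 \<Rightarrow> 3 \<Rightarrow> 'a ^ 3) \<Rightarrow> bool" where
  "has_mult_table b C \<longleftrightarrow> (\<forall>i j. br (b i) (b j) = (\<Sum>k\<in>UNIV. scale (C i j $ k) (b k)))"

definition matrix_wrt :: "(3 \<Rightarrow> 'v) \<Rightarrow> ('v \<Rightarrow> 'v) \<Rightarrow> 'a ^ 3 ^ 3" where
  "matrix_wrt b d = (\<chi> i j. representation (range b) (d (b j)) (b i))"

definition Der_matrices :: "(3 \<Rightarrow> 'v) \<Rightarrow> ('a ^ 3 ^ 3) set" where
  "Der_matrices b = matrix_wrt b ` derivations"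

end

locale left_leibniz_algebra = nonassoc_algebra +
  assumes left_leibniz: "\<And>x y z. br x (br y z) = br (br x y) z + br y (br x z)"

definition non_Lie :: "('v::zero \<Rightarrow> 'v \<Rightarrow> 'v) \<Rightarrow> bool" where
  "non_Lie br \<longleftrightarrow> (\<exists>x. br x x \<noteq> 0)"


section \<open>Lie algebras of matrices\<close>

definition mat_scale :: "'a::field \<Rightarrow> 'a ^ 'n ^ 'm \<Rightarrow> 'a ^ 'n ^ 'm"  (infixl \<open>*m\<close> 70) where
  "c *m A = (\<chi> i j. c * A $ i $ j)"

interpretation matv: vector_space "mat_scale :: 'a::field \<Rightarrow> 'a ^ 'n ^ 'm \<Rightarrow> 'a ^ 'n ^ 'm"
  by unfold_locales (simp_all add: mat_scale_def vec_eq_iff algebra_simps)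

definition lie :: "'a::field ^ 'n ^ 'n \<Rightarrow> 'a ^ 'n ^ 'n \<Rightarrow> 'a ^ 'n ^ 'n" where
  "lie A B = A ** B - B ** A"

definition subalgebra :: "('a::field ^ 'n ^ 'n) set \<Rightarrow> ('a ^ 'n ^ 'n) set \<Rightarrow> bool" where
  "subalgebra H D \<longleftrightarrow> matv.subspace H \<and> H \<subseteq> D \<and> (\<forall>x\<in>H. \<forall>y\<in>H. lie x y \<in> H)"

definition lie_ideal :: "('a::field ^ 'n ^ 'n) set \<Rightarrow> ('a ^ 'n ^ 'n) set \<Rightarrow> bool" where
  "lie_ideal I D \<longleftrightarrow> matv.subspace I \<and> I \<subseteq> D \<and> (\<forall>x\<in>D. \<forall>y\<in>I. lie x y \<in> I)"

definition abelian :: "('a::field ^ 'n ^ 'n) set \<Rightarrow> bool" where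
  "abelian D \<longleftrightarrow> (\<forall>x\<in>D. \<forall>y\<in>D. lie x y = 0)"

definition lie_center :: "('a::field ^ 'n ^ 'n) set \<Rightarrow> ('a ^ 'n ^ 'n) set" where
  "lie_center D = {x \<in> D. \<forall>y\<in>D. lie x y = 0}"

abbreviation line :: "'a::field ^ 'n ^ 'n \<Rightarrow> ('a ^ 'n ^ 'n) set" where
  "line x \<equiv> matv.span {x}"

text \<open>\<open>D\<close> is the semidirect sum of the ideal \<open>I\<close> and the subalgebra \<open>H\<close>.\<close>

definition semidirect ::
  "('a::field ^ 'n ^ 'n) set \<Rightarrow> ('a ^ 'n ^ 'n) set \<Rightarrow> ('a ^ 'n ^ 'n) set \<Rightarrow> bool" where
  "semidirect D I H \<longleftrightarrow>
     lie_ideal I D \<and> subalgebra H D \<and> D = {x + y | x y. x \<in> I \<and> y \<in> H} \<and> I \<inter> H = {0}"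

text \<open>Direct sum of Lie algebras: both summands are ideals.\<close>

definition direct_sum ::
  "('a::field ^ 'n ^ 'n) set \<Rightarrow> ('a ^ 'n ^ 'n) set \<Rightarrow> ('a ^ 'n ^ 'n) set \<Rightarrow> bool" where
  "direct_sum D A B \<longleftrightarrow>
     lie_ideal A D \<and> lie_ideal B D \<and> D = {x + y | x y. x \<in> A \<and> y \<in> B} \<and> A \<inter> B = {0}"

text \<open>\<open>X\<close> is, as a vector space only, the direct sum of the lines spanned by the (nonzero) members
  of \<open>xs\<close>.\<close>

definition linear_direct_sum :: "('a::field ^ 'n ^ 'n) set \<Rightarrow> ('a ^ 'n ^ 'n) list \<Rightarrow> bool" where
  "linear_direct_sum X xs \<longleftrightarrow>
     X = matv.span (set xs) \<and> distinct xs \<and> matv.independent (set xs)"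

definition isomorphic_gl2 :: "('a::field ^ 3 ^ 3) set \<Rightarrow> bool" where
  "isomorphic_gl2 D \<longleftrightarrow>
     (\<exists>f :: 'a ^ 3 ^ 3 \<Rightarrow> 'a ^ 2 ^ 2. bij_betw f D UNIV \<and>
        (\<forall>x\<in>D. \<forall>y\<in>D. f (x + y) = f x + f y \<and> f (lie x y) = lie (f x) (f y)) \<and>
        (\<forall>c. \<forall>x\<in>D. f (c *m x) = c *m f x))"


section \<open>The sixteen types\<close>

datatype 'a leibniz_type =
    L1 | L2 | L3 'a | L4 | L5 'a | L6 'a | L7 | L8 'a | L9 | L10 'a | L11 | L12 | L13 | L14 'a
  | L15 | L16 'a 'a

fun admissible :: "'a::field leibniz_type \<Rightarrow> bool" where
  "admissible (L3 \<alpha>) \<longleftrightarrow> \<alpha> \<noteq> 0 \<and> \<alpha> \<noteq> - 1"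
| "admissible (L5 \<beta>) \<longleftrightarrow> \<not> (\<exists>x. x ^ 2 + \<beta> = 0)"
| "admissible (L6 \<delta>) \<longleftrightarrow> \<not> (\<exists>x. x ^ 2 + x + \<delta> = 0)"
| "admissible (L8 l) \<longleftrightarrow> CHAR('a) = 2"
| "admissible (L10 r) \<longleftrightarrow> r \<noteq> 0"
| "admissible L11 \<longleftrightarrow> CHAR('a) \<noteq> 2"
| "admissible (L14 \<rho>) \<longleftrightarrow> \<rho> \<noteq> 0"
| "admissible (L16 \<beta> \<gamma>) \<longleftrightarrow> irreducible [:- \<beta>, - \<gamma>, 1:]"
| "admissible _ \<longleftrightarrow> True"

text \<open>Products that are not listed are zero.\<close>

definition products :: "((3 \<times> 3) \<times> ('a::zero ^ 3)) list \<Rightarrow> 3 \<Rightarrow> 3 \<Rightarrow> 'a ^ 3" where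
  "products ps i j = (case map_of ps (i, j) of None \<Rightarrow> 0 | Some v \<Rightarrow> v)"

abbreviation bv :: "3 \<Rightarrow> 'a::field ^ 3" where "bv k \<equiv> axis k 1"

fun mult_table :: "'a::field leibniz_type \<Rightarrow> 3 \<Rightarrow> 3 \<Rightarrow> 'a ^ 3" where
  "mult_table L1 = products [((1,1), bv 3)]"
| "mult_table L2 = products [((1,1), bv 3), ((1,2), bv 3)]"
| "mult_table (L3 \<alpha>) = products [((1,1), bv 3), ((2,1), bv 3), ((1,2), \<alpha> *s bv 3)]"
| "mult_table L4 = products [((1,1), bv 3), ((2,1), bv 3), ((1,2), - bv 3)]"
| "mult_table (L5 \<beta>) = products [((1,1), bv 3), ((2,2), \<beta> *s bv 3)]"
| "mult_table (L6 \<delta>) = products [((1,1), bv 3), ((1,2), bv 3), ((2,2), \<delta> *s bv 3)]"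
| "mult_table L7 = products [((1,1), bv 3), ((1,2), bv 2), ((2,1), - bv 2)]"
| "mult_table (L8 l) =
     products [((1,1), l *s bv 3), ((1,2), bv 2), ((2,1), bv 2), ((2,2), bv 3)]"
| "mult_table L9 = products [((1,1), bv 3), ((1,3), bv 3)]"
| "mult_table (L10 r) =
     products [((1,1), bv 3), ((1,2), bv 2), ((2,1), - bv 2), ((1,3), r *s bv 3)]"
| "mult_table L11 =
     products [((2,2), bv 3), ((1,2), bv 2), ((2,1), - bv 2), ((1,3), 2 *s bv 3)]"
| "mult_table L12 = products [((1,1), bv 2), ((1,2), bv 3)]"
| "mult_table L13 = products [((1,1), bv 2), ((1,2), bv 2 + bv 3)]"
| "mult_table (L14 \<rho>) = products [((1,1), bv 2), ((1,2), bv 2), ((1,3), \<rho> *s bv 3)]"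
| "mult_table L15 = products [((1,1), bv 2), ((1,2), bv 2 + bv 3), ((1,3), bv 3)]"
| "mult_table (L16 \<beta> \<gamma>) =
     products [((1,1), bv 2), ((1,2), bv 3), ((1,3), \<beta> *s bv 2 + \<gamma> *s bv 3)]"


section \<open>The derivation algebras\<close>

abbreviation rows :: "'a::zero list list \<Rightarrow> 'a ^ 3 ^ 3" where
  "rows xss \<equiv> vector (map vector xss)"

text \<open>\<open>D\<close> is the semidirect sum of the abelian ideal \<open>line x1 \<oplus> line x2\<close> and the abelian
  subalgebra \<open>line y1 \<oplus> line y2\<close>.\<close>

definition abelian_semidirect where
  "abelian_semidirect D x1 x2 y1 y2 \<longleftrightarrow>
     (let I = matv.span {x1, x2}; H = matv.span {y1, y2}
      in semidirect D I H \<and>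
         direct_sum I (line x1) (line x2) \<and> abelian I \<and>
         direct_sum H (line y1) (line y2) \<and> abelian H)"

text \<open>\<open>D\<close> is the direct sum of \<open>line x \<rtimes> line y\<close> and \<open>line z\<close>.\<close>

definition semidirect_plus_line where
  "semidirect_plus_line D x y z \<longleftrightarrow>
     (let K = matv.span {x, y}
      in direct_sum D K (line z) \<and> semidirect K (line x) (line y))"

text \<open>\<open>D\<close> stands for the set of matrices of all derivations in the distinguished basis; \<open>u\<close>, \<open>v\<close>,
  \<open>w\<close>, \<open>z\<close>, \<open>t\<close> are obtained from the parametrization \<open>M\<close> by setting one parameter to 1 and the
  others to 0.\<close>

fun der_description :: "'a::field leibniz_type \<Rightarrow> ('a ^ 3 ^ 3) set \<Rightarrow> bool" where
  "der_description L1 D \<longleftrightarrow>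
    (let M = (\<lambda>a b c d e. rows [[a, 0, 0], [b, d, 0], [c, e, 2 * a]]);
         u = M 1 0 0 0 0; v = M 0 1 0 0 0; w = M 0 0 1 0 0; z = M 0 0 0 1 0; t = M 0 0 0 0 1;
         I = matv.span {v, w, t}; H = matv.span {u, z}
     in D = {M a b c d e | a b c d e. True} \<and> matv.dim D = 5 \<and>
        semidirect D I H \<and> linear_direct_sum I [v, w, t] \<and>
        direct_sum H (line u) (line z) \<and> abelian H \<and> lie v t = - w)"
| "der_description L2 D \<longleftrightarrow>
    (let M = (\<lambda>a b c d. rows [[a, 0, 0], [b, a + b, 0], [c, d, 2 * a + b]]);
         u = M 1 0 0 0; v = M 0 1 0 0; w = M 0 0 1 0; z = M 0 0 0 1
     in D = {M a b c d | a b c d. True} \<and> matv.dim D = 4 \<and>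
        abelian_semidirect D w z u v)"
| "der_description (L3 \<alpha>) D \<longleftrightarrow>
    (let M = (\<lambda>a b c d. rows
           [[a, 0, 0], [b, a + (1 + \<alpha>) * b, 0], [c, d, 2 * a + (1 + \<alpha>) * b]]);
         u = M 1 0 0 0; v = M 0 1 0 0; w = M 0 0 1 0; z = M 0 0 0 1
     in D = {M a b c d | a b c d. True} \<and> matv.dim D = 4 \<and>
        abelian_semidirect D w z u v)"
| "der_description L4 D \<longleftrightarrow>
    (if CHAR('a) \<noteq> 2 then
      (let M = (\<lambda>a b c d. rows [[a, 0, 0], [b, a, 0], [c, d, 2 * a]]);
           u = M 1 0 0 0; v = M 0 1 0 0; w = M 0 0 1 0; z = M 0 0 0 1
       in D = {M a b c d | a b c d. True} \<and> matv.dim D = 4 \<and>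
          abelian_semidirect D w z u v)
     else
      (let M = (\<lambda>a p b c d. rows [[a, p, 0], [b, a + p, 0], [c, d, 0]]);
           u = M 1 0 0 0 0; v = M 0 1 0 0 0; w = M 0 0 1 0 0; z = M 0 0 0 1 0; t = M 0 0 0 0 1;
           I = matv.span {z, t}; H = matv.span {u, v, w}
       in D = {M a p b c d | a p b c d. True} \<and> matv.dim D = 5 \<and>
          semidirect D I H \<and> direct_sum I (line z) (line t) \<and>
          linear_direct_sum H [u, v, w] \<and> semidirect_plus_line H (u + w) v u))"
| "der_description (L5 \<beta>) D \<longleftrightarrow>
    (if CHAR('a) \<noteq> 2 then
      (let M = (\<lambda>a b c d. rows [[a, - \<beta> * b, 0], [b, a, 0], [c, d, 2 * a]]);
           u = M 1 0 0 0; v = M 0 1 0 0; w = M 0 0 1 0; z = M 0 0 0 1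
       in D = {M a b c d | a b c d. True} \<and> matv.dim D = 4 \<and>
          abelian_semidirect D w z u v)
     else
      (let M = (\<lambda>a b c d e. rows [[a, \<beta> * b, 0], [b, e, 0], [c, d, 0]]);
           u = M 1 0 0 0 0; v = M 0 1 0 0 0; w = M 0 0 1 0 0; z = M 0 0 0 1 0; t = M 0 0 0 0 1;
           I = matv.span {w, z}; H = matv.span {u, v, t}
       in D = {M a b c d e | a b c d e. True} \<and> matv.dim D = 5 \<and>
          semidirect D I H \<and> direct_sum I (line w) (line z) \<and>
          linear_direct_sum H [u, v, t] \<and> semidirect_plus_line H v u (u + t)))"
| "der_description (L6 \<delta>) D \<longleftrightarrow>
    (let M = (\<lambda>a b c d. rows [[a, - \<delta> * b, 0], [b, a + b, 0], [c, d, 2 * a + b]]);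
         u = M 1 0 0 0; v = M 0 1 0 0; w = M 0 0 1 0; z = M 0 0 0 1
     in D = {M a b c d | a b c d. True} \<and> matv.dim D = 4 \<and>
        abelian_semidirect D w z u v)"
| "der_description L7 D \<longleftrightarrow>
    (let M = (\<lambda>a b c. rows [[0, 0, 0], [a, b, 0], [c, 0, 0]]);
         u = M 1 0 0; v = M 0 1 0; w = M 0 0 1
     in D = {M a b c | a b c. True} \<and> matv.dim D = 3 \<and>
        semidirect_plus_line D u v w \<and> lie v u = u \<and> line w \<subseteq> lie_center D)"
| "der_description (L8 l) D \<longleftrightarrow>
    (let M = (\<lambda>a b c. rows [[0, 0, 0], [a, b, 0], [c, a, 0]]);
         u = M 1 0 0; v = M 0 1 0; w = M 0 0 1
     in D = {M a b c | a b c. True} \<and> matv.dim D = 3 \<and>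
        semidirect_plus_line D u v w \<and> lie v u = u \<and> line w \<subseteq> lie_center D)"
| "der_description L9 D \<longleftrightarrow>
    (let M = (\<lambda>a b c. rows [[0, 0, 0], [a, b, 0], [c, 0, c]]);
         u = M 1 0 0; v = M 0 1 0; w = M 0 0 1
     in D = {M a b c | a b c. True} \<and> matv.dim D = 3 \<and>
        semidirect_plus_line D u v w \<and> lie v u = u \<and> line w \<subseteq> lie_center D)"
| "der_description (L10 r) D \<longleftrightarrow>
    (let M = (\<lambda>a b c. rows [[0, 0, 0], [a, b, 0], [c, 0, r * c]]);
         u = M 1 0 0; v = M 0 1 0; w = M 0 0 1
     in D = {M a b c | a b c. True} \<and> matv.dim D = 3 \<and>
        semidirect_plus_line D u v w \<and> lie v u = u \<and> line w \<subseteq> lie_center D)"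
| "der_description L11 D \<longleftrightarrow>
    (let M = (\<lambda>a b. rows [[0, 0, 0], [a, b, 0], [0, - a, 2 * b]]);
         u = M 1 0; v = M 0 1
     in D = {M a b | a b. True} \<and> matv.dim D = 2 \<and>
        semidirect D (line u) (line v) \<and> lie v u = u)"
| "der_description L12 D \<longleftrightarrow>
    (let M = (\<lambda>a b c. rows [[a, 0, 0], [b, 2 * a, 0], [c, b, 3 * a]]);
         u = M 1 0 0; v = M 0 1 0; w = M 0 0 1; I = matv.span {v, w}
     in D = {M a b c | a b c. True} \<and> matv.dim D = 3 \<and>
        semidirect D I (line u) \<and> direct_sum I (line v) (line w) \<and>
        lie u v = v \<and> lie u w = 2 *m w)"
| "der_description L13 D \<longleftrightarrow>
    (let M = (\<lambda>a b. rows [[0, 0, 0], [a, a, 0], [b, a, 0]]);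
         u = M 1 0; v = M 0 1
     in D = {M a b | a b. True} \<and> matv.dim D = 2 \<and>
        direct_sum D (line u) (line v) \<and> abelian D)"
| "der_description (L14 \<rho>) D \<longleftrightarrow>
    (if \<rho> \<noteq> 1 then
      (let M = (\<lambda>a b. rows [[0, 0, 0], [a, a, 0], [0, 0, b]]);
           u = M 1 0; v = M 0 1
       in D = {M a b | a b. True} \<and> matv.dim D = 2 \<and>
          direct_sum D (line u) (line v) \<and> abelian D)
     else
      (let M = (\<lambda>a b c d. rows [[0, 0, 0], [a, a, c], [b, b, d]])
       in D = {M a b c d | a b c d. True} \<and> matv.dim D = 4 \<and> isomorphic_gl2 D))"
| "der_description L15 D \<longleftrightarrow>
    (if CHAR('a) \<noteq> 2 then
      (let M = (\<lambda>a b. rows [[0, 0, 0], [a, a, 0], [b, a + b, a]]);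
           u = M 1 0; v = M 0 1
       in D = {M a b | a b. True} \<and> matv.dim D = 2 \<and>
          direct_sum D (line u) (line v) \<and> abelian D)
     else
      (let M = (\<lambda>s a b. rows [[s, 0, 0], [a, a, s], [b, a + b, s + a]]);
           u = M 1 0 0; v = M 0 1 0; w = M 0 0 1
       in D = {M s a b | s a b. True} \<and> matv.dim D = 3 \<and>
          semidirect_plus_line D v u (v + w) \<and> lie u v = v \<and>
          line (v + w) \<subseteq> lie_center D))"
| "der_description (L16 \<beta> \<gamma>) D \<longleftrightarrow>
    (if CHAR('a) \<noteq> 2 \<or> \<gamma> \<noteq> 0 then
      (let M = (\<lambda>a b. rows
             [[0, 0, 0],
              [a, \<beta> * b, \<beta> * (a + \<gamma> * b)],
              [b, a + \<gamma> * b, \<gamma> * a + (\<beta> + \<gamma> ^ 2) * b]]);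
           u = M 1 0; v = M 0 1
       in D = {M a b | a b. True} \<and> matv.dim D = 2 \<and>
          direct_sum D (line u) (line v) \<and> abelian D)
     else
      (let M = (\<lambda>s a b. rows [[s, 0, 0], [a, \<beta> * b, \<beta> * a], [b, a, s + \<beta> * b]]);
           u = M 1 0 0; v = M 0 1 0; w = M 0 0 1
       in D = {M s a b | s a b. True} \<and> matv.dim D = 3 \<and>
          semidirect_plus_line D v u w \<and> lie u v = v \<and> line w \<subseteq> lie_center D))"

end

theory Submission
  imports Defs
begin

text \<open>All squares lie in the left center, and \<open>br x\<close> preserves the left center. If the squares span a
  plane \<open>K\<close>, then \<open>L = F x + K\<close> with \<open>K\<close> the left center, and the algebra is determined by the map
  \<open>br x\<close> from \<open>L\<close> onto \<open>K\<close>: this gives the types \<open>L12\<close>--\<open>L16\<close>. Otherwise the squares span a line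
  \<open>F e\<close>, and \<open>L / F e\<close> is a Lie algebra of dimension 2. If it is not abelian, the types are \<open>L7\<close>,
  \<open>L8\<close>, \<open>L10\<close> and \<open>L11\<close>; if it is abelian and \<open>e\<close> is not right central, the type is \<open>L9\<close>; in the
  remaining case the product is a non-alternating bilinear form on a plane, and the type is \<open>L5\<close> or \<open>L6\<close>
  if there is no isotropic vector, one of \<open>L1\<close>--\<open>L4\<close> otherwise.

  A matrix represents a derivation iff its entries satisfy the 27 linear equations expressing the
  derivation rule on pairs of basis vectors. The structure of the solution space is read off from the
  brackets of its generators.\<close>

section \<open>Fields of characteristic 2\<close>

text \<open>The identity says that every \<open>br x\<close> is a derivation. With equal first two
  arguments it leaves \<open>br (br x x) v = 0\<close>, and for left central \<open>z\<close> it
  makes \<open>br x z\<close> left central. A third independent square would make the left center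
  all of \<open>L\<close> and the product zero, so squares span a line or a plane. The obstacle is
  the arbitrary field. In characteristic 2 a bilinear form does not split into a symmetric and an
  alternating part, so forms are normalized on one side only, by making \<open>br y x\<close>
  vanish, and the existence of a root of a quadratic polynomial takes the place of a discriminant.
  Most exceptional derivation algebras in characteristic 2 come from a coefficient \<open>2\<close>
  in the equations. For \<open>L15\<close> and \<open>L16\<close> it has a conceptual source: a
  derivation \<open>d\<close> that sends the first basis vector to \<open>s\<close> times itself
  modulo \<open>K\<close> satisfies \<open>d A - A d = s A\<close> on \<open>K\<close>, where
  \<open>A\<close> is left multiplication by that vector; hence \<open>s\<close> times the trace of
  \<open>A\<close>, and of \<open>A^2\<close>, is zero.\<close>

lemma two_eq_0_iff_CHAR: "(2::'a::field) = 0 \<longleftrightarrow> CHAR('a) = 2"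
proof -
  have "(2::'a) = 0 \<longleftrightarrow> CHAR('a) dvd 2"
    using of_nat_eq_0_iff_char_dvd[of 2, where 'a = 'a] by simp
  also have "\<dots> \<longleftrightarrow> CHAR('a) = 2"
    using CHAR_not_1'[where 'a = 'a]
    by (auto dest: prime_nat_iff[THEN iffD1, OF two_is_prime_nat, THEN conjunct2, rule_format])
  finally show ?thesis .
qed

text \<open>Used as rewrite rules, these remove signs and coefficients \<open>2\<close>; the last
  one cancels equal summands in a right-nested sum, where \<open>x + x = 0\<close> does not
  match.\<close>

lemma CHAR_2_simps:
  assumes "CHAR('a::field) = 2"
  shows "2 = (0::'a)" "- x = (x::'a)" "x + x = 0" "x - y = x + y" "x + (x + y) = y"
proof -
  show 2: "2 = (0::'a)" using assms two_eq_0_iff_CHAR by blast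
  have "x + x = 2 * x" by simp
  then show xx: "x + x = 0" unfolding 2 by simp
  then show n: "- x = x" by (simp add: eq_neg_iff_add_eq_0 [symmetric] minus_equation_iff)
  have "- y = y" using 2 by (metis mult_2 mult_zero_left neg_eq_iff_add_eq_0)
  then show "x - y = x + y" by (metis diff_conv_add_uminus)
  show "x + (x + y) = y" using xx by (simp add: add.assoc[symmetric])
qed

section \<open>Spans of matrices as Lie algebras\<close>

lemma lie_add_left: "lie (x + y) z = lie x z + lie y z"
  and lie_add_right: "lie z (x + y) = lie z x + lie z y"
  by (simp_all add: lie_def vec_eq_iff matrix_matrix_mult_def sum.distrib algebra_simps)

lemma lie_scale_left: "lie (c *m x) y = c *m lie x y"
  and lie_scale_right: "lie x (c *m y) = c *m lie x y"
  by (simp_all add: lie_def mat_scale_def vec_eq_iff matrix_matrix_mult_def sum_distrib_left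
      algebra_simps)

lemma lie_zero [simp]: "lie 0 y = 0" "lie x 0 = 0"
  by (simp_all add: lie_def)

lemma lie_self [simp]: "lie x x = 0"
  by (simp add: lie_def)

lemma lie_commute: "lie x y = - lie y x"
  by (simp add: lie_def)

text \<open>Bilinearity, one argument at a time. The target \<open>V\<close> is a separate subspace,
  so that the lemma serves ideals and subalgebras (\<open>V\<close> a span) as well as vanishing
  brackets (\<open>V = {0}\<close>).\<close>

lemma lie_span:
  assumes V: "matv.subspace V" and ST: "\<And>x y. x \<in> S \<Longrightarrow> y \<in> T \<Longrightarrow> lie x y \<in> V"
    and "x \<in> matv.span S" "y \<in> matv.span T"
  shows "lie x y \<in> V"
proof -
  have *: "lie x y \<in> V" if "x \<in> S" for x
    using \<open>y \<in> matv.span T\<close>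
    by (induction rule: matv.span_induct_alt)
      (auto simp: lie_add_right lie_scale_right V ST that
        intro!: matv.subspace_add matv.subspace_scale matv.subspace_0)
  show ?thesis
    using \<open>x \<in> matv.span S\<close>
    by (induction rule: matv.span_induct_alt)
      (auto simp: lie_add_left lie_scale_left V *
        intro!: matv.subspace_add matv.subspace_scale matv.subspace_0)
qed

lemma lie_span_commute: "lie x y \<in> matv.span S \<longleftrightarrow> lie y x \<in> matv.span S"
  by (metis lie_commute matv.span_neg minus_minus)

lemma lie_ideal_span:
  assumes "D = matv.span (A \<union> B)"
    and "\<And>x y. x \<in> A \<union> B \<Longrightarrow> y \<in> A \<Longrightarrow> lie x y \<in> matv.span A"
  shows "lie_ideal (matv.span A) D"
  unfolding lie_ideal_def assms(1)
  using assms(2) lie_span[of "matv.span A" "A \<union> B" A] by (auto intro!: matv.span_mono)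

lemma subalgebra_span:
  assumes "D = matv.span (A \<union> B)"
    and "\<And>x y. x \<in> B \<Longrightarrow> y \<in> B \<Longrightarrow> lie x y \<in> matv.span B"
  shows "subalgebra (matv.span B) D"
  unfolding subalgebra_def assms(1)
  using assms(2) lie_span[of "matv.span B" B B] by (auto intro!: matv.span_mono)

text \<open>The coordinates of a common element over \<open>A \<union> B\<close> are its coordinates
  over \<open>A\<close> and also those over \<open>B\<close>; their support lies in both sets, hence
  is empty.\<close>

lemma span_Int_independent:
  assumes "matv.independent (A \<union> B)" "A \<inter> B = {}"
  shows "matv.span A \<inter> matv.span B = {0}"
proof -
  have "x = 0" if "x \<in> matv.span A" "x \<in> matv.span B" for x
  proof -
    have "matv.representation (A \<union> B) x = matv.representation A x"
      "matv.representation (A \<union> B) x = matv.representation B x"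
      using that assms by (auto intro: matv.representation_extend)
    then have "matv.representation A x v = 0" for v
      using assms(2) by (metis matv.representation_ne_zero IntI emptyE)
    then show ?thesis
      using matv.sum_nonzero_representation_eq[of A x] that assms(1)
      by (auto dest: matv.independent_mono[of _ A])
  qed
  then show ?thesis by (auto simp: matv.span_zero)
qed

lemma semidirect_span:
  assumes D: "D = matv.span (A \<union> B)" and ind: "matv.independent (A \<union> B)" "A \<inter> B = {}"
    and AA: "\<And>x y. x \<in> A \<Longrightarrow> y \<in> A \<Longrightarrow> lie x y \<in> matv.span A"
    and BA: "\<And>x y. x \<in> B \<Longrightarrow> y \<in> A \<Longrightarrow> lie x y \<in> matv.span A"
    and BB: "\<And>x y. x \<in> B \<Longrightarrow> y \<in> B \<Longrightarrow> lie x y \<in> matv.span B"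
  shows "semidirect D (matv.span A) (matv.span B)"
  unfolding semidirect_def
proof (intro conjI)
  show "lie_ideal (matv.span A) D"
    using AA BA by (auto intro!: lie_ideal_span[OF D])
  show "subalgebra (matv.span B) D"
    using BB by (rule subalgebra_span[OF D])
  show "D = {x + y |x y. x \<in> matv.span A \<and> y \<in> matv.span B}"
    by (simp add: D matv.span_Un)
qed (rule span_Int_independent[OF ind])

text \<open>Requiring \<open>A\<close> and \<open>B\<close> to commute loses nothing: the bracket of
  two ideals lies in their intersection.\<close>

lemma direct_sum_span:
  assumes D: "D = matv.span (A \<union> B)" and ind: "matv.independent (A \<union> B)" "A \<inter> B = {}"
    and AA: "\<And>x y. x \<in> A \<Longrightarrow> y \<in> A \<Longrightarrow> lie x y \<in> matv.span A"
    and AB: "\<And>x y. x \<in> A \<Longrightarrow> y \<in> B \<Longrightarrow> lie x y = 0"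
    and BB: "\<And>x y. x \<in> B \<Longrightarrow> y \<in> B \<Longrightarrow> lie x y \<in> matv.span B"
  shows "direct_sum D (matv.span A) (matv.span B)"
proof -
  have BA: "lie x y = 0" if "x \<in> B" "y \<in> A" for x y
    using AB[OF that(2,1)] lie_commute[of x y] by simp
  show ?thesis
    unfolding direct_sum_def
  proof (intro conjI)
    show "lie_ideal (matv.span A) D"
      using AA BA by (auto intro!: lie_ideal_span[OF D] simp: matv.span_zero)
    show "lie_ideal (matv.span B) D"
      using AB BB by (intro lie_ideal_span[of D B A]) (auto simp: D matv.span_zero Un_commute)
    show "D = {x + y |x y. x \<in> matv.span A \<and> y \<in> matv.span B}"
      by (simp add: D matv.span_Un)
  qed (rule span_Int_independent[OF ind])
qed

lemma abelian_span:
  assumes "\<And>x y. x \<in> S \<Longrightarrow> y \<in> S \<Longrightarrow> lie x y = 0"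
  shows "abelian (matv.span S)"
  unfolding abelian_def
  using lie_span[of "{0}" S S] assms by (auto simp: matv.subspace_single_0)

lemma line_subset_lie_center:
  assumes "D = matv.span S" "x \<in> D" "\<And>y. y \<in> S \<Longrightarrow> lie x y = 0"
  shows "line x \<subseteq> lie_center D"
proof
  fix z assume z: "z \<in> line x"
  have "z \<in> D"
    using z assms(1,2) matv.span_minimal[of "{x}" D] by auto
  moreover have "lie z y = 0" if "y \<in> D" for y
    using lie_span[of "{0}" "{x}" S] z that assms by (auto simp: matv.subspace_single_0)
  ultimately show "z \<in> lie_center D" by (simp add: lie_center_def)
qed

text \<open>A matrix entry is a linear functional. Below, generators are listed so that each has an
  entry at which all later ones vanish; this triangular shape proves independence without solving
  equations.\<close>

lemma independent_insert_entry:
  assumes "matv.independent S" "x $ i $ j \<noteq> 0" "\<And>y. y \<in> S \<Longrightarrow> y $ i $ j = 0"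
  shows "matv.independent (insert x S)"
proof (rule matv.independent_insertI)
  have "y $ i $ j = 0" if "y \<in> matv.span S" for y
    using that by (induction rule: matv.span_induct_alt) (auto simp: assms(3) mat_scale_def)
  then show "x \<notin> matv.span S" using assms(2) by blast
qed fact

lemma abelian_semidirect_span:
  assumes D: "D = matv.span {x1, x2, y1, y2}" and ind: "matv.independent {x1, x2, y1, y2}"
    and dist: "distinct [x1, x2, y1, y2]"
    and "lie x1 x2 = 0" "lie y1 y2 = 0"
    and "lie y1 x1 \<in> matv.span {x1, x2}" "lie y1 x2 \<in> matv.span {x1, x2}"
    and "lie y2 x1 \<in> matv.span {x1, x2}" "lie y2 x2 \<in> matv.span {x1, x2}"
  shows "abelian_semidirect D x1 x2 y1 y2"
proof -
  have c: "lie x2 x1 = 0" "lie y2 y1 = 0"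
    using assms(4,5) lie_commute[of x2 x1] lie_commute[of y2 y1] by auto
  have i: "matv.independent ({x1} \<union> {x2})" "matv.independent ({y1} \<union> {y2})"
    by (rule matv.independent_mono[OF ind]; auto)+
  have "semidirect D (matv.span {x1, x2}) (matv.span {y1, y2})"
    by (rule semidirect_span)
      (use D ind dist assms(4-) c in \<open>auto simp: matv.span_zero insert_commute\<close>)
  moreover have "direct_sum (matv.span {x1, x2}) (line x1) (line x2)"
    "direct_sum (matv.span {y1, y2}) (line y1) (line y2)"
    by (rule direct_sum_span; use i dist assms(4,5) in \<open>auto simp: matv.span_zero insert_commute\<close>)+
  moreover have "abelian (matv.span {x1, x2})" "abelian (matv.span {y1, y2})"
    by (rule abelian_span; use assms(4,5) c in auto)+
  ultimately show ?thesis by (simp add: abelian_semidirect_def)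
qed

lemma semidirect_plus_line_span:
  assumes D: "D = matv.span {x, y, z}" and ind: "matv.independent {x, y, z}"
    and dist: "distinct [x, y, z]"
    and "lie y x \<in> line x" "lie z x = 0" "lie z y = 0"
  shows "semidirect_plus_line D x y z"
proof -
  have xy: "lie y x \<in> matv.span {x, y}" "lie x y \<in> matv.span {x, y}"
    using assms(4) matv.span_mono[of "{x}" "{x, y}"] lie_span_commute[of x y "{x, y}"] by auto
  have i: "matv.independent ({x} \<union> {y})"
    by (rule matv.independent_mono[OF ind]; auto)
  have "direct_sum D (matv.span {x, y}) (line z)"
    by (rule direct_sum_span)
      (use D ind dist xy assms(5,6) lie_commute[of x z] lie_commute[of y z] in
        \<open>auto simp: matv.span_zero insert_commute\<close>)
  moreover have "semidirect (matv.span {x, y}) (line x) (line y)"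
    by (rule semidirect_span) (use i dist assms(4) in \<open>auto simp: matv.span_zero insert_commute\<close>)
  ultimately show ?thesis by (simp add: semidirect_plus_line_def)
qed

section \<open>Linear parametrizations, dimensions and membership in spans\<close>

lemma span2_range:
  assumes "\<And>a b. M a b = a *m M 1 0 + b *m M 0 1"
  shows "{M a b |a b. True} = matv.span {M 1 0, M 0 1}"
  by (subst assms) (simp add: set_eq_iff matv.span_breakdown_eq diff_diff_eq)

lemma span3_range:
  assumes "\<And>a b c. M a b c = a *m M 1 0 0 + b *m M 0 1 0 + c *m M 0 0 1"
  shows "{M a b c |a b c. True} = matv.span {M 1 0 0, M 0 1 0, M 0 0 1}"
  by (subst assms) (simp add: set_eq_iff matv.span_breakdown_eq diff_diff_eq)

lemma span4_range:
  assumes "\<And>a b c d. M a b c d =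
    a *m M 1 0 0 0 + b *m M 0 1 0 0 + c *m M 0 0 1 0 + d *m M 0 0 0 1"
  shows "{M a b c d |a b c d. True} =
    matv.span {M 1 0 0 0, M 0 1 0 0, M 0 0 1 0, M 0 0 0 1}"
  by (subst assms) (simp add: set_eq_iff matv.span_breakdown_eq diff_diff_eq)

lemma span5_range:
  assumes "\<And>a b c d e. M a b c d e = a *m M 1 0 0 0 0 + b *m M 0 1 0 0 0 + c *m M 0 0 1 0 0 +
    d *m M 0 0 0 1 0 + e *m M 0 0 0 0 1"
  shows "{M a b c d e |a b c d e. True} =
    matv.span {M 1 0 0 0 0, M 0 1 0 0 0, M 0 0 1 0 0, M 0 0 0 1 0, M 0 0 0 0 1}"
  by (subst assms) (simp add: set_eq_iff matv.span_breakdown_eq diff_diff_eq)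

lemma dim_span_distinct:
  assumes "matv.independent (set xs)" "distinct xs"
  shows "matv.dim (matv.span (set xs)) = length xs"
  using matv.dim_span_eq_card_independent[OF assms(1)] distinct_card[OF assms(2)] by metis

lemma abelian_plane_span:
  assumes D: "D = matv.span {u, v}" and ind: "matv.independent {u, v}" and "u \<noteq> v"
    and "lie u v = 0"
  shows "direct_sum D (line u) (line v)" "abelian D"
proof -
  have "lie v u = 0" using assms(4) lie_commute[of v u] by simp
  with assms show "abelian D" by (auto intro: abelian_span)
  show "direct_sum D (line u) (line v)"
    by (rule direct_sum_span) (use assms in \<open>auto simp: matv.span_zero insert_commute\<close>)
qed

text \<open>Generators are named by position, so that a bracket written as an explicit combination
  is recognized as a member of the span. Five positions suffice for the derivation algebras that
  occur.\<close>

lemma span_members: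
  "x1 \<in> matv.span (insert x1 S)" "x2 \<in> matv.span (insert x1 (insert x2 S))"
  "x3 \<in> matv.span (insert x1 (insert x2 (insert x3 S)))"
  "x4 \<in> matv.span (insert x1 (insert x2 (insert x3 (insert x4 S))))"
  "x5 \<in> matv.span (insert x1 (insert x2 (insert x3 (insert x4 (insert x5 S)))))"
  by (auto intro: matv.span_base)

lemmas span_intros = matv.span_scale matv.span_neg matv.span_add matv.span_zero span_members

section \<open>Matrices of derivations\<close>

text \<open>The equation for \<open>i\<close>, \<open>j\<close>, \<open>l\<close> is the
  \<open>l\<close>-th coordinate of the derivation rule on the \<open>i\<close>-th and
  \<open>j\<close>-th basis vectors. Only the multiplication table enters, so each type becomes a
  fixed linear system.\<close>

definition derivation_matrices :: "(3 \<Rightarrow> 3 \<Rightarrow> 'a::field ^ 3) \<Rightarrow> ('a ^ 3 ^ 3) set" where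
  "derivation_matrices C = {M. \<forall>i j l. (\<Sum>k\<in>UNIV. C i j $ k * M $ l $ k) =
      (\<Sum>k\<in>UNIV. M $ k $ i * C k j $ l) + (\<Sum>k\<in>UNIV. M $ k $ j * C i k $ l)}"

lemma derivation_matricesD:
  "M \<in> derivation_matrices C \<Longrightarrow> (\<Sum>k\<in>UNIV. C i j $ k * M $ l $ k) =
      (\<Sum>k\<in>UNIV. M $ k $ i * C k j $ l) + (\<Sum>k\<in>UNIV. M $ k $ j * C i k $ l)"
  by (simp add: derivation_matrices_def)

context nonassoc_algebra
begin

sublocale vector_space_pair scale scale ..

context
  fixes b :: "3 \<Rightarrow> 'v"
  assumes b: "ordered_basis b"
begin

definition coord :: "'v \<Rightarrow> 'a ^ 3" where
  "coord v = (\<chi> i. representation (range b) v (b i))"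

lemma sum_coord: "(\<Sum>i\<in>UNIV. scale (coord v $ i) (b i)) = v"
proof -
  have "v = (\<Sum>x\<in>range b. scale (representation (range b) v x) x)"
    using b by (intro sum_representation_eq[symmetric]) (auto simp: ordered_basis_def)
  also have "\<dots> = (\<Sum>i\<in>UNIV. scale (coord v $ i) (b i))"
    using b by (simp add: sum.reindex coord_def ordered_basis_def)
  finally show ?thesis by simp
qed

lemma coord_add: "coord (x + y) = coord x + coord y"
  using b by (simp add: coord_def vec_eq_iff representation_add ordered_basis_def)

lemma coord_scale: "coord (scale c x) = c *s coord x"
  using b by (simp add: coord_def vec_eq_iff representation_scale ordered_basis_def)

lemma coord_sum: "coord (sum f A) = (\<Sum>x\<in>A. coord (f x))"
  using b by (simp add: coord_def vec_eq_iff representation_sum ordered_basis_def)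

lemma coord_basis: "coord (b i) = axis i 1"
  using b
  by (auto simp: coord_def vec_eq_iff representation_basis ordered_basis_def axis_def inj_eq)

lemma coord_inject: "coord x = coord y \<longleftrightarrow> x = y"
  by (metis sum_coord)

text \<open>The two sides of the derivation rule are bilinear, so the rule holds everywhere once it
  holds on pairs of basis vectors, where it is compared coordinate by coordinate.\<close>

lemma Der_matrices_iff:
  assumes C: "has_mult_table b C"
  shows "M \<in> Der_matrices b \<longleftrightarrow>
    (\<forall>i j l. (\<Sum>k\<in>UNIV. C i j $ k * M $ l $ k) =
      (\<Sum>k\<in>UNIV. M $ k $ i * C k j $ l) + (\<Sum>k\<in>UNIV. M $ k $ j * C i k $ l))"
    (is "_ \<longleftrightarrow> ?R M")
proof -
  have br_l: "br (\<Sum>i\<in>A. scale (f i) (g i)) y = (\<Sum>i\<in>A. scale (f i) (br (g i) y))"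
    for A :: "3 set" and f g y
  proof -
    interpret l: Vector_Spaces.linear scale scale "\<lambda>x. br x y" by (rule linear_left)
    show ?thesis by (simp add: l.sum l.scale)
  qed
  have br_r: "br y (\<Sum>i\<in>A. scale (f i) (g i)) = (\<Sum>i\<in>A. scale (f i) (br y (g i)))"
    for A :: "3 set" and f g y
  proof -
    interpret l: Vector_Spaces.linear scale scale "\<lambda>x. br y x" by (rule linear_right)
    show ?thesis by (simp add: l.sum l.scale)
  qed
  have cbr: "coord (br (b i) (b j)) = C i j" for i j
  proof -
    have "coord (br (b i) (b j)) = (\<Sum>k\<in>UNIV. C i j $ k *s axis k 1)"
      using C by (simp add: has_mult_table_def coord_sum coord_scale coord_basis)
    also have "\<dots> = C i j"
      by (simp add: vec_eq_iff axis_def if_distrib cong: if_cong)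
    finally show ?thesis .
  qed
  have key: "d (br (b i) (b j)) = br (d (b i)) (b j) + br (b i) (d (b j)) \<longleftrightarrow>
     (\<forall>l. (\<Sum>k\<in>UNIV. C i j $ k * M $ l $ k) =
      (\<Sum>k\<in>UNIV. M $ k $ i * C k j $ l) + (\<Sum>k\<in>UNIV. M $ k $ j * C i k $ l))"
    if d: "Vector_Spaces.linear scale scale d" and M: "\<And>j. coord (d (b j)) = column j M" for d M i j
  proof -
    interpret d: Vector_Spaces.linear scale scale d by (rule d)
    have db: "d (b j) = (\<Sum>k\<in>UNIV. scale (M $ k $ j) (b k))" for j
      using sum_coord[of "d (b j)"] M by (simp add: column_def)
    have "br (b i) (b j) = (\<Sum>k\<in>UNIV. scale (C i j $ k) (b k))"
      using C by (simp add: has_mult_table_def)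
    then have "coord (d (br (b i) (b j))) = (\<Sum>k\<in>UNIV. C i j $ k *s column k M)"
      by (simp add: d.sum d.scale coord_sum coord_scale M)
    moreover have "coord (br (d (b i)) (b j) + br (b i) (d (b j))) =
        (\<Sum>k\<in>UNIV. M $ k $ i *s C k j) + (\<Sum>k\<in>UNIV. M $ k $ j *s C i k)"
      by (simp add: db br_l br_r coord_add coord_sum coord_scale cbr)
    ultimately show ?thesis
      by (simp add: coord_inject[symmetric] vec_eq_iff column_def)
  qed
  show ?thesis
  proof
    assume "M \<in> Der_matrices b"
    then obtain d where d: "d \<in> derivations" and M: "M = matrix_wrt b d"
      by (auto simp: Der_matrices_def)
    show "?R M"
      using d key[of d M] by (auto simp: derivations_def M matrix_wrt_def column_def coord_def)
  next
    assume R: "?R M"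
    \<comment> \<open>\<open>inv b\<close> recovers the index of a basis vector, so \<open>d\<close>
      is the linear map with the columns of \<open>M\<close>.\<close>
    define d where "d = construct (range b) (\<lambda>x. \<Sum>k\<in>UNIV. scale (M $ k $ (inv b x)) (b k))"
    have lin: "Vector_Spaces.linear scale scale d"
      unfolding d_def using b by (intro linear_construct) (auto simp: ordered_basis_def)
    have "d (b j) = (\<Sum>k\<in>UNIV. scale (M $ k $ j) (b k))" for j
      unfolding d_def using b by (subst construct_basis) (auto simp: ordered_basis_def)
    then have M: "coord (d (b j)) = column j M" for j
      by (simp add: coord_sum coord_scale coord_basis)
        (simp add: vec_eq_iff axis_def column_def if_distrib cong: if_cong)
    interpret d: Vector_Spaces.linear scale scale d by (rule lin)
    have bb: "d (br (b i) (b j)) = br (d (b i)) (b j) + br (b i) (d (b j))" for i j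
      using key[OF lin M] R by blast
    \<comment> \<open>The arguments are freed from the basis one after the other: the first here,
      the second below.\<close>
    have xb: "d (br x (b j)) = br (d x) (b j) + br x (d (b j))" for x j
    proof (rule linear_eq_on[where B = "range b" and x = x
          and f = "\<lambda>x. d (br x (b j))" and g = "\<lambda>x. br (d x) (b j) + br x (d (b j))"])
      show "Vector_Spaces.linear scale scale (\<lambda>x. d (br x (b j)))"
        using Vector_Spaces.linear_compose[OF linear_left lin] by (simp add: o_def)
      show "Vector_Spaces.linear scale scale (\<lambda>x. br (d x) (b j) + br x (d (b j)))"
        using Vector_Spaces.linear_compose[OF lin linear_left]
        by (intro linear_compose_add linear_left) (simp add: o_def)
    qed (use b bb in \<open>auto simp: ordered_basis_def\<close>)
    have "d (br x y) = br (d x) y + br x (d y)" for x y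
    proof (rule linear_eq_on[where B = "range b" and x = y
          and f = "\<lambda>y. d (br x y)" and g = "\<lambda>y. br (d x) y + br x (d y)"])
      show "Vector_Spaces.linear scale scale (\<lambda>y. d (br x y))"
        using Vector_Spaces.linear_compose[OF linear_right lin] by (simp add: o_def)
      show "Vector_Spaces.linear scale scale (\<lambda>y. br (d x) y + br x (d y))"
        using Vector_Spaces.linear_compose[OF lin linear_right]
        by (intro linear_compose_add linear_right) (simp add: o_def)
    qed (use b xb in \<open>auto simp: ordered_basis_def\<close>)
    then have "d \<in> derivations" using lin by (simp add: derivations_def)
    moreover have "matrix_wrt b d = M"
      using M by (simp add: matrix_wrt_def coord_def column_def vec_eq_iff)
    ultimately show "M \<in> Der_matrices b" by (auto simp: Der_matrices_def)
  qed
qed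

lemma Der_matrices_eq: "has_mult_table b C \<Longrightarrow> Der_matrices b = derivation_matrices C"
  by (auto simp: Der_matrices_iff derivation_matrices_def)

end

end

section \<open>Derivations of the sixteen types\<close>

lemmas derivation_eqs = derivation_matrices_def forall_3 sum_3 products_def axis_def

lemmas mat3_simps = vec_eq_iff forall_3 lie_def matrix_matrix_mult_def sum_3 mat_scale_def

section \<open>Types \<open>L1\<close> to \<open>L6\<close>: a bilinear form on a plane\<close>

lemma der_L1:
  fixes D :: "('a::field ^ 3 ^ 3) set"
  assumes tab: "D = derivation_matrices (mult_table L1)"
  shows "der_description L1 D"
proof -
  let ?M = "\<lambda>a b c d e. rows [[a, 0, 0], [b, d, 0], [c, e, 2 * a]] :: 'a ^ 3 ^ 3"
  define u v w z t where g: "u = ?M 1 0 0 0 0" "v = ?M 0 1 0 0 0" "w = ?M 0 0 1 0 0"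
    "z = ?M 0 0 0 1 0" "t = ?M 0 0 0 0 1"
  \<comment> \<open>Here simplification solves all 27 equations. For types that need division by a
    parameter or by \<open>2\<close>, the decisive equations are extracted by their indices.\<close>
  have "X \<in> D \<longleftrightarrow> (\<exists>a b c d e. X = ?M a b c d e)" for X
    unfolding tab by (simp add: derivation_eqs vec_eq_iff) (auto simp: algebra_simps)
  then have D: "D = {?M a b c d e |a b c d e. True}" by blast
  have sp: "D = matv.span {u, v, w, z, t}"
    unfolding D g by (rule span5_range) (simp add: mat3_simps algebra_simps)
  have ind: "matv.independent {u, v, w, z, t}"
    by (rule independent_insert_entry[where i = 1 and j = 1],
        rule independent_insert_entry[where i = 2 and j = 1],
        rule independent_insert_entry[where i = 3 and j = 1],
        rule independent_insert_entry[where i = 2 and j = 2],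
        rule independent_insert_entry[where i = 3 and j = 2])
      (auto simp: g matv.independent_empty)
  have dist: "distinct [u, v, w, z, t]"
    by (auto simp: g mat3_simps)
  have dim: "matv.dim D = 5"
    using dim_span_distinct[of "[u, v, w, z, t]"] ind dist sp by (simp add: insert_commute)
  \<comment> \<open>The ideal spanned by \<open>v\<close>, \<open>w\<close>, \<open>t\<close> is a
    Heisenberg algebra with center \<open>w\<close>, on which the diagonal matrices \<open>u\<close>
    and \<open>z\<close> act.\<close>
  have lie: "lie v t = - w" "lie u z = 0" "lie u v = - v" "lie u w = w" "lie u t = 2 *m t"
    "lie v w = 0" "lie z v = v" "lie z w = 0" "lie z t = - t" "lie w t = 0" "lie t v = w"
    "lie w v = 0" "lie t w = 0"
    by (simp_all add: g mat3_simps algebra_simps)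
  have "semidirect D (matv.span {v, w, t}) (matv.span {u, z})"
    by (rule semidirect_span)
      (use sp ind dist lie_commute[of z u] in \<open>auto simp: lie insert_commute intro!: span_intros\<close>)
  moreover have "matv.independent {v, w, t}" "matv.independent {u, z}"
    by (rule matv.independent_mono[OF ind]; auto)+
  moreover from this have "direct_sum (matv.span {u, z}) (line u) (line z)"
    "abelian (matv.span {u, z})"
    using dist lie by (auto intro!: abelian_plane_span)
  ultimately show ?thesis
    unfolding der_description.simps Let_def g[symmetric]
    using D dim lie dist
    by (simp add: linear_direct_sum_def)
qed

lemma der_L2:
  fixes D :: "('a::field ^ 3 ^ 3) set"
  assumes tab: "D = derivation_matrices (mult_table L2)"
  shows "der_description L2 D"
proof -
  let ?M = "\<lambda>a b c d. rows [[a, 0, 0], [b, a + b, 0], [c, d, 2 * a + b]] :: 'a ^ 3 ^ 3"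
  define u v w z where g: "u = ?M 1 0 0 0" "v = ?M 0 1 0 0" "w = ?M 0 0 1 0" "z = ?M 0 0 0 1"
  have "X \<in> D \<longleftrightarrow> (\<exists>a b c d. X = ?M a b c d)" for X
    unfolding tab by (simp add: derivation_eqs vec_eq_iff) (auto simp: algebra_simps)
  then have D: "D = {?M a b c d |a b c d. True}" by blast
  have sp: "D = matv.span {u, v, w, z}"
    unfolding D g by (rule span4_range) (simp add: mat3_simps algebra_simps)
  have ind: "matv.independent {u, v, w, z}"
    by (rule independent_insert_entry[where i = 1 and j = 1],
        rule independent_insert_entry[where i = 2 and j = 1],
        rule independent_insert_entry[where i = 3 and j = 1],
        rule independent_insert_entry[where i = 3 and j = 2])
      (auto simp: g matv.independent_empty)
  have dist: "distinct [u, v, w, z]"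
    by (auto simp: g mat3_simps)
  have dim: "matv.dim D = 4"
    using dim_span_distinct[of "[u, v, w, z]"] ind dist sp by (simp add: insert_commute)
  have lie: "lie w z = 0" "lie u v = 0" "lie u w = w" "lie u z = z" "lie v w = w" "lie v z = - w"
    by (simp_all add: g mat3_simps algebra_simps)
  have "abelian_semidirect D w z u v"
    by (rule abelian_semidirect_span)
      (use sp ind dist in \<open>auto simp: lie insert_commute intro!: span_intros\<close>)
  show ?thesis
    unfolding der_description.simps Let_def g[symmetric]
    using D dim lie \<open>abelian_semidirect D w z u v\<close>
    by simp
qed

lemma der_L3:
  fixes D :: "('a::field ^ 3 ^ 3) set"
  assumes tab: "D = derivation_matrices (mult_table (L3 \<alpha>))"
    and hyp: "\<alpha> \<noteq> 0" "\<alpha> \<noteq> - 1"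
  shows "der_description (L3 \<alpha>) D"
proof -
  let ?M = "\<lambda>a b c d. rows
    [[a, 0, 0], [b, a + (1 + \<alpha>) * b, 0], [c, d, 2 * a + (1 + \<alpha>) * b]] :: 'a ^ 3 ^ 3"
  define u v w z where g: "u = ?M 1 0 0 0" "v = ?M 0 1 0 0" "w = ?M 0 0 1 0" "z = ?M 0 0 0 1"
  have "X \<in> D \<longleftrightarrow> (\<exists>a b c d. X = ?M a b c d)" for X
  proof
    assume "X \<in> D"
    then have X: "X \<in> derivation_matrices (mult_table (L3 \<alpha>))" by (simp only: tab)
    have e1: "X $ 1 $ 3 = 0"
      using derivation_matricesD[OF X, of 1 1 1] hyp
      by (simp add: derivation_eqs two_eq_0_iff_CHAR)
    have e2: "X $ 2 $ 3 = 0"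
      using derivation_matricesD[OF X, of 1 1 2] hyp
      by (simp add: derivation_eqs two_eq_0_iff_CHAR)
    have e3: "X $ 3 $ 3 = 2 * X $ 1 $ 1 + (X $ 2 $ 1 + X $ 2 $ 1 * \<alpha>)"
      using derivation_matricesD[OF X, of 1 1 3] hyp
      by (simp add: derivation_eqs two_eq_0_iff_CHAR)
    have e4: "X $ 3 $ 3 = X $ 1 $ 2 + X $ 2 $ 2 + X $ 1 $ 1"
      using derivation_matricesD[OF X, of 2 1 3] hyp
      by (simp add: derivation_eqs two_eq_0_iff_CHAR)
    \<comment> \<open>The second basis vector has square zero, which yields this equation;
      \<open>\<alpha> \<noteq> - 1\<close> then clears the entry. At \<open>- 1\<close>, the type
      \<open>L4\<close>, it would say nothing.\<close>
    have e5: "X $ 1 $ 2 * \<alpha> + X $ 1 $ 2 = 0"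
      using derivation_matricesD[OF X, of 2 2 3] hyp
      by (simp add: derivation_eqs two_eq_0_iff_CHAR)
    note e = e1 e2 e3 e4 e5
    have "X $ 1 $ 2 * (\<alpha> + 1) = 0"
      using e(5) by (simp add: algebra_simps)
    have "X $ 1 $ 2 = 0"
      using \<open>X $ 1 $ 2 * (\<alpha> + 1) = 0\<close> hyp(2) by (simp add: add_eq_0_iff2)
    have "X $ 2 $ 2 = X $ 1 $ 1 + (1 + \<alpha>) * X $ 2 $ 1"
      using e(3,4) \<open>X $ 1 $ 2 = 0\<close> by algebra
    have "X $ 3 $ 3 = 2 * X $ 1 $ 1 + (1 + \<alpha>) * X $ 2 $ 1"
      using e(3) by algebra
    with e \<open>X $ 1 $ 2 = 0\<close>
      \<open>X $ 2 $ 2 = X $ 1 $ 1 + (1 + \<alpha>) * X $ 2 $ 1\<close>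
    show "\<exists>a b c d. X = ?M a b c d"
      by (simp add: vec_eq_iff forall_3)
  next
    assume "\<exists>a b c d. X = ?M a b c d"
    then show "X \<in> D"
      unfolding tab using hyp by (auto simp: derivation_eqs algebra_simps power2_eq_square)
  qed
  then have D: "D = {?M a b c d |a b c d. True}" by blast
  have sp: "D = matv.span {u, v, w, z}"
    unfolding D g by (rule span4_range) (simp add: mat3_simps algebra_simps)
  have ind: "matv.independent {u, v, w, z}"
    by (rule independent_insert_entry[where i = 1 and j = 1],
        rule independent_insert_entry[where i = 2 and j = 1],
        rule independent_insert_entry[where i = 3 and j = 1],
        rule independent_insert_entry[where i = 3 and j = 2])
      (auto simp: g matv.independent_empty)
  have dist: "distinct [u, v, w, z]"
    by (auto simp: g mat3_simps)
  have dim: "matv.dim D = 4"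
    using dim_span_distinct[of "[u, v, w, z]"] ind dist sp by (simp add: insert_commute)
  have lie: "lie w z = 0" "lie u v = 0" "lie u w = w" "lie u z = z"
    "lie v w = (1 + \<alpha>) *m w" "lie v z = - w"
    by (simp_all add: g mat3_simps algebra_simps)
  have "abelian_semidirect D w z u v"
    by (rule abelian_semidirect_span)
      (use sp ind dist in \<open>auto simp: lie insert_commute intro!: span_intros\<close>)
  show ?thesis
    unfolding der_description.simps Let_def g[symmetric]
    using D dim lie \<open>abelian_semidirect D w z u v\<close>
    by simp
qed

lemma der_L4:
  fixes D :: "('a::field ^ 3 ^ 3) set"
  assumes tab: "D = derivation_matrices (mult_table L4)"
    and hyp: "CHAR('a) \<noteq> 2"
  shows "der_description L4 D"
proof -
  let ?M = "\<lambda>a b c d. rows [[a, 0, 0], [b, a, 0], [c, d, 2 * a]] :: 'a ^ 3 ^ 3"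
  define u v w z where g: "u = ?M 1 0 0 0" "v = ?M 0 1 0 0" "w = ?M 0 0 1 0" "z = ?M 0 0 0 1"
  have "X \<in> D \<longleftrightarrow> (\<exists>a b c d. X = ?M a b c d)" for X
  proof
    assume "X \<in> D"
    then have X: "X \<in> derivation_matrices (mult_table L4)" by (simp only: tab)
    have e1: "X $ 1 $ 3 = 0"
      using derivation_matricesD[OF X, of 1 1 1] hyp
      by (simp add: derivation_eqs two_eq_0_iff_CHAR)
    have e2: "X $ 2 $ 3 = 0"
      using derivation_matricesD[OF X, of 1 1 2] hyp
      by (simp add: derivation_eqs two_eq_0_iff_CHAR)
    have e3: "X $ 3 $ 3 = 2 * X $ 1 $ 1"
      using derivation_matricesD[OF X, of 1 1 3] hyp
      by (simp add: derivation_eqs two_eq_0_iff_CHAR)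
    have e4: "- X $ 3 $ 3 = X $ 1 $ 2 - X $ 2 $ 2 - X $ 1 $ 1"
      using derivation_matricesD[OF X, of 1 2 3] hyp
      by (simp add: derivation_eqs two_eq_0_iff_CHAR)
    have e5: "X $ 3 $ 3 = X $ 1 $ 2 + X $ 2 $ 2 + X $ 1 $ 1"
      using derivation_matricesD[OF X, of 2 1 3] hyp
      by (simp add: derivation_eqs two_eq_0_iff_CHAR)
    note e = e1 e2 e3 e4 e5
    \<comment> \<open>The equations at \<open>(1, 2)\<close> and \<open>(2, 1)\<close> come from
      products of opposite sign, so their sum leaves only this. In characteristic 2 the entry stays
      free.\<close>
    have "2 * X $ 1 $ 2 = 0"
      using e(3-5) by algebra
    have "X $ 1 $ 2 = 0"
      using \<open>2 * X $ 1 $ 2 = 0\<close> hyp by (simp add: two_eq_0_iff_CHAR)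
    have "X $ 2 $ 2 = X $ 1 $ 1 \<and> X $ 1 $ 2 = 0"
      using e \<open>X $ 1 $ 2 = 0\<close> by (simp add: algebra_simps)
    with e show "\<exists>a b c d. X = ?M a b c d"
      by (simp add: vec_eq_iff forall_3)
  next
    assume "\<exists>a b c d. X = ?M a b c d"
    then show "X \<in> D"
      unfolding tab using hyp by (auto simp: derivation_eqs algebra_simps power2_eq_square)
  qed
  then have D: "D = {?M a b c d |a b c d. True}" by blast
  have sp: "D = matv.span {u, v, w, z}"
    unfolding D g by (rule span4_range) (simp add: mat3_simps algebra_simps)
  have ind: "matv.independent {u, v, w, z}"
    by (rule independent_insert_entry[where i = 1 and j = 1],
        rule independent_insert_entry[where i = 2 and j = 1],
        rule independent_insert_entry[where i = 3 and j = 1],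
        rule independent_insert_entry[where i = 3 and j = 2])
      (auto simp: g matv.independent_empty)
  have dist: "distinct [u, v, w, z]"
    by (auto simp: g mat3_simps)
  have dim: "matv.dim D = 4"
    using dim_span_distinct[of "[u, v, w, z]"] ind dist sp by (simp add: insert_commute)
  have lie: "lie w z = 0" "lie u v = 0" "lie u w = w" "lie u z = z" "lie v w = 0" "lie v z = - w"
    by (simp_all add: g mat3_simps algebra_simps)
  have "abelian_semidirect D w z u v"
    by (rule abelian_semidirect_span)
      (use sp ind dist in \<open>auto simp: lie insert_commute intro!: span_intros\<close>)
  show ?thesis
    unfolding der_description.simps Let_def g[symmetric]
    using D dim lie \<open>abelian_semidirect D w z u v\<close> hyp
    by simp
qed

lemma der_L4_CHAR_2:
  fixes D :: "('a::field ^ 3 ^ 3) set"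
  assumes tab: "D = derivation_matrices (mult_table L4)"
    and hyp: "CHAR('a) = 2"
  shows "der_description L4 D"
proof -
  let ?M = "\<lambda>a p b c d. rows [[a, p, 0], [b, a + p, 0], [c, d, 0]] :: 'a ^ 3 ^ 3"
  define u v w z t where g: "u = ?M 1 0 0 0 0" "v = ?M 0 1 0 0 0" "w = ?M 0 0 1 0 0"
    "z = ?M 0 0 0 1 0" "t = ?M 0 0 0 0 1"
  note two = CHAR_2_simps[OF hyp(1)]
  have "X \<in> D \<longleftrightarrow> (\<exists>a p b c d. X = ?M a p b c d)" for X
  proof
    assume "X \<in> D"
    then have X: "X \<in> derivation_matrices (mult_table L4)" by (simp only: tab)
    have e1: "X $ 1 $ 3 = 0"
      using derivation_matricesD[OF X, of 1 1 1] hyp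
      by (simp add: derivation_eqs two_eq_0_iff_CHAR two)
    have e2: "X $ 2 $ 3 = 0"
      using derivation_matricesD[OF X, of 1 1 2] hyp
      by (simp add: derivation_eqs two_eq_0_iff_CHAR two)
    have e3: "X $ 3 $ 3 = 0"
      using derivation_matricesD[OF X, of 1 1 3] hyp
      by (simp add: derivation_eqs two_eq_0_iff_CHAR two)
    have e4: "X $ 3 $ 3 = X $ 1 $ 2 + X $ 2 $ 2 + X $ 1 $ 1"
      using derivation_matricesD[OF X, of 1 2 3] hyp
      by (simp add: derivation_eqs two_eq_0_iff_CHAR two)
    note e = e1 e2 e3 e4
    have "X $ 2 $ 2 = X $ 1 $ 1 + X $ 1 $ 2"
      using e(3,4) two(5)[of "X $ 2 $ 2" "X $ 1 $ 1 + X $ 1 $ 2"] by (simp add: ac_simps)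
    with e show "\<exists>a p b c d. X = ?M a p b c d"
      by (simp add: vec_eq_iff forall_3)
  next
    assume "\<exists>a p b c d. X = ?M a p b c d"
    then show "X \<in> D"
      unfolding tab using hyp by (auto simp: derivation_eqs algebra_simps power2_eq_square two)
  qed
  then have D: "D = {?M a p b c d |a p b c d. True}" by blast
  have sp: "D = matv.span {u, v, w, z, t}"
    unfolding D g by (rule span5_range) (simp add: mat3_simps algebra_simps)
  have ind: "matv.independent {u, v, w, z, t}"
    by (rule independent_insert_entry[where i = 1 and j = 1],
        rule independent_insert_entry[where i = 1 and j = 2],
        rule independent_insert_entry[where i = 2 and j = 1],
        rule independent_insert_entry[where i = 3 and j = 1],
        rule independent_insert_entry[where i = 3 and j = 2])
      (auto simp: g matv.independent_empty)
  have dist: "distinct [u, v, w, z, t]"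
    by (auto simp: g mat3_simps)
  have dim: "matv.dim D = 5"
    using dim_span_distinct[of "[u, v, w, z, t]"] ind dist sp by (simp add: insert_commute)
  have lie: "lie z t = 0" "lie t z = 0" "lie u z = - z" "lie u t = - t" "lie v z = - t"
    "lie v t = - t" "lie w z = 0" "lie w t = - z" "lie v w = u + w" "lie w v = u + w"
    "lie u v = 0" "lie v u = 0" "lie u w = 0" "lie w u = 0" "lie v (u + w) = u + w"
    "lie u (u + w) = 0"
    by (simp_all add: g mat3_simps algebra_simps two)
  \<comment> \<open>In characteristic 2, \<open>u\<close> is the identity on the first two
    coordinates and commutes with \<open>v\<close> and \<open>w\<close>. The derived algebra of
    \<open>H\<close> is spanned by \<open>lie v w = u + w\<close>, which explains this
    basis.\<close>
  have ind': "matv.independent {u + w, v, u}"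
    by (rule independent_insert_entry[where i = 2 and j = 1],
        rule independent_insert_entry[where i = 1 and j = 2],
        rule independent_insert_entry[where i = 1 and j = 1])
      (auto simp: g matv.independent_empty)
  have dist': "distinct [u + w, v, u]"
    by (auto simp: g mat3_simps)
  have "semidirect_plus_line (matv.span {u + w, v, u}) (u + w) v u"
    by (rule semidirect_plus_line_span[OF refl ind' dist'])
      (auto simp: lie intro!: span_intros)
  moreover have "semidirect D (matv.span {z, t}) (matv.span {u, v, w})"
    by (rule semidirect_span)
      (use sp ind dist in \<open>auto simp: lie insert_commute intro!: span_intros\<close>)
  moreover have "matv.independent {z, t}" "matv.independent {u, v, w}"
    by (rule matv.independent_mono[OF ind]; auto)+
  moreover from this have "direct_sum (matv.span {z, t}) (line z) (line t)"
    using dist lie by (auto intro!: abelian_plane_span)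
  moreover have "matv.span {u, v, w} = matv.span {u + w, v, u}"
    using matv.span_diff[of "u + w" "{u + w, v, u}" u]
    by (auto simp: matv.span_eq intro: span_intros)
  ultimately show ?thesis
    unfolding der_description.simps Let_def g[symmetric]
    using hyp D dim lie dist
    by (simp add: linear_direct_sum_def)
qed

lemma der_L5:
  fixes D :: "('a::field ^ 3 ^ 3) set"
  assumes tab: "D = derivation_matrices (mult_table (L5 \<beta>))"
    and hyp: "CHAR('a) \<noteq> 2" "\<beta> \<noteq> 0"
  shows "der_description (L5 \<beta>) D"
proof -
  let ?M = "\<lambda>a b c d. rows [[a, - \<beta> * b, 0], [b, a, 0], [c, d, 2 * a]] :: 'a ^ 3 ^ 3"
  define u v w z where g: "u = ?M 1 0 0 0" "v = ?M 0 1 0 0" "w = ?M 0 0 1 0" "z = ?M 0 0 0 1"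
  have "X \<in> D \<longleftrightarrow> (\<exists>a b c d. X = ?M a b c d)" for X
  proof
    assume "X \<in> D"
    then have X: "X \<in> derivation_matrices (mult_table (L5 \<beta>))" by (simp only: tab)
    have e1: "X $ 1 $ 3 = 0"
      using derivation_matricesD[OF X, of 1 1 1] hyp
      by (simp add: derivation_eqs two_eq_0_iff_CHAR)
    have e2: "X $ 2 $ 3 = 0"
      using derivation_matricesD[OF X, of 1 1 2] hyp
      by (simp add: derivation_eqs two_eq_0_iff_CHAR)
    have e3: "X $ 3 $ 3 = 2 * X $ 1 $ 1"
      using derivation_matricesD[OF X, of 1 1 3] hyp
      by (simp add: derivation_eqs two_eq_0_iff_CHAR)
    have e4: "X $ 1 $ 2 + X $ 2 $ 1 * \<beta> = 0"
      using derivation_matricesD[OF X, of 2 1 3] hyp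
      by (simp add: derivation_eqs two_eq_0_iff_CHAR)
    have e5: "X $ 3 $ 3 = 2 * X $ 2 $ 2"
      using derivation_matricesD[OF X, of 2 2 3] hyp
      by (simp add: derivation_eqs two_eq_0_iff_CHAR)
    note e = e1 e2 e3 e4 e5
    \<comment> \<open>The squares of the first two basis vectors are nonzero multiples of the third,
      so \<open>X $ 3 $ 3\<close> is twice either diagonal entry. In characteristic 2 it is zero
      instead, and the two diagonal entries are unrelated.\<close>
    have "2 * (X $ 2 $ 2 - X $ 1 $ 1) = 0"
      using e(3,5) by algebra
    have "X $ 2 $ 2 = X $ 1 $ 1"
      using \<open>2 * (X $ 2 $ 2 - X $ 1 $ 1) = 0\<close> hyp(1) by (simp add: two_eq_0_iff_CHAR)
    have "X $ 2 $ 2 = X $ 1 $ 1 \<and> X $ 1 $ 2 = - \<beta> * X $ 2 $ 1"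
      using e \<open>X $ 2 $ 2 = X $ 1 $ 1\<close> by (simp add: eq_neg_iff_add_eq_0 mult.commute)
    with e show "\<exists>a b c d. X = ?M a b c d"
      by (simp add: vec_eq_iff forall_3)
  next
    assume "\<exists>a b c d. X = ?M a b c d"
    then show "X \<in> D"
      unfolding tab using hyp by (auto simp: derivation_eqs algebra_simps power2_eq_square)
  qed
  then have D: "D = {?M a b c d |a b c d. True}" by blast
  have sp: "D = matv.span {u, v, w, z}"
    unfolding D g by (rule span4_range) (simp add: mat3_simps algebra_simps)
  have ind: "matv.independent {u, v, w, z}"
    by (rule independent_insert_entry[where i = 1 and j = 1],
        rule independent_insert_entry[where i = 2 and j = 1],
        rule independent_insert_entry[where i = 3 and j = 1],
        rule independent_insert_entry[where i = 3 and j = 2])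
      (auto simp: g matv.independent_empty)
  have dist: "distinct [u, v, w, z]"
    by (auto simp: g mat3_simps)
  have dim: "matv.dim D = 4"
    using dim_span_distinct[of "[u, v, w, z]"] ind dist sp by (simp add: insert_commute)
  have lie: "lie w z = 0" "lie u v = 0" "lie u w = w" "lie u z = z" "lie v w = \<beta> *m z"
    "lie v z = - w"
    by (simp_all add: g mat3_simps algebra_simps)
  have "abelian_semidirect D w z u v"
    by (rule abelian_semidirect_span)
      (use sp ind dist in \<open>auto simp: lie insert_commute intro!: span_intros\<close>)
  show ?thesis
    unfolding der_description.simps Let_def g[symmetric]
    using D dim lie \<open>abelian_semidirect D w z u v\<close> hyp
    by simp
qed

lemma der_L5_CHAR_2:
  fixes D :: "('a::field ^ 3 ^ 3) set"
  assumes tab: "D = derivation_matrices (mult_table (L5 \<beta>))"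
    and hyp: "CHAR('a) = 2" "\<beta> \<noteq> 0"
  shows "der_description (L5 \<beta>) D"
proof -
  let ?M = "\<lambda>a b c d e. rows [[a, \<beta> * b, 0], [b, e, 0], [c, d, 0]] :: 'a ^ 3 ^ 3"
  define u v w z t where g: "u = ?M 1 0 0 0 0" "v = ?M 0 1 0 0 0" "w = ?M 0 0 1 0 0"
    "z = ?M 0 0 0 1 0" "t = ?M 0 0 0 0 1"
  note two = CHAR_2_simps[OF hyp(1)]
  have "X \<in> D \<longleftrightarrow> (\<exists>a b c d e. X = ?M a b c d e)" for X
  proof
    assume "X \<in> D"
    then have X: "X \<in> derivation_matrices (mult_table (L5 \<beta>))" by (simp only: tab)
    have e1: "X $ 1 $ 3 = 0"
      using derivation_matricesD[OF X, of 1 1 1] hyp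
      by (simp add: derivation_eqs two_eq_0_iff_CHAR two)
    have e2: "X $ 2 $ 3 = 0"
      using derivation_matricesD[OF X, of 1 1 2] hyp
      by (simp add: derivation_eqs two_eq_0_iff_CHAR two)
    have e3: "X $ 3 $ 3 = 0"
      using derivation_matricesD[OF X, of 1 1 3] hyp
      by (simp add: derivation_eqs two_eq_0_iff_CHAR two)
    have e4: "X $ 1 $ 2 + X $ 2 $ 1 * \<beta> = 0"
      using derivation_matricesD[OF X, of 2 1 3] hyp
      by (simp add: derivation_eqs two_eq_0_iff_CHAR two)
    note e = e1 e2 e3 e4
    have "X $ 1 $ 2 = \<beta> * X $ 2 $ 1"
      using e(4) two(2)[of "X $ 2 $ 1 * \<beta>"]
      by (simp add: eq_neg_iff_add_eq_0[symmetric] mult.commute)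
    with e show "\<exists>a b c d e. X = ?M a b c d e"
      by (simp add: vec_eq_iff forall_3)
  next
    assume "\<exists>a b c d e. X = ?M a b c d e"
    then show "X \<in> D"
      unfolding tab using hyp by (auto simp: derivation_eqs algebra_simps power2_eq_square two)
  qed
  then have D: "D = {?M a b c d e |a b c d e. True}" by blast
  have sp: "D = matv.span {u, v, w, z, t}"
    unfolding D g by (rule span5_range) (simp add: mat3_simps algebra_simps)
  have ind: "matv.independent {u, v, w, z, t}"
    by (rule independent_insert_entry[where i = 1 and j = 1],
        rule independent_insert_entry[where i = 2 and j = 1],
        rule independent_insert_entry[where i = 3 and j = 1],
        rule independent_insert_entry[where i = 3 and j = 2],
        rule independent_insert_entry[where i = 2 and j = 2])
      (auto simp: g matv.independent_empty)
  have dist: "distinct [u, v, w, z, t]"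
    by (auto simp: g mat3_simps)
  have dim: "matv.dim D = 5"
    using dim_span_distinct[of "[u, v, w, z, t]"] ind dist sp by (simp add: insert_commute)
  have lie: "lie w z = 0" "lie z w = 0" "lie u w = - w" "lie u z = 0" "lie v w = - (\<beta> *m z)"
    "lie v z = - w" "lie t w = 0" "lie t z = - z" "lie u v = v" "lie v u = v" "lie t v = v"
    "lie v t = v" "lie u t = 0" "lie t u = 0" "lie (u + t) v = 0" "lie (u + t) u = 0"
    by (simp_all add: g mat3_simps algebra_simps two)
  \<comment> \<open>\<open>u + t\<close> precedes \<open>u\<close> here because \<open>u\<close> has
    no nonzero entry at which \<open>u + t\<close> vanishes.\<close>
  have "matv.independent {v, u + t, u}"
    by (rule independent_insert_entry[where i = 2 and j = 1],
        rule independent_insert_entry[where i = 2 and j = 2],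
        rule independent_insert_entry[where i = 1 and j = 1])
      (auto simp: g matv.independent_empty)
  then have ind': "matv.independent {v, u, u + t}" by (simp add: insert_commute)
  have dist': "distinct [v, u, u + t]"
    by (auto simp: g mat3_simps)
  have "semidirect_plus_line (matv.span {v, u, u + t}) v u (u + t)"
    by (rule semidirect_plus_line_span[OF refl ind' dist'])
      (auto simp: lie intro!: span_intros)
  moreover have "semidirect D (matv.span {w, z}) (matv.span {u, v, t})"
    by (rule semidirect_span)
      (use sp ind dist in \<open>auto simp: lie insert_commute intro!: span_intros\<close>)
  moreover have "matv.independent {w, z}" "matv.independent {u, v, t}"
    by (rule matv.independent_mono[OF ind]; auto)+
  moreover from this have "direct_sum (matv.span {w, z}) (line w) (line z)"
    using dist lie by (auto intro!: abelian_plane_span)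
  moreover have "matv.span {u, v, t} = matv.span {v, u, u + t}"
    using matv.span_diff[of "u + t" "{v, u, u + t}" u]
    by (auto simp: matv.span_eq intro: span_intros)
  ultimately show ?thesis
    unfolding der_description.simps Let_def g[symmetric]
    using hyp D dim lie dist
    by (simp add: linear_direct_sum_def)
qed

lemma der_L6:
  fixes D :: "('a::field ^ 3 ^ 3) set"
  assumes tab: "D = derivation_matrices (mult_table (L6 \<delta>))"
    and hyp: "\<delta> \<noteq> 0"
  shows "der_description (L6 \<delta>) D"
proof -
  let ?M = "\<lambda>a b c d. rows [[a, - \<delta> * b, 0], [b, a + b, 0], [c, d, 2 * a + b]] :: 'a ^ 3 ^ 3"
  define u v w z where g: "u = ?M 1 0 0 0" "v = ?M 0 1 0 0" "w = ?M 0 0 1 0" "z = ?M 0 0 0 1"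
  have "X \<in> D \<longleftrightarrow> (\<exists>a b c d. X = ?M a b c d)" for X
  proof
    assume "X \<in> D"
    then have X: "X \<in> derivation_matrices (mult_table (L6 \<delta>))" by (simp only: tab)
    have e1: "X $ 1 $ 3 = 0"
      using derivation_matricesD[OF X, of 1 1 1] hyp
      by (simp add: derivation_eqs two_eq_0_iff_CHAR)
    have e2: "X $ 2 $ 3 = 0"
      using derivation_matricesD[OF X, of 1 1 2] hyp
      by (simp add: derivation_eqs two_eq_0_iff_CHAR)
    have e3: "X $ 3 $ 3 = 2 * X $ 1 $ 1 + X $ 2 $ 1"
      using derivation_matricesD[OF X, of 1 1 3] hyp
      by (simp add: derivation_eqs two_eq_0_iff_CHAR)
    have e4: "X $ 3 $ 3 = X $ 1 $ 1 + X $ 2 $ 1 * \<delta> + (X $ 1 $ 2 + X $ 2 $ 2)"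
      using derivation_matricesD[OF X, of 1 2 3] hyp
      by (simp add: derivation_eqs two_eq_0_iff_CHAR)
    have e5: "X $ 1 $ 2 + X $ 2 $ 1 * \<delta> = 0"
      using derivation_matricesD[OF X, of 2 1 3] hyp
      by (simp add: derivation_eqs two_eq_0_iff_CHAR)
    note e = e1 e2 e3 e4 e5
    have "X $ 1 $ 2 = - \<delta> * X $ 2 $ 1"
      using e(5) by algebra
    have "X $ 1 $ 2 = - \<delta> * X $ 2 $ 1 \<and> X $ 2 $ 2 = X $ 1 $ 1 + X $ 2 $ 1"
      using e(3-5) by algebra
    with e show "\<exists>a b c d. X = ?M a b c d"
      by (simp add: vec_eq_iff forall_3)
  next
    assume "\<exists>a b c d. X = ?M a b c d"
    then show "X \<in> D"
      unfolding tab using hyp by (auto simp: derivation_eqs algebra_simps power2_eq_square)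
  qed
  then have D: "D = {?M a b c d |a b c d. True}" by blast
  have sp: "D = matv.span {u, v, w, z}"
    unfolding D g by (rule span4_range) (simp add: mat3_simps algebra_simps)
  have ind: "matv.independent {u, v, w, z}"
    by (rule independent_insert_entry[where i = 1 and j = 1],
        rule independent_insert_entry[where i = 2 and j = 1],
        rule independent_insert_entry[where i = 3 and j = 1],
        rule independent_insert_entry[where i = 3 and j = 2])
      (auto simp: g matv.independent_empty)
  have dist: "distinct [u, v, w, z]"
    by (auto simp: g mat3_simps)
  have dim: "matv.dim D = 4"
    using dim_span_distinct[of "[u, v, w, z]"] ind dist sp by (simp add: insert_commute)
  have lie: "lie w z = 0" "lie u v = 0" "lie u w = w" "lie u z = z" "lie v w = w + \<delta> *m z"
    "lie v z = - w"
    by (simp_all add: g mat3_simps algebra_simps)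
  have "abelian_semidirect D w z u v"
    by (rule abelian_semidirect_span)
      (use sp ind dist in \<open>auto simp: lie insert_commute intro!: span_intros\<close>)
  show ?thesis
    unfolding der_description.simps Let_def g[symmetric]
    using D dim lie \<open>abelian_semidirect D w z u v\<close>
    by simp
qed

section \<open>Types \<open>L7\<close> to \<open>L11\<close>: a nonabelian quotient, or (for
  \<open>L9\<close>) a square that is not right central\<close>

lemma der_L7:
  fixes D :: "('a::field ^ 3 ^ 3) set"
  assumes tab: "D = derivation_matrices (mult_table L7)"
  shows "der_description L7 D"
proof -
  let ?M = "\<lambda>a b c. rows [[0, 0, 0], [a, b, 0], [c, 0, 0]] :: 'a ^ 3 ^ 3"
  define u v w where g: "u = ?M 1 0 0" "v = ?M 0 1 0" "w = ?M 0 0 1"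
  have "X \<in> D \<longleftrightarrow> (\<exists>a b c. X = ?M a b c)" for X
    unfolding tab by (simp add: derivation_eqs vec_eq_iff) (auto simp: algebra_simps)
  then have D: "D = {?M a b c |a b c. True}" by blast
  have sp: "D = matv.span {u, v, w}"
    unfolding D g by (rule span3_range) (simp add: mat3_simps algebra_simps)
  have ind: "matv.independent {u, v, w}"
    by (rule independent_insert_entry[where i = 2 and j = 1],
        rule independent_insert_entry[where i = 2 and j = 2],
        rule independent_insert_entry[where i = 3 and j = 1])
      (auto simp: g matv.independent_empty)
  have dist: "distinct [u, v, w]"
    by (auto simp: g mat3_simps)
  have dim: "matv.dim D = 3"
    using dim_span_distinct[of "[u, v, w]"] ind dist sp by (simp add: insert_commute)
  have lie: "lie v u = u" "lie w u = 0" "lie w v = 0"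
    by (simp_all add: g mat3_simps algebra_simps)
  have "semidirect_plus_line D u v w"
    by (rule semidirect_plus_line_span)
      (use sp ind dist in \<open>auto simp: lie insert_commute intro!: span_intros\<close>)
  moreover have "line w \<subseteq> lie_center D"
    by (rule line_subset_lie_center[OF sp])
      (use sp in \<open>auto simp: lie intro!: span_intros\<close>)
  ultimately show ?thesis
    unfolding der_description.simps Let_def g[symmetric]
    using D dim lie
    by simp
qed

text \<open>The counterpart of \<open>L11\<close> in characteristic 2: the square of the second
  basis vector makes \<open>X $ 3 $ 3\<close> twice \<open>X $ 2 $ 2\<close>, which is zero
  here.\<close>

lemma der_L8:
  fixes D :: "('a::field ^ 3 ^ 3) set"
  assumes tab: "D = derivation_matrices (mult_table (L8 l))"
    and hyp: "CHAR('a) = 2"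
  shows "der_description (L8 l) D"
proof -
  let ?M = "\<lambda>a b c. rows [[0, 0, 0], [a, b, 0], [c, a, 0]] :: 'a ^ 3 ^ 3"
  define u v w where g: "u = ?M 1 0 0" "v = ?M 0 1 0" "w = ?M 0 0 1"
  note two = CHAR_2_simps[OF hyp(1)]
  have "X \<in> D \<longleftrightarrow> (\<exists>a b c. X = ?M a b c)" for X
  proof
    assume "X \<in> D"
    then have X: "X \<in> derivation_matrices (mult_table (L8 l))" by (simp only: tab)
    have e: "X $ 1 $ 3 = 0" "X $ 2 $ 3 = 0" "X $ 3 $ 3 = 0" "X $ 1 $ 2 = 0" "X $ 1 $ 1 = 0"
      "X $ 3 $ 2 = X $ 2 $ 1 + X $ 1 $ 2 * l"
      using X hyp by (simp_all add: derivation_eqs two)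
    from e show "\<exists>a b c. X = ?M a b c"
      by (simp add: vec_eq_iff forall_3)
  next
    assume "\<exists>a b c. X = ?M a b c"
    then show "X \<in> D"
      unfolding tab using hyp by (auto simp: derivation_eqs algebra_simps power2_eq_square two)
  qed
  then have D: "D = {?M a b c |a b c. True}" by blast
  have sp: "D = matv.span {u, v, w}"
    unfolding D g by (rule span3_range) (simp add: mat3_simps algebra_simps)
  have ind: "matv.independent {u, v, w}"
    by (rule independent_insert_entry[where i = 2 and j = 1],
        rule independent_insert_entry[where i = 2 and j = 2],
        rule independent_insert_entry[where i = 3 and j = 1])
      (auto simp: g matv.independent_empty)
  have dist: "distinct [u, v, w]"
    by (auto simp: g mat3_simps)
  have dim: "matv.dim D = 3"
    using dim_span_distinct[of "[u, v, w]"] ind dist sp by (simp add: insert_commute)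
  have lie: "lie v u = u" "lie w u = 0" "lie w v = 0"
    by (simp_all add: g mat3_simps algebra_simps two)
  have "semidirect_plus_line D u v w"
    by (rule semidirect_plus_line_span)
      (use sp ind dist in \<open>auto simp: lie insert_commute intro!: span_intros\<close>)
  moreover have "line w \<subseteq> lie_center D"
    by (rule line_subset_lie_center[OF sp])
      (use sp in \<open>auto simp: lie intro!: span_intros\<close>)
  ultimately show ?thesis
    unfolding der_description.simps Let_def g[symmetric]
    using D dim lie
    by simp
qed

lemma der_L9:
  fixes D :: "('a::field ^ 3 ^ 3) set"
  assumes tab: "D = derivation_matrices (mult_table L9)"
  shows "der_description L9 D"
proof -
  let ?M = "\<lambda>a b c. rows [[0, 0, 0], [a, b, 0], [c, 0, c]] :: 'a ^ 3 ^ 3"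
  define u v w where g: "u = ?M 1 0 0" "v = ?M 0 1 0" "w = ?M 0 0 1"
  have "X \<in> D \<longleftrightarrow> (\<exists>a b c. X = ?M a b c)" for X
    unfolding tab by (simp add: derivation_eqs vec_eq_iff) (auto simp: algebra_simps)
  then have D: "D = {?M a b c |a b c. True}" by blast
  have sp: "D = matv.span {u, v, w}"
    unfolding D g by (rule span3_range) (simp add: mat3_simps algebra_simps)
  have ind: "matv.independent {u, v, w}"
    by (rule independent_insert_entry[where i = 2 and j = 1],
        rule independent_insert_entry[where i = 2 and j = 2],
        rule independent_insert_entry[where i = 3 and j = 1])
      (auto simp: g matv.independent_empty)
  have dist: "distinct [u, v, w]"
    by (auto simp: g mat3_simps)
  have dim: "matv.dim D = 3"
    using dim_span_distinct[of "[u, v, w]"] ind dist sp by (simp add: insert_commute)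
  have lie: "lie v u = u" "lie w u = 0" "lie w v = 0"
    by (simp_all add: g mat3_simps algebra_simps)
  have "semidirect_plus_line D u v w"
    by (rule semidirect_plus_line_span)
      (use sp ind dist in \<open>auto simp: lie insert_commute intro!: span_intros\<close>)
  moreover have "line w \<subseteq> lie_center D"
    by (rule line_subset_lie_center[OF sp])
      (use sp in \<open>auto simp: lie intro!: span_intros\<close>)
  ultimately show ?thesis
    unfolding der_description.simps Let_def g[symmetric]
    using D dim lie
    by simp
qed

lemma der_L10:
  fixes D :: "('a::field ^ 3 ^ 3) set"
  assumes tab: "D = derivation_matrices (mult_table (L10 r))"
    and hyp: "r \<noteq> 0"
  shows "der_description (L10 r) D"
proof -
  let ?M = "\<lambda>a b c. rows [[0, 0, 0], [a, b, 0], [c, 0, r * c]] :: 'a ^ 3 ^ 3"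
  define u v w where g: "u = ?M 1 0 0" "v = ?M 0 1 0" "w = ?M 0 0 1"
  have "X \<in> D \<longleftrightarrow> (\<exists>a b c. X = ?M a b c)" for X
    unfolding tab by (simp add: derivation_eqs vec_eq_iff) (auto simp: algebra_simps)
  then have D: "D = {?M a b c |a b c. True}" by blast
  have sp: "D = matv.span {u, v, w}"
    unfolding D g by (rule span3_range) (simp add: mat3_simps algebra_simps)
  have ind: "matv.independent {u, v, w}"
    by (rule independent_insert_entry[where i = 2 and j = 1],
        rule independent_insert_entry[where i = 2 and j = 2],
        rule independent_insert_entry[where i = 3 and j = 1])
      (auto simp: g matv.independent_empty)
  have dist: "distinct [u, v, w]"
    by (auto simp: g mat3_simps)
  have dim: "matv.dim D = 3"
    using dim_span_distinct[of "[u, v, w]"] ind dist sp by (simp add: insert_commute)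
  have lie: "lie v u = u" "lie w u = 0" "lie w v = 0"
    by (simp_all add: g mat3_simps algebra_simps)
  have "semidirect_plus_line D u v w"
    by (rule semidirect_plus_line_span)
      (use sp ind dist in \<open>auto simp: lie insert_commute intro!: span_intros\<close>)
  moreover have "line w \<subseteq> lie_center D"
    by (rule line_subset_lie_center[OF sp])
      (use sp in \<open>auto simp: lie intro!: span_intros\<close>)
  ultimately show ?thesis
    unfolding der_description.simps Let_def g[symmetric]
    using D dim lie
    by simp
qed

lemma der_L11:
  fixes D :: "('a::field ^ 3 ^ 3) set"
  assumes tab: "D = derivation_matrices (mult_table L11)"
    and hyp: "CHAR('a) \<noteq> 2"
  shows "der_description L11 D"
proof -
  let ?M = "\<lambda>a b. rows [[0, 0, 0], [a, b, 0], [0, - a, 2 * b]] :: 'a ^ 3 ^ 3"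
  define u v where g: "u = ?M 1 0" "v = ?M 0 1"
  have "X \<in> D \<longleftrightarrow> (\<exists>a b. X = ?M a b)" for X
  proof
    assume "X \<in> D"
    then have X: "X \<in> derivation_matrices (mult_table L11)" by (simp only: tab)
    have e1: "X $ 1 $ 2 = 0"
      using derivation_matricesD[OF X, of 1 2 1] hyp
      by (simp add: derivation_eqs two_eq_0_iff_CHAR)
    have e2: "X $ 1 $ 1 = 0"
      using derivation_matricesD[OF X, of 1 2 2] hyp
      by (simp add: derivation_eqs two_eq_0_iff_CHAR)
    have e3: "- X $ 3 $ 2 = X $ 2 $ 1"
      using derivation_matricesD[OF X, of 2 1 3] hyp
      by (simp add: derivation_eqs two_eq_0_iff_CHAR)
    have e4: "X $ 1 $ 3 = 0"
      using derivation_matricesD[OF X, of 2 2 1] hyp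
      by (simp add: derivation_eqs two_eq_0_iff_CHAR)
    have e5: "X $ 2 $ 3 = 0"
      using derivation_matricesD[OF X, of 2 2 2] hyp
      by (simp add: derivation_eqs two_eq_0_iff_CHAR)
    have e6: "X $ 3 $ 3 = 2 * X $ 2 $ 2"
      using derivation_matricesD[OF X, of 2 2 3] hyp
      by (simp add: derivation_eqs two_eq_0_iff_CHAR)
    \<comment> \<open>The equation itself reads \<open>2 * X $ 3 $ 1 = 0\<close>: the first basis
      vector has square zero and acts on the third by \<open>2\<close>.\<close>
    have e7: "X $ 3 $ 1 = 0"
      using derivation_matricesD[OF X, of 1 1 3] hyp
      by (simp add: derivation_eqs two_eq_0_iff_CHAR)
    note e = e1 e2 e3 e4 e5 e6 e7
    have "X $ 3 $ 2 = - X $ 2 $ 1"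
      using e(3) by (simp add: minus_equation_iff)
    with e show "\<exists>a b. X = ?M a b"
      by (simp add: vec_eq_iff forall_3)
  next
    assume "\<exists>a b. X = ?M a b"
    then show "X \<in> D"
      unfolding tab using hyp by (auto simp: derivation_eqs algebra_simps power2_eq_square)
  qed
  then have D: "D = {?M a b |a b. True}" by blast
  have sp: "D = matv.span {u, v}"
    unfolding D g by (rule span2_range) (simp add: mat3_simps algebra_simps)
  have ind: "matv.independent {u, v}"
    by (rule independent_insert_entry[where i = 2 and j = 1],
        rule independent_insert_entry[where i = 2 and j = 2])
      (auto simp: g matv.independent_empty)
  have dist: "distinct [u, v]"
    by (auto simp: g mat3_simps)
  have dim: "matv.dim D = 2"
    using dim_span_distinct[of "[u, v]"] ind dist sp by (simp add: insert_commute)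
  have lie: "lie v u = u"
    by (simp_all add: g mat3_simps algebra_simps)
  have "semidirect D (line u) (line v)"
    by (rule semidirect_span)
      (use sp ind dist in \<open>auto simp: lie insert_commute intro!: span_intros\<close>)
  show ?thesis
    unfolding der_description.simps Let_def g[symmetric]
    using D dim lie \<open>semidirect D (line u) (line v)\<close>
    by simp
qed

section \<open>Types \<open>L12\<close> to \<open>L16\<close>: squares spanning a plane\<close>

lemma der_L12:
  fixes D :: "('a::field ^ 3 ^ 3) set"
  assumes tab: "D = derivation_matrices (mult_table L12)"
  shows "der_description L12 D"
proof -
  let ?M = "\<lambda>a b c. rows [[a, 0, 0], [b, 2 * a, 0], [c, b, 3 * a]] :: 'a ^ 3 ^ 3"
  define u v w where g: "u = ?M 1 0 0" "v = ?M 0 1 0" "w = ?M 0 0 1"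
  have "X \<in> D \<longleftrightarrow> (\<exists>a b c. X = ?M a b c)" for X
    unfolding tab by (simp add: derivation_eqs vec_eq_iff) (auto simp: algebra_simps)
  then have D: "D = {?M a b c |a b c. True}" by blast
  have sp: "D = matv.span {u, v, w}"
    unfolding D g by (rule span3_range) (simp add: mat3_simps algebra_simps)
  have ind: "matv.independent {u, v, w}"
    by (rule independent_insert_entry[where i = 1 and j = 1],
        rule independent_insert_entry[where i = 2 and j = 1],
        rule independent_insert_entry[where i = 3 and j = 1])
      (auto simp: g matv.independent_empty)
  have dist: "distinct [u, v, w]"
    by (auto simp: g mat3_simps)
  have dim: "matv.dim D = 3"
    using dim_span_distinct[of "[u, v, w]"] ind dist sp by (simp add: insert_commute)
  \<comment> \<open>\<open>u\<close> is the derivation of a grading with weights \<open>1\<close>,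
    \<open>2\<close>, \<open>3\<close>; \<open>v\<close> and \<open>w\<close> raise the degree by
    \<open>1\<close> and \<open>2\<close>, and these are their eigenvalues.\<close>
  have lie: "lie u v = v" "lie u w = 2 *m w" "lie v w = 0" "lie w v = 0"
    by (simp_all add: g mat3_simps algebra_simps)
  have "semidirect D (matv.span {v, w}) (line u)"
    by (rule semidirect_span)
      (use sp ind dist in \<open>auto simp: lie insert_commute intro!: span_intros\<close>)
  moreover have "matv.independent {v, w}"
    by (rule matv.independent_mono[OF ind]) auto
  then have "direct_sum (matv.span {v, w}) (line v) (line w)"
    using dist lie by (auto intro!: abelian_plane_span)
  ultimately show ?thesis
    unfolding der_description.simps Let_def g[symmetric]
    using D dim lie
    by simp
qed

text \<open>The first basis vector generates the algebra, so the first column determines a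
  derivation. \<open>u\<close> is left multiplication by this vector and
  \<open>v = u ** u - u\<close>, which is why they commute.\<close>

lemma der_L13:
  fixes D :: "('a::field ^ 3 ^ 3) set"
  assumes tab: "D = derivation_matrices (mult_table L13)"
  shows "der_description L13 D"
proof -
  let ?M = "\<lambda>a b. rows [[0, 0, 0], [a, a, 0], [b, a, 0]] :: 'a ^ 3 ^ 3"
  define u v where g: "u = ?M 1 0" "v = ?M 0 1"
  have "X \<in> D \<longleftrightarrow> (\<exists>a b. X = ?M a b)" for X
    unfolding tab by (simp add: derivation_eqs vec_eq_iff) (auto simp: algebra_simps)
  then have D: "D = {?M a b |a b. True}" by blast
  have sp: "D = matv.span {u, v}"
    unfolding D g by (rule span2_range) (simp add: mat3_simps algebra_simps)
  have ind: "matv.independent {u, v}"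
    by (rule independent_insert_entry[where i = 2 and j = 1],
        rule independent_insert_entry[where i = 3 and j = 1])
      (auto simp: g matv.independent_empty)
  have dist: "distinct [u, v]"
    by (auto simp: g mat3_simps)
  have dim: "matv.dim D = 2"
    using dim_span_distinct[of "[u, v]"] ind dist sp by (simp add: insert_commute)
  have lie: "lie u v = 0"
    by (simp_all add: g mat3_simps algebra_simps)
  note ab = abelian_plane_span[OF sp ind _ lie(1)]
  show ?thesis
    unfolding der_description.simps Let_def g[symmetric]
    using D dim ab dist
    by simp
qed

lemma der_L14:
  fixes D :: "('a::field ^ 3 ^ 3) set"
  assumes tab: "D = derivation_matrices (mult_table (L14 \<rho>))"
    and hyp: "\<rho> \<noteq> 0" "\<rho> \<noteq> 1"
  shows "der_description (L14 \<rho>) D"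
proof -
  let ?M = "\<lambda>a b. rows [[0, 0, 0], [a, a, 0], [0, 0, b]] :: 'a ^ 3 ^ 3"
  define u v where g: "u = ?M 1 0" "v = ?M 0 1"
  have "X \<in> D \<longleftrightarrow> (\<exists>a b. X = ?M a b)" for X
  proof
    assume "X \<in> D"
    then have X: "X \<in> derivation_matrices (mult_table (L14 \<rho>))" by (simp only: tab)
    have e1: "X $ 1 $ 2 = 0"
      using derivation_matricesD[OF X, of 1 1 1] hyp
      by (simp add: derivation_eqs two_eq_0_iff_CHAR)
    have e2: "X $ 2 $ 2 = 2 * X $ 1 $ 1 + X $ 2 $ 1"
      using derivation_matricesD[OF X, of 1 1 2] hyp
      by (simp add: derivation_eqs two_eq_0_iff_CHAR)
    have e3: "X $ 3 $ 2 = X $ 3 $ 1 * \<rho>"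
      using derivation_matricesD[OF X, of 1 1 3] hyp
      by (simp add: derivation_eqs two_eq_0_iff_CHAR)
    have e4: "X $ 3 $ 2 = 0"
      using derivation_matricesD[OF X, of 1 2 3] hyp
      by (simp add: derivation_eqs two_eq_0_iff_CHAR)
    have e5: "X $ 1 $ 3 = 0"
      using derivation_matricesD[OF X, of 1 3 1] hyp
      by (simp add: derivation_eqs two_eq_0_iff_CHAR)
    have e6: "\<rho> * X $ 2 $ 3 = X $ 1 $ 3 + X $ 2 $ 3"
      using derivation_matricesD[OF X, of 1 3 2] hyp
      by (simp add: derivation_eqs two_eq_0_iff_CHAR)
    have e7: "X $ 1 $ 1 + X $ 1 $ 2 = 0"
      using derivation_matricesD[OF X, of 1 2 2] hyp
      by (simp add: derivation_eqs two_eq_0_iff_CHAR)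
    note e = e1 e2 e3 e4 e5 e6 e7
    \<comment> \<open>As \<open>X $ 1 $ 1\<close> is zero by \<open>e1\<close> and
      \<open>e7\<close>, the matrix commutes on the plane with left multiplication by the first
      basis vector, which is diagonal there with entries \<open>1\<close> and \<open>\<rho>\<close>.
      Distinct eigenvalues leave no off-diagonal entry.\<close>
    have "(\<rho> - 1) * X $ 2 $ 3 = 0"
      using e(5,6) by (simp add: algebra_simps)
    have "X $ 2 $ 3 = 0 \<and> X $ 3 $ 1 = 0 \<and> X $ 1 $ 1 = 0"
      using \<open>(\<rho> - 1) * X $ 2 $ 3 = 0\<close> e hyp by simp
    with e show "\<exists>a b. X = ?M a b"
      by (simp add: vec_eq_iff forall_3)
  next
    assume "\<exists>a b. X = ?M a b"
    then show "X \<in> D"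
      unfolding tab using hyp by (auto simp: derivation_eqs algebra_simps power2_eq_square)
  qed
  then have D: "D = {?M a b |a b. True}" by blast
  have sp: "D = matv.span {u, v}"
    unfolding D g by (rule span2_range) (simp add: mat3_simps algebra_simps)
  have ind: "matv.independent {u, v}"
    by (rule independent_insert_entry[where i = 2 and j = 1],
        rule independent_insert_entry[where i = 3 and j = 3])
      (auto simp: g matv.independent_empty)
  have dist: "distinct [u, v]"
    by (auto simp: g mat3_simps)
  have dim: "matv.dim D = 2"
    using dim_span_distinct[of "[u, v]"] ind dist sp by (simp add: insert_commute)
  have lie: "lie u v = 0"
    by (simp_all add: g mat3_simps algebra_simps)
  note ab = abelian_plane_span[OF sp ind _ lie(1)]
  show ?thesis
    unfolding der_description.simps Let_def g[symmetric]
    using D dim ab dist hyp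
    by simp
qed

text \<open>Left multiplication by the first basis vector is the identity on the plane of the other
  two, so a derivation may restrict to any endomorphism of this plane. It takes equal values at the
  first basis vector and at its square, the second one, so restriction loses nothing: this is the
  isomorphism with \<open>gl_2\<close>.\<close>

lemma der_L14_one:
  fixes D :: "('a::field ^ 3 ^ 3) set"
  assumes tab: "D = derivation_matrices (mult_table (L14 1))"
  shows "der_description (L14 1) D"
proof -
  let ?M = "\<lambda>a b c d. rows [[0, 0, 0], [a, a, c], [b, b, d]] :: 'a ^ 3 ^ 3"
  define u v w z where g: "u = ?M 1 0 0 0" "v = ?M 0 1 0 0" "w = ?M 0 0 1 0" "z = ?M 0 0 0 1"
  have "X \<in> D \<longleftrightarrow> (\<exists>a b c d. X = ?M a b c d)" for X
    unfolding tab by (simp add: derivation_eqs vec_eq_iff) (auto simp: algebra_simps)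
  then have D: "D = {?M a b c d |a b c d. True}" by blast
  have sp: "D = matv.span {u, v, w, z}"
    unfolding D g by (rule span4_range) (simp add: mat3_simps algebra_simps)
  have ind: "matv.independent {u, v, w, z}"
    by (rule independent_insert_entry[where i = 2 and j = 1],
        rule independent_insert_entry[where i = 3 and j = 1],
        rule independent_insert_entry[where i = 2 and j = 3],
        rule independent_insert_entry[where i = 3 and j = 3])
      (auto simp: g matv.independent_empty)
  have dist: "distinct [u, v, w, z]"
    by (auto simp: g mat3_simps)
  have dim: "matv.dim D = 4"
    using dim_span_distinct[of "[u, v, w, z]"] ind dist sp by (simp add: insert_commute)
  have "isomorphic_gl2 D"
    unfolding isomorphic_gl2_def
  proof (intro exI conjI ballI allI)
    let ?f = "\<lambda>X :: 'a ^ 3 ^ 3.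
      vector [vector [X $ 2 $ 2, X $ 2 $ 3], vector [X $ 3 $ 2, X $ 3 $ 3]] :: 'a ^ 2 ^ 2"
    show "bij_betw ?f D UNIV"
      by (rule bij_betw_byWitness[where f' =
          "\<lambda>N. ?M (N $ 1 $ 1) (N $ 2 $ 1) (N $ 1 $ 2) (N $ 2 $ 2)"])
        (auto simp: D vec_eq_iff forall_3 forall_2)
    fix X Y assume "X \<in> D" "Y \<in> D"
    then show "?f (X + Y) = ?f X + ?f Y" "?f (lie X Y) = lie (?f X) (?f Y)"
      by (auto simp: D lie_def matrix_matrix_mult_def vec_eq_iff forall_2 sum_2 sum_3)
  next
    let ?f = "\<lambda>X :: 'a ^ 3 ^ 3.
      vector [vector [X $ 2 $ 2, X $ 2 $ 3], vector [X $ 3 $ 2, X $ 3 $ 3]] :: 'a ^ 2 ^ 2"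
    show "?f (c *m X) = c *m ?f X" for c X
      by (simp add: mat_scale_def vec_eq_iff forall_2)
  qed
  show ?thesis
    unfolding der_description.simps Let_def g[symmetric]
    using D dim \<open>isomorphic_gl2 D\<close>
    by simp
qed

lemma der_L15:
  fixes D :: "('a::field ^ 3 ^ 3) set"
  assumes tab: "D = derivation_matrices (mult_table L15)"
    and hyp: "CHAR('a) \<noteq> 2"
  shows "der_description L15 D"
proof -
  let ?M = "\<lambda>a b. rows [[0, 0, 0], [a, a, 0], [b, a + b, a]] :: 'a ^ 3 ^ 3"
  define u v where g: "u = ?M 1 0" "v = ?M 0 1"
  have "X \<in> D \<longleftrightarrow> (\<exists>a b. X = ?M a b)" for X
  proof
    assume "X \<in> D"
    then have X: "X \<in> derivation_matrices (mult_table L15)" by (simp only: tab)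
    have e1: "X $ 1 $ 2 = 0"
      using derivation_matricesD[OF X, of 1 1 1] hyp
      by (simp add: derivation_eqs two_eq_0_iff_CHAR)
    have e2: "X $ 2 $ 2 = 2 * X $ 1 $ 1 + X $ 2 $ 1"
      using derivation_matricesD[OF X, of 1 1 2] hyp
      by (simp add: derivation_eqs two_eq_0_iff_CHAR)
    have e3: "X $ 3 $ 2 = X $ 2 $ 1 + X $ 3 $ 1"
      using derivation_matricesD[OF X, of 1 1 3] hyp
      by (simp add: derivation_eqs two_eq_0_iff_CHAR)
    have e4: "X $ 1 $ 3 = 0"
      using derivation_matricesD[OF X, of 3 1 2] hyp
      by (simp add: derivation_eqs two_eq_0_iff_CHAR)
    have e5: "X $ 2 $ 3 = X $ 1 $ 1 + X $ 1 $ 2"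
      using derivation_matricesD[OF X, of 1 2 2] hyp
      by (simp add: derivation_eqs two_eq_0_iff_CHAR)
    have e6: "X $ 3 $ 3 = X $ 1 $ 1 + X $ 2 $ 2"
      using derivation_matricesD[OF X, of 1 2 3] hyp
      by (simp add: derivation_eqs two_eq_0_iff_CHAR)
    have e7: "X $ 1 $ 1 + X $ 2 $ 3 = 0"
      using derivation_matricesD[OF X, of 1 3 3] hyp
      by (simp add: derivation_eqs two_eq_0_iff_CHAR)
    note e = e1 e2 e3 e4 e5 e6 e7
    \<comment> \<open>\<open>X $ 2 $ 3\<close> is \<open>X $ 1 $ 1\<close> by the equation at
      \<open>(1, 2)\<close> and its negative by the one at \<open>(1, 3)\<close>. In characteristic
      2 these agree and the entry is free.\<close>
    have "2 * X $ 1 $ 1 = 0"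
      using e by simp
    have "X $ 1 $ 1 = 0"
      using \<open>2 * X $ 1 $ 1 = 0\<close> hyp by (simp add: two_eq_0_iff_CHAR)
    with e show "\<exists>a b. X = ?M a b"
      by (simp add: vec_eq_iff forall_3)
  next
    assume "\<exists>a b. X = ?M a b"
    then show "X \<in> D"
      unfolding tab using hyp by (auto simp: derivation_eqs algebra_simps power2_eq_square)
  qed
  then have D: "D = {?M a b |a b. True}" by blast
  have sp: "D = matv.span {u, v}"
    unfolding D g by (rule span2_range) (simp add: mat3_simps algebra_simps)
  have ind: "matv.independent {u, v}"
    by (rule independent_insert_entry[where i = 2 and j = 1],
        rule independent_insert_entry[where i = 3 and j = 1])
      (auto simp: g matv.independent_empty)
  have dist: "distinct [u, v]"
    by (auto simp: g mat3_simps)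
  have dim: "matv.dim D = 2"
    using dim_span_distinct[of "[u, v]"] ind dist sp by (simp add: insert_commute)
  have lie: "lie u v = 0"
    by (simp_all add: g mat3_simps algebra_simps)
  note ab = abelian_plane_span[OF sp ind _ lie(1)]
  show ?thesis
    unfolding der_description.simps Let_def g[symmetric]
    using D dim ab dist hyp
    by simp
qed

text \<open>\<open>v\<close> is left multiplication by the first basis vector, and
  \<open>v + w = v ** v\<close>, since the square of a derivation is a derivation in characteristic
  2. From \<open>lie u v = v\<close> one gets \<open>lie u (v ** v) = 2 *m (v ** v) = 0\<close>,
  which explains the central line.\<close>

lemma der_L15_CHAR_2:
  fixes D :: "('a::field ^ 3 ^ 3) set"
  assumes tab: "D = derivation_matrices (mult_table L15)"
    and hyp: "CHAR('a) = 2"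
  shows "der_description L15 D"
proof -
  let ?M = "\<lambda>s a b. rows [[s, 0, 0], [a, a, s], [b, a + b, s + a]] :: 'a ^ 3 ^ 3"
  define u v w where g: "u = ?M 1 0 0" "v = ?M 0 1 0" "w = ?M 0 0 1"
  note two = CHAR_2_simps[OF hyp(1)]
  have "X \<in> D \<longleftrightarrow> (\<exists>s a b. X = ?M s a b)" for X
  proof
    assume "X \<in> D"
    then have X: "X \<in> derivation_matrices (mult_table L15)" by (simp only: tab)
    have e: "X $ 1 $ 2 = 0" "X $ 2 $ 2 = X $ 2 $ 1" "X $ 3 $ 2 = X $ 2 $ 1 + X $ 3 $ 1"
      "X $ 1 $ 3 = 0" "X $ 2 $ 3 = X $ 1 $ 1 + X $ 1 $ 2" "X $ 3 $ 3 = X $ 1 $ 1 + X $ 2 $ 2"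
      using X hyp by (simp_all add: derivation_eqs two)
    from e show "\<exists>s a b. X = ?M s a b"
      by (simp add: vec_eq_iff forall_3)
  next
    assume "\<exists>s a b. X = ?M s a b"
    then show "X \<in> D"
      unfolding tab using hyp by (auto simp: derivation_eqs algebra_simps power2_eq_square two)
  qed
  then have D: "D = {?M s a b |s a b. True}" by blast
  have sp: "D = matv.span {u, v, w}"
    unfolding D g by (rule span3_range) (simp add: mat3_simps algebra_simps)
  have ind: "matv.independent {u, v, w}"
    by (rule independent_insert_entry[where i = 1 and j = 1],
        rule independent_insert_entry[where i = 2 and j = 1],
        rule independent_insert_entry[where i = 3 and j = 1])
      (auto simp: g matv.independent_empty)
  have dist: "distinct [u, v, w]"
    by (auto simp: g mat3_simps)
  have dim: "matv.dim D = 3"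
    using dim_span_distinct[of "[u, v, w]"] ind dist sp by (simp add: insert_commute)
  have lie: "lie u v = v" "lie (v + w) u = 0" "lie (v + w) v = 0" "lie (v + w) w = 0"
    by (simp_all add: g mat3_simps algebra_simps two)
  have "D = matv.span {v, u, v + w}"
    using matv.span_diff[of "v + w" "{v, u, v + w}" v]
    by (auto simp: sp matv.span_eq intro: span_intros)
  moreover have "matv.independent {u, v + w, v}"
    by (rule independent_insert_entry[where i = 1 and j = 1],
        rule independent_insert_entry[where i = 3 and j = 1],
        rule independent_insert_entry[where i = 2 and j = 1])
      (auto simp: g matv.independent_empty)
  moreover have "distinct [v, u, v + w]"
    by (auto simp: g mat3_simps)
  ultimately have "semidirect_plus_line D v u (v + w)"
    by (intro semidirect_plus_line_span)
      (use dist in \<open>auto simp: lie insert_commute intro!: span_intros\<close>)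
  moreover have "line (v + w) \<subseteq> lie_center D"
    by (rule line_subset_lie_center[OF sp])
      (use sp in \<open>auto simp: lie intro!: span_intros\<close>)
  ultimately show ?thesis
    unfolding der_description.simps Let_def g[symmetric]
    using hyp D dim lie
    by simp
qed

text \<open>\<open>u\<close> is left multiplication by the first basis vector and
  \<open>v = u ** u\<close>, hence they commute.\<close>

lemma der_L16:
  fixes D :: "('a::field ^ 3 ^ 3) set"
  assumes tab: "D = derivation_matrices (mult_table (L16 \<beta> \<gamma>))"
    and hyp: "CHAR('a) \<noteq> 2 \<or> \<gamma> \<noteq> 0" "\<beta> \<noteq> 0"
  shows "der_description (L16 \<beta> \<gamma>) D"
proof -
  let ?M = "\<lambda>a b. rows [[0, 0, 0], [a, \<beta> * b, \<beta> * (a + \<gamma> * b)],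
      [b, a + \<gamma> * b, \<gamma> * a + (\<beta> + \<gamma> ^ 2) * b]] :: 'a ^ 3 ^ 3"
  define u v where g: "u = ?M 1 0" "v = ?M 0 1"
  have "X \<in> D \<longleftrightarrow> (\<exists>a b. X = ?M a b)" for X
  proof
    assume "X \<in> D"
    then have X: "X \<in> derivation_matrices (mult_table (L16 \<beta> \<gamma>))" by (simp only: tab)
    have e1: "X $ 1 $ 2 = 0"
      using derivation_matricesD[OF X, of 1 1 1] hyp
      by (simp add: derivation_eqs two_eq_0_iff_CHAR)
    have e2: "X $ 2 $ 2 = 2 * X $ 1 $ 1 + X $ 3 $ 1 * \<beta>"
      using derivation_matricesD[OF X, of 1 1 2] hyp
      by (simp add: derivation_eqs two_eq_0_iff_CHAR)
    have e3: "X $ 3 $ 2 = X $ 2 $ 1 + X $ 3 $ 1 * \<gamma>"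
      using derivation_matricesD[OF X, of 1 1 3] hyp
      by (simp add: derivation_eqs two_eq_0_iff_CHAR)
    have e4: "X $ 1 $ 3 = 0"
      using derivation_matricesD[OF X, of 1 2 1] hyp
      by (simp add: derivation_eqs two_eq_0_iff_CHAR)
    have e5: "X $ 2 $ 3 = X $ 1 $ 2 + X $ 3 $ 2 * \<beta>"
      using derivation_matricesD[OF X, of 1 2 2] hyp
      by (simp add: derivation_eqs two_eq_0_iff_CHAR)
    have e6: "X $ 3 $ 3 = X $ 1 $ 1 + (X $ 2 $ 2 + X $ 3 $ 2 * \<gamma>)"
      using derivation_matricesD[OF X, of 1 2 3] hyp
      by (simp add: derivation_eqs two_eq_0_iff_CHAR)
    have e7: "\<beta> * X $ 2 $ 2 + \<gamma> * X $ 2 $ 3 = X $ 1 $ 1 * \<beta> + (X $ 1 $ 3 + X $ 3 $ 3 * \<beta>)"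
      using derivation_matricesD[OF X, of 1 3 2] hyp
      by (simp add: derivation_eqs two_eq_0_iff_CHAR)
    have e8: "\<beta> * X $ 3 $ 2 = X $ 1 $ 1 * \<gamma> + X $ 2 $ 3"
      using derivation_matricesD[OF X, of 1 3 3] hyp
      by (simp add: derivation_eqs two_eq_0_iff_CHAR)
    note e = e1 e2 e3 e4 e5 e6 e7 e8
    \<comment> \<open>With \<open>A\<close> the left multiplication by the first basis vector on the
      plane, \<open>X A - A X = s A\<close> for \<open>s = X $ 1 $ 1\<close>. Traces give
      \<open>s * \<gamma> = 0\<close> and, after multiplication by \<open>A\<close>,
      \<open>s * (\<gamma>^2 + 2 * \<beta>) = 0\<close>; these are the two equations derived
      here.\<close>
    have "2 * X $ 1 $ 1 * \<beta> = 0"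
      using e by algebra
    have "X $ 1 $ 1 * \<gamma> = 0"
      using e by algebra
    have "X $ 1 $ 1 = 0"
      using \<open>2 * X $ 1 $ 1 * \<beta> = 0\<close> \<open>X $ 1 $ 1 * \<gamma> = 0\<close> hyp by (auto simp: two_eq_0_iff_CHAR)
    have "X $ 1 $ 1 = 0 \<and> X $ 3 $ 3 = \<gamma> * X $ 2 $ 1 + (\<beta> + \<gamma> ^ 2) * X $ 3 $ 1"
      using e \<open>X $ 1 $ 1 = 0\<close> by algebra
    with e show "\<exists>a b. X = ?M a b"
      by (simp add: vec_eq_iff forall_3)
  next
    assume "\<exists>a b. X = ?M a b"
    then show "X \<in> D"
      unfolding tab using hyp by (auto simp: derivation_eqs algebra_simps power2_eq_square)
  qed
  then have D: "D = {?M a b |a b. True}" by blast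
  have sp: "D = matv.span {u, v}"
    unfolding D g by (rule span2_range) (simp add: mat3_simps algebra_simps)
  have ind: "matv.independent {u, v}"
    by (rule independent_insert_entry[where i = 2 and j = 1],
        rule independent_insert_entry[where i = 3 and j = 1])
      (auto simp: g matv.independent_empty)
  have dist: "distinct [u, v]"
    by (auto simp: g mat3_simps)
  have dim: "matv.dim D = 2"
    using dim_span_distinct[of "[u, v]"] ind dist sp by (simp add: insert_commute)
  have lie: "lie u v = 0"
    by (simp_all add: g mat3_simps algebra_simps power2_eq_square)
  note ab = abelian_plane_span[OF sp ind _ lie(1)]
  show ?thesis
    unfolding der_description.simps Let_def g[symmetric]
    using D dim ab dist hyp
    by simp
qed

text \<open>Both trace conditions on \<open>X $ 1 $ 1\<close> are empty here, so it becomes the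
  parameter \<open>s\<close>. Again \<open>v\<close> is left multiplication by the first basis
  vector, and \<open>w = v ** v\<close> is central because
  \<open>lie u (v ** v) = 2 *m (v ** v) = 0\<close>.\<close>

lemma der_L16_CHAR_2:
  fixes D :: "('a::field ^ 3 ^ 3) set"
  assumes tab: "D = derivation_matrices (mult_table (L16 \<beta> \<gamma>))"
    and hyp: "CHAR('a) = 2" "\<gamma> = 0" "\<beta> \<noteq> 0"
  shows "der_description (L16 \<beta> \<gamma>) D"
proof -
  let ?M = "\<lambda>s a b. rows [[s, 0, 0], [a, \<beta> * b, \<beta> * a], [b, a, s + \<beta> * b]] :: 'a ^ 3 ^ 3"
  define u v w where g: "u = ?M 1 0 0" "v = ?M 0 1 0" "w = ?M 0 0 1"
  note two = CHAR_2_simps[OF hyp(1)]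
  have "X \<in> D \<longleftrightarrow> (\<exists>s a b. X = ?M s a b)" for X
  proof
    assume "X \<in> D"
    then have X: "X \<in> derivation_matrices (mult_table (L16 \<beta> \<gamma>))" by (simp only: tab)
    have e: "X $ 1 $ 2 = 0" "X $ 2 $ 2 = X $ 3 $ 1 * \<beta>" "X $ 3 $ 2 = X $ 2 $ 1"
      "X $ 1 $ 3 = 0" "X $ 2 $ 3 = X $ 1 $ 2 + X $ 3 $ 2 * \<beta>"
      "X $ 3 $ 3 = X $ 1 $ 1 + X $ 2 $ 2"
      using X hyp by (simp_all add: derivation_eqs two)
    from e show "\<exists>s a b. X = ?M s a b"
      by (simp add: vec_eq_iff forall_3)
  next
    assume "\<exists>s a b. X = ?M s a b"
    then show "X \<in> D"
      unfolding tab using hyp by (auto simp: derivation_eqs algebra_simps power2_eq_square two)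
  qed
  then have D: "D = {?M s a b |s a b. True}" by blast
  have sp: "D = matv.span {u, v, w}"
    unfolding D g by (rule span3_range) (simp add: mat3_simps algebra_simps)
  have ind: "matv.independent {u, v, w}"
    by (rule independent_insert_entry[where i = 1 and j = 1],
        rule independent_insert_entry[where i = 2 and j = 1],
        rule independent_insert_entry[where i = 3 and j = 1])
      (auto simp: g matv.independent_empty)
  have dist: "distinct [u, v, w]"
    by (auto simp: g mat3_simps)
  have dim: "matv.dim D = 3"
    using dim_span_distinct[of "[u, v, w]"] ind dist sp by (simp add: insert_commute)
  have lie: "lie u v = v" "lie w v = 0" "lie w u = 0"
    by (simp_all add: g mat3_simps algebra_simps two)
  have "semidirect_plus_line D v u w"
    by (rule semidirect_plus_line_span)
      (use sp ind dist in \<open>auto simp: lie insert_commute intro!: span_intros\<close>)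
  moreover have "line w \<subseteq> lie_center D"
    by (rule line_subset_lie_center[OF sp])
      (use sp in \<open>auto simp: lie intro!: span_intros\<close>)
  ultimately show ?thesis
    unfolding der_description.simps Let_def g[symmetric]
    using hyp D dim lie
    by simp
qed

lemma irreducible_quadratic_no_root:
  fixes \<beta> \<gamma> :: "'a::field"
  assumes "irreducible [:- \<beta>, - \<gamma>, 1:]"
  shows "x ^ 2 - \<gamma> * x - \<beta> \<noteq> 0"
proof
  assume "x ^ 2 - \<gamma> * x - \<beta> = 0"
  then have "\<beta> = x ^ 2 - \<gamma> * x" by simp
  then have eq: "[:- \<beta>, - \<gamma>, 1:] = [:- x, 1:] * [:x - \<gamma>, 1:]"
    by (simp add: algebra_simps power2_eq_square)
  show False
    using irreducibleD[OF assms eq] by (auto simp: is_unit_pCons_iff)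
qed

lemma der_description_derivation_matrices:
  fixes T :: "'a::field leibniz_type"
  assumes "admissible T"
  shows "der_description T (derivation_matrices (mult_table T))"
proof (cases T)
  case (L3 \<alpha>)
  then have "\<alpha> \<noteq> 0" "\<alpha> \<noteq> - 1" using assms by auto
  then show ?thesis unfolding L3 by (rule der_L3[OF refl])
next
  case L4
  then show ?thesis using der_L4 der_L4_CHAR_2 by blast
next
  case (L5 \<beta>)
  \<comment> \<open>A zero constant term would make \<open>0\<close> a root of the polynomial
    excluded by admissibility; the same holds for \<open>L6\<close> and \<open>L16\<close>.\<close>
  then have "\<beta> \<noteq> 0" using assms by (auto intro: exI[of _ 0])
  then show ?thesis using L5 der_L5 der_L5_CHAR_2 by blast
next
  case (L6 \<delta>)
  then have "\<delta> \<noteq> 0" using assms by (auto dest: spec[of _ 0])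
  then show ?thesis using L6 der_L6 by blast
next
  case (L14 \<rho>)
  show ?thesis
  proof (cases "\<rho> = 1")
    case True
    show ?thesis unfolding L14 True by (rule der_L14_one[OF refl])
  next
    case False
    have "\<rho> \<noteq> 0" using L14 assms by simp
    then show ?thesis unfolding L14 by (rule der_L14[OF refl _ False])
  qed
next
  case L15
  then show ?thesis using der_L15 der_L15_CHAR_2 by blast
next
  case (L16 \<beta> \<gamma>)
  then have "\<beta> \<noteq> 0"
    using assms irreducible_quadratic_no_root[of \<beta> \<gamma> 0] by auto
  then show ?thesis using L16 der_L16 der_L16_CHAR_2 by blast
qed (use assms der_L1[OF refl] der_L2[OF refl] der_L7[OF refl] der_L8[OF refl]
    der_L9[OF refl] der_L10[OF refl] der_L11[OF refl] der_L12[OF refl] der_L13[OF refl] in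
    \<open>simp_all del: der_description.simps mult_table.simps\<close>)

section \<open>Classification of the algebras\<close>

locale leibniz_algebra_dim_3 = left_leibniz_algebra +
  assumes dim_UNIV: "dim UNIV = 3"
begin

lemma br_add_left: "br (x + y) z = br x z + br y z"
  and br_scale_left: "br (scale c x) z = scale c (br x z)"
  and br_add_right: "br z (x + y) = br z x + br z y"
  and br_scale_right: "br z (scale c x) = scale c (br z x)"
  and br_diff_left: "br (x - y) z = br x z - br y z"
  and br_diff_right: "br z (x - y) = br z x - br z y"
  and br_minus_left: "br (- x) z = - br x z"
  and br_minus_right: "br z (- x) = - br z x"
  and br_zero_left: "br 0 z = 0"
  and br_zero_right: "br z 0 = 0"
proof -
  interpret l: Vector_Spaces.linear scale scale "\<lambda>x. br x z" by (rule linear_left)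
  interpret r: Vector_Spaces.linear scale scale "\<lambda>x. br z x" by (rule linear_right)
  show "br (x + y) z = br x z + br y z" "br (scale c x) z = scale c (br x z)"
    "br z (x + y) = br z x + br z y" "br z (scale c x) = scale c (br z x)"
    "br (x - y) z = br x z - br y z" "br z (x - y) = br z x - br z y"
    "br (- x) z = - br x z" "br z (- x) = - br z x" "br 0 z = 0" "br z 0 = 0"
    by (rule l.add l.scale r.add r.scale l.diff r.diff l.neg r.neg l.zero r.zero)+
qed

lemmas br_simps = br_add_left br_scale_left br_add_right br_scale_right br_diff_left br_diff_right
  br_minus_left br_minus_right br_zero_left br_zero_right

text \<open>Independence is stated by coefficients of an ordered triple, since a set forgets order
  and repetition and does not support comparing coefficients or exchanging one basis vector at a
  time.\<close>

definition indep3 :: "'b \<Rightarrow> 'b \<Rightarrow> 'b \<Rightarrow> bool" where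
  "indep3 x y z \<longleftrightarrow>
    (\<forall>a b c. scale a x + scale b y + scale c z = 0 \<longrightarrow> a = 0 \<and> b = 0 \<and> c = 0)"

lemma indep3D:
  assumes "indep3 x y z" "scale a x + scale b y + scale c z = 0"
  shows "a = 0" "b = 0" "c = 0"
  using assms by (auto simp: indep3_def)

lemma indep3_eqD:
  assumes "indep3 x y z"
    and "scale a x + scale b y + scale c z = scale a' x + scale b' y + scale c' z"
  shows "a = a'" "b = b'" "c = c'"
proof -
  have "scale (a - a') x + scale (b - b') y + scale (c - c') z = 0"
    using assms(2) by (simp add: scale_left_diff_distrib algebra_simps)
  from indep3D[OF assms(1) this] show "a = a'" "b = b'" "c = c'" by auto
qed

lemma indep3_swap12: "indep3 x y z \<Longrightarrow> indep3 y x z"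
  unfolding indep3_def
proof (intro allI impI)
  fix a b c
  assume *: "\<forall>a b c. scale a x + scale b y + scale c z = 0 \<longrightarrow> a = 0 \<and> b = 0 \<and> c = 0"
    and "scale a y + scale b x + scale c z = 0"
  then have "scale b x + scale a y + scale c z = 0" by (simp add: ac_simps)
  then show "a = 0 \<and> b = 0 \<and> c = 0" using * by blast
qed

lemma indep3_swap23: "indep3 x y z \<Longrightarrow> indep3 x z y"
  unfolding indep3_def
proof (intro allI impI)
  fix a b c
  assume *: "\<forall>a b c. scale a x + scale b y + scale c z = 0 \<longrightarrow> a = 0 \<and> b = 0 \<and> c = 0"
    and "scale a x + scale b z + scale c y = 0"
  then have "scale a x + scale c y + scale b z = 0" by (simp add: ac_simps)
  then show "a = 0 \<and> b = 0 \<and> c = 0" using * by blast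
qed

text \<open>The changes of basis below are composites of such replacements, each needing one nonzero
  coefficient. Many new basis vectors are therefore written with explicit coefficients
  \<open>0\<close> and \<open>1\<close>.\<close>

lemma indep3_replace1:
  assumes "indep3 x y z" "a \<noteq> 0" "x' = scale a x + scale b y + scale c z"
  shows "indep3 x' y z"
  unfolding indep3_def
proof (intro allI impI)
  fix p q r assume "scale p x' + scale q y + scale r z = 0"
  then have "scale (p * a) x + scale (p * b + q) y + scale (p * c + r) z = 0"
    by (simp add: assms(3) scale_left_distrib scale_right_distrib algebra_simps)
  from indep3D[OF assms(1) this] show "p = 0 \<and> q = 0 \<and> r = 0" using assms(2) by auto
qed

lemma indep3_replace2:
  assumes "indep3 x y z" "b \<noteq> 0" "y' = scale a x + scale b y + scale c z"
  shows "indep3 x y' z"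
  using indep3_replace1[OF indep3_swap12[OF assms(1)] assms(2), of y' a c] assms(3)
  by (simp add: indep3_swap12 add.commute)

lemma indep3_replace3:
  assumes "indep3 x y z" "c \<noteq> 0" "z' = scale a x + scale b y + scale c z"
  shows "indep3 x y z'"
  using indep3_replace2[OF indep3_swap23[OF assms(1)] assms(2), of z' a b] assms(3)
  by (simp add: indep3_swap23 add.commute add.left_commute)

lemma finite_dimensional:
  obtains B where "finite_dimensional_vector_space scale B"
proof -
  obtain B where B: "independent B" "UNIV \<subseteq> span B" "card B = 3"
    using basis_exists[of UNIV] dim_UNIV by metis
  \<comment> \<open>Cardinality \<open>3\<close> excludes infinite sets, to which
    \<open>card\<close> assigns \<open>0\<close>.\<close>
  then have "finite_dimensional_vector_space scale B"
    by unfold_locales (auto intro: card_ge_0_finite)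
  then show ?thesis by (rule that)
qed

lemma indep3_independent:
  assumes "indep3 x y z"
  shows "distinct [x, y, z]" "independent {x, y, z}"
proof -
  show d: "distinct [x, y, z]"
    using indep3D[OF assms, of 1 "- 1" 0] indep3D[OF assms, of 1 0 "- 1"]
      indep3D[OF assms, of 0 1 "- 1"]
    by auto
  show "independent {x, y, z}"
  proof
    assume "dependent {x, y, z}"
    then obtain u where u: "\<exists>v\<in>{x, y, z}. u v \<noteq> 0" "(\<Sum>v\<in>{x, y, z}. scale (u v) v) = 0"
      by (auto simp: dependent_finite)
    then have "scale (u x) x + scale (u y) y + scale (u z) z = 0"
      using d by (simp add: add.assoc)
    from indep3D[OF assms this] u(1) show False by auto
  qed
qed

lemma indep3_span: "indep3 x y z \<Longrightarrow> span {x, y, z} = UNIV"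
proof -
  assume *: "indep3 x y z"
  obtain B where "finite_dimensional_vector_space scale B" by (rule finite_dimensional)
  then interpret fd: finite_dimensional_vector_space scale B .
  show ?thesis
    using fd.card_ge_dim_independent[of "{x, y, z}" UNIV] indep3_independent[OF *] dim_UNIV
    by auto
qed

lemma indep3_coords:
  assumes "indep3 x y z"
  obtains a b c where "v = scale a x + scale b y + scale c z"
proof -
  have "v \<in> span {x, y, z}" using indep3_span[OF assms] by simp
  then obtain a b c where "v - scale a x - scale b y - scale c z = 0"
    by (auto simp: span_breakdown_eq)
  then have "v = scale a x + scale b y + scale c z" by (simp add: algebra_simps)
  then show ?thesis by (rule that)
qed

lemma ex_not_in_span:
  assumes "finite S" "card S < 3"
  obtains x where "x \<notin> span S"
proof -
  have "\<not> UNIV \<subseteq> span S" using dim_le_card[of UNIV S] assms dim_UNIV by auto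
  then show ?thesis using that by blast
qed

lemma indep3_extend2:
  assumes "\<And>a b. scale a y + scale b z = 0 \<Longrightarrow> a = 0 \<and> b = 0"
  obtains x where "indep3 x y z"
proof -
  have "card {y, z} < 3" by (cases "y = z") auto
  then obtain x where x: "x \<notin> span {y, z}" by (rule ex_not_in_span[rotated]) auto
  have "indep3 x y z"
    unfolding indep3_def
  proof (intro allI impI)
    fix a b c assume *: "scale a x + scale b y + scale c z = 0"
    have "a = 0"
    proof (rule ccontr)
      assume "a \<noteq> 0"
      have "scale a x = - (scale b y + scale c z)"
        using * by (metis add.assoc eq_neg_iff_add_eq_0)
      then have "scale a x \<in> span {y, z}"
        by (simp add: span_diff span_neg span_scale span_base)
      then show False using x \<open>a \<noteq> 0\<close> span_scale[of "scale a x" "{y, z}" "inverse a"] by simp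
    qed
    then show "a = 0 \<and> b = 0 \<and> c = 0" using * assms by simp
  qed
  then show ?thesis by (rule that)
qed

lemma indep3_extend1:
  assumes "z \<noteq> 0"
  obtains x y where "indep3 x y z"
proof -
  obtain y where y: "y \<notin> span {z}" by (rule ex_not_in_span[of "{z}"]) auto
  have "a = 0 \<and> b = 0" if *: "scale a y + scale b z = 0" for a b
  proof -
    have "a = 0"
    proof (rule ccontr)
      assume "a \<noteq> 0"
      have "scale a y = - scale b z"
        using * by (simp add: eq_neg_iff_add_eq_0 add.assoc)
      then have "scale a y \<in> span {z}"
        by (auto intro!: span_neg span_scale intro: span_base)
      then show False using y \<open>a \<noteq> 0\<close> span_scale[of "scale a y" "{z}" "inverse a"] by simp
    qed
    then show ?thesis using * assms by simp
  qed
  then obtain x where "indep3 x y z" by (rule indep3_extend2)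
  then show ?thesis by (rule that)
qed

section \<open>Recognition of a type from nine products\<close>

definition has_type :: bool where
  "has_type \<longleftrightarrow> (\<exists>T b. admissible T \<and> ordered_basis b \<and> has_mult_table b (mult_table T))"

definition lincomb :: "'b \<Rightarrow> 'b \<Rightarrow> 'b \<Rightarrow> 'a ^ 3 \<Rightarrow> 'b" where
  "lincomb x y z v = scale (v $ 1) x + scale (v $ 2) y + scale (v $ 3) z"

lemma has_typeI:
  assumes "admissible T" "indep3 x y z"
    and "br x x = lincomb x y z (mult_table T 1 1)" "br x y = lincomb x y z (mult_table T 1 2)"
    and "br x z = lincomb x y z (mult_table T 1 3)" "br y x = lincomb x y z (mult_table T 2 1)"
    and "br y y = lincomb x y z (mult_table T 2 2)" "br y z = lincomb x y z (mult_table T 2 3)"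
    and "br z x = lincomb x y z (mult_table T 3 1)" "br z y = lincomb x y z (mult_table T 3 2)"
    and "br z z = lincomb x y z (mult_table T 3 3)"
  shows has_type
proof -
  define b :: "3 \<Rightarrow> 'b" where "b = (\<lambda>i. if i = 1 then x else if i = 2 then y else z)"
  have b: "b 1 = x" "b 2 = y" "b 3 = z" by (simp_all add: b_def)
  have range: "range b = {x, y, z}" by (auto simp: UNIV_3 b)
  have "\<forall>i j. b i = b j \<longrightarrow> i = j"
    using indep3_independent(1)[OF assms(2)] by (auto simp: forall_3 b)
  then have "inj b" by (auto simp: inj_def)
  then have "ordered_basis b"
    using indep3_independent[OF assms(2)] indep3_span[OF assms(2)]
    by (simp add: ordered_basis_def range)
  moreover have "has_mult_table b (mult_table T)"
    using assms(3-) by (simp add: has_mult_table_def forall_3 sum_3 b lincomb_def)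
  ultimately show ?thesis using assms(1) unfolding has_type_def by blast
qed

lemmas table_simps = lincomb_def products_def axis_def

section \<open>Squares spanning a plane: normal forms of \<open>br x\<close>\<close>

lemma indep3_shift:
  assumes "indep3 x f g" "k \<noteq> 0"
  shows "indep3 (scale k (x + scale s f + scale t g)) f g"
  by (rule indep3_replace1[OF assms, where b = "k * s" and c = "k * t"])
    (simp add: scale_right_distrib)

lemma br_shift:
  assumes "\<And>v. br f v = 0" "\<And>v. br g v = 0"
  shows "br (scale k (x + scale s f + scale t g)) v = scale k (br x v)"
  by (simp add: br_simps assms)

text \<open>As both eigenvalues are nonzero, a correction of \<open>x\<close> inside the plane gives
  \<open>br x x\<close> any prescribed value. Scaling \<open>x\<close> scales both eigenvalues, so
  only their ratio survives, as the parameter of \<open>L14\<close>.\<close>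

lemma has_type_diag:
  assumes i: "indep3 x f g" and c: "\<And>v. br f v = 0" "\<And>v. br g v = 0"
    and t: "br x x = scale a f + scale b g" "br x f = scale \<mu> f" "br x g = scale \<nu> g"
    and n: "\<mu> \<noteq> 0" "\<nu> \<noteq> 0"
  shows has_type
proof -
  \<comment> \<open>These solve \<open>a + s * \<mu> = \<mu>\<^sup>2\<close> and
    \<open>b + t * \<nu> = 0\<close>: the factor \<open>1 / \<mu>\<close> in \<open>x'\<close>
    enters its square twice and turns \<open>\<mu>\<^sup>2\<close> into \<open>1\<close>.\<close>
  define s t where "s = (\<mu>\<^sup>2 - a) / \<mu>" "t = - b / \<nu>"
  define x' where "x' = scale (1 / \<mu>) (x + scale s f + scale t g)"
  have i': "indep3 x' f g" using indep3_shift[OF i] n by (simp add: x'_def)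
  have x': "br x' v = scale (1 / \<mu>) (br x v)" for v
    by (simp only: x'_def br_shift[OF c])
  have x'x': "br x' x' = f"
  proof -
    have "br x (x + scale s f + scale t g) = scale (a + s * \<mu>) f + scale (b + t * \<nu>) g"
      by (simp add: br_simps assms(4-6) scale_left_distrib ac_simps)
    also have "\<dots> = scale (\<mu>\<^sup>2) f" using n by (simp add: s_t_def)
    finally show ?thesis using n unfolding x' by (simp add: x'_def br_scale_right power2_eq_square)
  qed
  show ?thesis
    by (rule has_typeI[of "L14 (\<nu> / \<mu>)", OF _ i'])
      (use n in \<open>simp_all add: table_simps c x'x'\<close>, use n in \<open>simp_all add: x' assms(5,6) c\<close>)
qed


lemma has_type_jordan:
  assumes i: "indep3 x f g" and c: "\<And>v. br f v = 0" "\<And>v. br g v = 0"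
    and t: "br x x = scale a f + scale b g" "br x f = scale \<mu> f + g" "br x g = scale \<mu> g"
    and n: "\<mu> \<noteq> 0"
  shows has_type
proof -
  \<comment> \<open>Now \<open>a + s * \<mu> = \<mu>\<^sup>2\<close> and
    \<open>b + s + t * \<mu> = 0\<close>. Scaling \<open>x\<close> also divides the off-diagonal
    entry of the Jordan block by \<open>\<mu>\<close>, which \<open>g'\<close> absorbs.\<close>
  define s where "s = (\<mu>\<^sup>2 - a) / \<mu>"
  define t where "t = - (b + s) / \<mu>"
  define x' where "x' = scale (1 / \<mu>) (x + scale s f + scale t g)"
  define g' where "g' = scale (1 / \<mu>) g"
  have i': "indep3 x' f g'"
    using indep3_replace3[OF indep3_shift[OF i, of "1 / \<mu>" s t], of "1 / \<mu>" g' 0 0] n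
    by (simp add: g'_def x'_def)
  have x': "br x' v = scale (1 / \<mu>) (br x v)" for v
    by (simp only: x'_def br_shift[OF c])
  have x'x': "br x' x' = f"
  proof -
    have "br x (x + scale s f + scale t g) = scale (a + s * \<mu>) f + scale (b + s + t * \<mu>) g"
      by (simp add: br_simps assms(4-6) scale_left_distrib scale_right_distrib ac_simps)
    also have "\<dots> = scale (\<mu>\<^sup>2) f" using n by (simp add: s_def t_def)
    finally show ?thesis using n unfolding x' by (simp add: x'_def br_scale_right power2_eq_square)
  qed
  show ?thesis
    by (rule has_typeI[of L15, OF _ i'])
      (use n in \<open>simp_all add: table_simps c x'x'\<close>,
        use n in \<open>simp_all add: x' assms(5,6) c g'_def br_simps scale_right_distrib\<close>)
qed

lemma irreducible_quadratic:
  fixes \<beta> \<gamma> :: "'c::field"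
  assumes "\<And>x. x\<^sup>2 - \<gamma> * x - \<beta> \<noteq> 0"
  shows "irreducible [:- \<beta>, - \<gamma>, 1:]"
proof (rule irreducibleI)
  show "\<not> [:- \<beta>, - \<gamma>, 1:] dvd 1" by (simp add: is_unit_pCons_iff)
next
  fix p q :: "'c poly" assume pq: "[:- \<beta>, - \<gamma>, 1:] = p * q"
  then have nz: "p \<noteq> 0" "q \<noteq> 0" by auto
  have "degree p + degree q = 2"
    using degree_mult_eq[OF nz] by (simp add: pq[symmetric])
  then consider "degree p = 0" | "degree q = 0" | "degree p = 1"
    by linarith
  then show "p dvd 1 \<or> q dvd 1"
  proof cases
    case 3
    then obtain c d where p: "p = [:c, d:]" "d \<noteq> 0"
      by (metis degree1_coeffs)
    have "poly [:- \<beta>, - \<gamma>, 1:] (- c / d) = 0" unfolding pq using p by simp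
    then show ?thesis using assms[of "- c / d"] by (simp add: power2_eq_square algebra_simps)
  qed (use nz in \<open>auto simp: is_unit_iff_degree\<close>)
qed simp

text \<open>On the plane, \<open>br x\<close> is the companion matrix of the polynomial whose root
  is sought, and \<open>\<beta> \<noteq> 0\<close> makes it invertible. Without a root this is
  already \<open>L16\<close>; a root splits the polynomial, and the plane carries a Jordan block or
  two eigenvectors.\<close>

lemma has_type_cyclic:
  assumes i: "indep3 x f g" and c: "\<And>v. br f v = 0" "\<And>v. br g v = 0"
    and t: "br x x = scale a f + scale b g" "br x f = g" "br x g = scale \<beta> f + scale \<gamma> g"
    and n: "\<beta> \<noteq> 0"
  shows has_type
proof (cases "\<exists>\<mu>. \<mu>\<^sup>2 - \<gamma> * \<mu> - \<beta> = 0")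
  case False
  \<comment> \<open>The conditions are \<open>a + t * \<beta> = 1\<close> and
    \<open>b + s + t * \<gamma> = 0\<close>.\<close>
  define t where "t = (1 - a) / \<beta>"
  define s where "s = - b - t * \<gamma>"
  define x' where "x' = scale 1 x + scale s f + scale t g"
  have i': "indep3 x' f g" using indep3_replace1[OF i _ x'_def] by simp
  have x'x': "br x' x' = f"
  proof -
    have "br x' x' = scale (a + t * \<beta>) f + scale (b + s + t * \<gamma>) g"
      unfolding x'_def
      by (simp add: br_simps c assms(4-6) scale_right_distrib scale_left_distrib algebra_simps)
    then show ?thesis using n by (simp add: s_def t_def)
  qed
  show ?thesis
    by (rule has_typeI[of "L16 \<beta> \<gamma>", OF _ i'])
      (use False in \<open>simp_all add: irreducible_quadratic table_simps br_simps c x'x',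
        simp_all add: x'_def br_simps c assms(4-6)\<close>)
next
  case True
  then obtain \<mu> where \<mu>: "\<mu>\<^sup>2 - \<gamma> * \<mu> - \<beta> = 0" by blast
  define \<rho> where "\<rho> = \<gamma> - \<mu>"
  have \<beta>: "\<beta> = - \<mu> * \<rho>" and \<gamma>: "\<gamma> = \<mu> + \<rho>"
    using \<mu> by (simp_all add: \<rho>_def algebra_simps power2_eq_square)
  then have nz: "\<mu> \<noteq> 0" "\<rho> \<noteq> 0" using n by auto
  \<comment> \<open>The image of \<open>f\<close> under \<open>br x - \<mu>\<close>; by
    Cayley-Hamilton it is an eigenvector for the other eigenvalue \<open>\<rho>\<close>.\<close>
  define h where "h = scale (- \<mu>) f + g"
  have hc: "br h v = 0" for v by (simp add: h_def br_simps c)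
  have i1: "indep3 x f h" using indep3_replace3[OF i, of 1 h 0 "- \<mu>"] by (simp add: h_def)
  have xh: "br x h = scale \<rho> h"
    by (simp add: h_def br_simps assms(4-6) \<beta> \<gamma> scale_right_distrib scale_left_distrib
        scale_right_diff_distrib algebra_simps)
  have xf: "br x f = scale \<mu> f + h" by (simp add: h_def assms(5))
  have g: "g = scale \<mu> f + h" by (simp add: h_def)
  have xx: "br x x = scale (a + b * \<mu>) f + scale b h"
    unfolding assms(4) g by (simp add: scale_right_distrib scale_left_distrib algebra_simps)
  show ?thesis
  proof (cases "\<rho> = \<mu>")
    case True
    show ?thesis by (rule has_type_jordan[OF i1 c(1) hc xx xf _ nz(1)]) (simp add: xh True)
  next
    case False
    \<comment> \<open>This is \<open>g - \<rho> f\<close>, the eigenvector for \<open>\<mu>\<close>,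
      expressed through \<open>h\<close>.\<close>
    define k where "k = scale (\<mu> - \<rho>) f + h"
    have kc: "br k v = 0" for v by (simp add: k_def br_simps c hc)
    have i2: "indep3 x k h"
      using indep3_replace2[OF i1, of "\<mu> - \<rho>" k 0 1] False by (simp add: k_def)
    have xk: "br x k = scale \<mu> k"
      by (simp add: k_def br_simps xf xh scale_right_distrib scale_left_distrib
          scale_left_diff_distrib scale_right_diff_distrib algebra_simps)
    define p where "p = (a + b * \<mu>) / (\<mu> - \<rho>)"
    have "br x x = scale p k + scale (b - p) h"
    proof -
      have "scale p (scale (\<mu> - \<rho>) f) = scale (a + b * \<mu>) f" using False by (simp add: p_def)
      then show ?thesis
        by (simp add: xx k_def scale_right_distrib scale_left_diff_distrib del: scale_scale)
    qed
    then show ?thesis by (rule has_type_diag[OF i2 kc hc _ xk xh nz])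
  qed
qed

text \<open>\<open>g\<close> lies in the kernel of \<open>br x\<close>, and the determinant
  condition says that \<open>br x x\<close> and \<open>br x f\<close> span the plane. If
  \<open>br x\<close> is nilpotent on the plane the type is \<open>L12\<close>; a nonzero eigenvalue
  \<open>a\<close> gives \<open>L13\<close>.\<close>

lemma has_type_singular:
  assumes i: "indep3 x f g" and c: "\<And>v. br f v = 0" "\<And>v. br g v = 0"
    and t: "br x x = scale c' f + scale d g" "br x f = scale a f + scale b g" "br x g = 0"
    and n: "a * d - b * c' \<noteq> 0"
  shows has_type
proof (cases "a = 0")
  case True
  define y where "y = scale c' f + scale d g"
  define z where "z = scale (c' * b) g"
  have nz: "c' \<noteq> 0" "b \<noteq> 0" using n True by auto
  have "indep3 x y g" using indep3_replace2[OF i, of c' y 0 d] nz by (simp add: y_def)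
  then have i': "indep3 x y z"
    using indep3_replace3[of x y g "c' * b" z 0 0] nz by (simp add: z_def)
  show ?thesis
    by (rule has_typeI[of L12, OF _ i'])
      (simp_all add: table_simps y_def z_def br_simps c t True)
next
  case False
  define h where "h = scale 1 f + scale (b / a) g"
  \<comment> \<open>The component of \<open>br x x\<close> along the kernel. Corrections of
    \<open>x\<close> inside the plane only add multiples of \<open>h\<close>, so it survives and
    accounts for the third basis vector.\<close>
  define e where "e = (a * d - b * c') / a"
  have e: "e \<noteq> 0" using n False by (simp add: e_def)
  have i1: "indep3 x h g" using indep3_replace2[OF i, of 1 h 0 "b / a"] by (simp add: h_def)
  have hc: "br h v = 0" for v by (simp add: h_def br_simps c)
  have xh: "br x h = scale a h"
    using False by (simp add: h_def br_simps t scale_right_distrib)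
  have xx: "br x x = scale c' h + scale e g"
    using False by (simp add: h_def e_def t scale_right_distrib scale_left_diff_distrib
        diff_divide_distrib mult.commute)
  \<comment> \<open>\<open>s\<close> solves \<open>c' + s * a = a\<^sup>2\<close>. Then
    \<open>y\<close> is the square of \<open>x'\<close>, and \<open>z\<close> is
    \<open>br x' y - y\<close>, as \<open>br x' y = h\<close>.\<close>
  define s where "s = (a\<^sup>2 - c') / a"
  define x' where "x' = scale (1 / a) (x + scale s h + scale 0 g)"
  define y where "y = scale 0 x' + scale 1 h + scale (e / a\<^sup>2) g"
  define z where "z = scale 0 x' + scale 0 y + scale (- e / a\<^sup>2) g"
  have "indep3 x' h g" using indep3_shift[OF i1, of "1 / a" s 0] False by (simp add: x'_def)
  then have "indep3 x' y g" using indep3_replace2[OF _ _ y_def] by simp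
  then have i': "indep3 x' y z" using indep3_replace3[OF _ _ z_def] False e by simp
  have x': "br x' v = scale (1 / a) (br x v)" for v
    by (simp only: x'_def br_shift[OF hc c(2)])
  have x'x': "br x' x' = y"
  proof -
    have "br x (x + scale s h + scale 0 g) = scale (c' + s * a) h + scale e g"
      by (simp add: br_simps xx xh scale_left_distrib ac_simps)
    also have "\<dots> = scale (a\<^sup>2) h + scale e g" using False by (simp add: s_def)
    finally have "br x x' = scale (1 / a) (scale (a\<^sup>2) h + scale e g)"
      by (simp only: x'_def br_scale_right)
    then show ?thesis using False
      by (simp add: x' y_def power2_eq_square scale_right_distrib)
  qed
  show ?thesis
    by (rule has_typeI[of L13, OF _ i'])
      (simp_all add: table_simps x'x',
        use False in \<open>simp_all add: x' y_def z_def br_simps c hc t(3) xh\<close>)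
qed

text \<open>With \<open>A = br x\<close> and \<open>K\<close> the plane spanned by \<open>f\<close> and \<open>g\<close>, replacing \<open>x\<close> by \<open>x + k\<close> with \<open>k\<close> in
  \<open>K\<close> changes \<open>A x\<close> by \<open>A k\<close> and leaves \<open>A\<close> unchanged. So if \<open>A\<close> is invertible on \<open>K\<close>, only its
  conjugacy class up to scaling matters.\<close>

lemma has_type_left_center_dim_2:
  assumes i: "indep3 x f g" and c: "\<And>v. br f v = 0" "\<And>v. br g v = 0"
    and t: "br x x = scale c1 f + scale c2 g" "br x f = scale a11 f + scale a21 g"
      "br x g = scale a12 f + scale a22 g"
    and surj: "\<And>k. (\<And>v. br k v = 0) \<Longrightarrow> k \<in> range (br x)"
  shows has_type
proof (cases "a11 * a22 - a12 * a21 = 0")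
  case False
  \<comment> \<open>A nonzero off-diagonal entry makes \<open>f\<close> or \<open>g\<close>
    independent of its image, hence a cyclic vector; in the new basis \<open>\<beta>\<close> is
    minus the determinant and \<open>\<gamma>\<close> the trace.\<close>
  consider "a21 \<noteq> 0" | "a12 \<noteq> 0" | "a21 = 0" "a12 = 0" by blast
  then show ?thesis
  proof cases
    case 1
    define h where "h = scale 0 x + scale a11 f + scale a21 g"
    have i': "indep3 x f h" by (rule indep3_replace3[OF i 1 h_def])
    have hc: "br h v = 0" for v by (simp add: h_def br_simps c)
    have xf: "br x f = h" by (simp add: h_def t)
    have g: "g = scale (1 / a21) h + scale (- a11 / a21) f"
      using 1 by (simp add: h_def scale_right_distrib)
    have xx: "br x x = scale (c1 - c2 * a11 / a21) f + scale (c2 / a21) h"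
      unfolding t(1) by (subst (1) g) (simp add: scale_right_distrib scale_left_diff_distrib
          scale_right_diff_distrib)
    have "br x h = scale (a12 * a21 - a11 * a22) f + scale (a11 + a22) h"
      unfolding h_def
      by (simp add: br_simps t scale_right_distrib scale_left_distrib scale_left_diff_distrib
          algebra_simps)
    then show ?thesis
      by (rule has_type_cyclic[OF i' c(1) hc xx xf]) (use False in \<open>simp add: algebra_simps\<close>)
  next
    case 2
    define h where "h = scale 0 x + scale a22 g + scale a12 f"
    have i': "indep3 x g h" by (rule indep3_replace3[OF indep3_swap23[OF i] 2 h_def])
    have hc: "br h v = 0" for v by (simp add: h_def br_simps c)
    have xg: "br x g = h" by (simp add: h_def t)
    have f: "f = scale (1 / a12) h + scale (- a22 / a12) g"
      using 2 by (simp add: h_def scale_right_distrib)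
    have xx: "br x x = scale (c2 - c1 * a22 / a12) g + scale (c1 / a12) h"
      unfolding t(1) by (subst (1) f) (simp add: scale_right_distrib scale_left_diff_distrib
          scale_right_diff_distrib)
    have "br x h = scale (a12 * a21 - a11 * a22) g + scale (a11 + a22) h"
      unfolding h_def
      by (simp add: br_simps t scale_right_distrib scale_left_distrib scale_left_diff_distrib
          algebra_simps)
    then show ?thesis
      by (rule has_type_cyclic[OF i' c(2) hc xx xg]) (use False in \<open>simp add: algebra_simps\<close>)
  next
    case 3
    then show ?thesis using has_type_diag[OF i c t(1), of a11 a22] t(2,3) False by simp
  qed
next
  case True
  have sing: has_type
    if i: "indep3 x f g" and c: "\<And>v. br f v = 0" "\<And>v. br g v = 0"
      and t: "br x x = scale c' f + scale d g" "br x f = scale a f + scale b g" "br x g = 0"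
    for f g c' d a b
  proof (rule has_type_singular[OF i c t])
    have "f \<in> range (br x)" "g \<in> range (br x)" using c by (auto intro: surj)
    then obtain v w where vw: "f = br x v" "g = br x w" by auto
    obtain p q r where v: "v = scale p x + scale q f + scale r g" using indep3_coords[OF i] .
    obtain p' q' r' where w: "w = scale p' x + scale q' f + scale r' g" using indep3_coords[OF i] .
    have "scale 0 x + scale 1 f + scale 0 g =
        scale 0 x + scale (p * c' + q * a) f + scale (p * d + q * b) g"
      using vw(1) by (simp add: v br_simps t scale_right_distrib scale_left_distrib algebra_simps)
    note e1 = indep3_eqD[OF i this]
    have "scale 0 x + scale 0 f + scale 1 g =
        scale 0 x + scale (p' * c' + q' * a) f + scale (p' * d + q' * b) g"
      using vw(2) by (simp add: w br_simps t scale_right_distrib scale_left_distrib algebra_simps)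
    note e2 = indep3_eqD[OF i this]
    \<comment> \<open>The comparisons \<open>e1\<close> and \<open>e2\<close> say that a product of
      two 2 by 2 matrices is the identity; this is its determinant.\<close>
    have "(p * q' - q * p') * (c' * b - d * a) = 1"
    proof -
      have "(p * q' - q * p') * (c' * b - d * a) =
          (p * c' + q * a) * (p' * d + q' * b) - (p' * c' + q' * a) * (p * d + q * b)"
        by (simp add: algebra_simps)
      then show ?thesis using e1[symmetric] e2[symmetric] by simp
    qed
    then have "c' * b - d * a \<noteq> 0" by auto
    then show "a * d - b * c' \<noteq> 0" by (auto simp: mult.commute)
  qed
  show ?thesis
  proof (cases "a12 = 0 \<and> a22 = 0")
    case True
    then show ?thesis using sing[OF i c t(1,2)] t(3) by simp
  next
    case nz: False
    \<comment> \<open>The columns of a singular matrix with nonzero second column are proportional: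
      the first is \<open>k\<close> times the second, so \<open>f - k g\<close> spans the kernel on
      the plane.\<close>
    define k where "k = (if a12 \<noteq> 0 then a11 / a12 else a21 / a22)"
    have k: "a11 = k * a12" "a21 = k * a22"
      using True nz by (auto simp: k_def field_simps)
    define h where "h = scale 0 x + scale 1 f + scale (- k) g"
    have i': "indep3 x g h"
      using indep3_replace2[OF i _ h_def] by (simp add: indep3_swap23)
    have hc: "br h v = 0" for v by (simp add: h_def br_simps c)
    have f: "f = h + scale k g" by (simp add: h_def)
    have xh: "br x h = 0" by (simp add: h_def br_simps t k scale_right_distrib)
    have xg: "br x g = scale (a12 * k + a22) g + scale a12 h"
      unfolding t(3) by (subst (1) f) (simp add: scale_right_distrib scale_left_distrib)
    have xx: "br x x = scale (c1 * k + c2) g + scale c1 h"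
      unfolding t(1) by (subst (1) f) (simp add: scale_right_distrib scale_left_distrib)
    show ?thesis by (rule sing[OF i' c(2) hc xx xg xh])
  qed
qed

lemma left_center_square: "br (br x x) v = 0"
  using left_leibniz[of x x v] by simp

section \<open>Squares spanning a line\<close>

lemma square_add: "br (x + y) (x + y) = br x x + br y y + (br x y + br y x)"
  by (simp add: br_simps ac_simps)

text \<open>A root \<open>r\<close> of the quadratic polynomial makes \<open>scale r x + y\<close> isotropic.\<close>

lemma has_type_form_normalized:
  assumes i: "indep3 x y e" and c: "\<And>v. br e v = 0" "br x e = 0" "br y e = 0"
    and t: "br x x = e" "br y x = 0" "br x y = scale q e" "br y y = scale s e"
    and q: "q = 0 \<or> q = 1"
  shows has_type
proof (cases "\<exists>r. r\<^sup>2 + q * r + s = 0")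
  case False
  show ?thesis
  proof (cases "q = 0")
    case True
    show ?thesis
      by (rule has_typeI[of "L5 s", OF _ i]) (use False True in \<open>simp_all add: table_simps c t\<close>)
  next
    case False
    then have "q = 1" using q by simp
    then show ?thesis
      by (intro has_typeI[of "L6 s", OF _ i])
        (use \<open>\<nexists>r. r\<^sup>2 + q * r + s = 0\<close> in \<open>simp_all add: table_simps c t\<close>)
  qed
next
  case True
  then obtain r where r: "r\<^sup>2 + q * r + s = 0" by blast
  show ?thesis
  proof (cases "s = 0")
    case True
    show ?thesis
      by (rule has_typeI[of "if q = 0 then L1 else L2", OF _ i])
        (use q True in \<open>auto simp: table_simps c t\<close>)
  next
    case False
    then have r0: "r \<noteq> 0" using r by auto
    \<comment> \<open>The isotropic vector \<open>r x + y\<close> is divided by \<open>r\<close> to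
      make \<open>br y' x = e\<close>; then \<open>br x y' = scale (1 + q / r) e\<close>, which
      gives \<open>\<alpha>\<close>.\<close>
    define \<alpha> where "\<alpha> = (r + q) / r"
    define y' where "y' = scale 1 x + scale (1 / r) y + scale 0 e"
    have i': "indep3 x y' e" using indep3_replace2[OF i _ y'_def] r0 by simp
    have "br y' y' = scale (1 + q / r + s / (r * r)) e"
      by (simp add: y'_def br_simps c t scale_left_distrib scale_right_distrib ac_simps)
    also have "1 + q / r + s / (r * r) = (r\<^sup>2 + q * r + s) / (r * r)"
      using r0 by (simp add: add_divide_distrib power2_eq_square)
    finally have yy: "br y' y' = 0" by (simp add: r)
    have xy: "br x y' = scale \<alpha> e"
      using r0 by (simp add: y'_def br_simps t \<alpha>_def add_divide_distrib scale_left_distrib)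
    have yx: "br y' x = e" by (simp add: y'_def br_simps t)
    have c': "br y' e = 0" by (simp add: y'_def br_simps c)
    have "\<alpha> \<noteq> 0"
    proof
      assume "\<alpha> = 0"
      then have "r = - q" using r0 by (simp add: \<alpha>_def eq_neg_iff_add_eq_0)
      then show False using r False by (simp add: power2_eq_square)
    qed
    then show ?thesis
      by (intro has_typeI[of "if \<alpha> = - 1 then L4 else L3 \<alpha>", OF _ i'])
        (auto simp: table_simps c c' t xy yx yy)
  qed
qed

text \<open>One-sided orthogonalization: subtracting a multiple of \<open>x\<close> from
  \<open>y\<close> makes \<open>br y' x\<close> vanish, which needs \<open>p \<noteq> 0\<close> but
  no division by \<open>2\<close>. The asymmetry \<open>q - r\<close> that remains in
  \<open>br x y'\<close> is then scaled to \<open>0\<close> or \<open>1\<close> by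
  \<open>k\<close>.\<close>

lemma has_type_form_aux:
  assumes i: "indep3 x y e" and c: "\<And>v. br e v = 0" "br x e = 0" "br y e = 0"
    and t: "br x x = scale p e" "br x y = scale q e" "br y x = scale r e" "br y y = scale s e"
    and p: "p \<noteq> 0"
  shows has_type
proof -
  define e' where "e' = scale 0 x + scale 0 y + scale p e"
  have i1: "indep3 x y e'" by (rule indep3_replace3[OF i p e'_def])
  have c': "br e' v = 0" "br x e' = 0" "br y e' = 0" for v by (simp_all add: e'_def br_simps c)
  define k where "k = (if q = r then 1 else p / (q - r))"
  have k: "k \<noteq> 0" using p by (simp add: k_def)
  define y' where "y' = scale (- (k * r / p)) x + scale k y + scale 0 e'"
  have i2: "indep3 x y' e'" by (rule indep3_replace2[OF i1 k y'_def])
  show ?thesis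
  proof (rule has_type_form_normalized[OF i2 c'(1,2)])
    show "br x x = e'" by (simp add: e'_def t)
    show "br y' e' = 0" by (simp add: y'_def br_simps c')
    show "br y' x = 0" using p by (simp add: y'_def br_simps t)
    show "br x y' = scale (k * (q - r) / p) e'"
      using p by (simp add: y'_def e'_def br_simps t scale_left_diff_distrib right_diff_distrib)
    have "br y' y' = scale (k * k * (s - q * r / p)) e"
      using p by (simp add: y'_def e'_def br_simps c t scale_left_diff_distrib[symmetric]
          scale_left_distrib[symmetric] field_simps)
    then show "br y' y' = scale (k * k * (s - q * r / p) / p) e'"
      using p by (simp add: e'_def)
    show "k * (q - r) / p = 0 \<or> k * (q - r) / p = 1"
      using p by (auto simp: k_def)
  qed
qed

text \<open>A form that is not alternating is nonzero on the diagonal at \<open>x\<close>,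
  \<open>y\<close> or \<open>x + y\<close>; that vector takes the first place.\<close>

lemma has_type_form:
  assumes i: "indep3 x y e" and c: "\<And>v. br e v = 0" "br x e = 0" "br y e = 0"
    and t: "br x x = scale p e" "br x y = scale q e" "br y x = scale r e" "br y y = scale s e"
    and n: "p \<noteq> 0 \<or> s \<noteq> 0 \<or> q + r \<noteq> 0"
  shows has_type
proof -
  consider "p \<noteq> 0" | "s \<noteq> 0" | "p = 0" "s = 0" "q + r \<noteq> 0" using n by blast
  then show ?thesis
  proof cases
    case 1
    then show ?thesis using has_type_form_aux[OF i c t] by blast
  next
    case 2
    then show ?thesis
      using has_type_form_aux[OF indep3_swap12[OF i] c(1,3,2) t(4,3,2,1)] by blast
  next
    case 3
    define x' where "x' = scale 1 x + scale 1 y + scale 0 e"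
    have i': "indep3 x' y e" using indep3_replace1[OF i _ x'_def] by simp
    have "br x' x' = scale (q + r) e" "br x' y = scale q e" "br y x' = scale r e" "br x' e = 0"
      by (simp_all add: x'_def br_simps c t 3 scale_left_distrib add.commute)
    then show ?thesis using has_type_form_aux[OF i' c(1) _ c(3) _ _ _ t(4)] 3 by blast
  qed
qed

lemma has_type_L9:
  assumes i: "indep3 x y e" and c: "\<And>v. br e v = 0"
    and t: "br x x = scale p e" "br x y = scale q e" "br y x = scale r e" "br y y = scale s e"
      "br x e = scale f e" "br y e = scale g e"
    and n: "f \<noteq> 0"
  shows has_type
proof -
  have e0: "e \<noteq> 0" using indep3D(3)[OF i, of 0 0 1] by auto
  \<comment> \<open>Two corrections of \<open>y\<close>, both possible because
    \<open>f \<noteq> 0\<close>: the multiple of \<open>x\<close> gives \<open>br y0 e = 0\<close>,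
    and the multiple of \<open>e\<close> in \<open>y1\<close> gives
    \<open>br x y1 = 0\<close>.\<close>
  define y0 where "y0 = y - scale (g / f) x"
  have y0e: "br y0 e = 0" using n by (simp add: y0_def br_simps t)
  define y1 where "y1 = y0 - scale ((q - g / f * p) / f) e"
  have y1': "y1 = scale (- (g / f)) x + scale 1 y + scale (- ((q - g / f * p) / f)) e"
    by (simp add: y1_def y0_def)
  have i1: "indep3 x y1 e" by (rule indep3_replace2[OF i _ y1']) simp
  have y1e: "br y1 e = 0" by (simp add: y1_def br_simps y0e c)
  have xy1: "br x y1 = 0"
    using n by (simp add: y1_def y0_def br_simps t scale_left_diff_distrib)
  have in_e: "\<exists>k. br y1 v = scale k e" if "v = x \<or> v = y1" for v
  proof -
    have *: "\<exists>k. br y1 w = scale k e" if "w = x \<or> w = y \<or> w = e" for w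
    proof -
      have "br y1 x = scale (r - g / f * p) e" "br y1 y = scale (s - g / f * q) e"
        by (simp_all add: y1_def y0_def br_simps c t scale_left_diff_distrib)
      then show ?thesis using that y1e by (metis scale_zero_left)
    qed
    then obtain k1 k2 where k: "br y1 x = scale k1 e" "br y1 y = scale k2 e" by blast
    have "br y1 y1 = scale (k2 - g / f * k1) e"
      by (subst (2) y1_def) (simp add: y0_def br_simps y1e k scale_left_diff_distrib)
    then show ?thesis using that k by blast
  qed
  \<comment> \<open>The identity at \<open>x\<close>, \<open>y1\<close>, \<open>v\<close> gives
    \<open>br x (br y1 v) = 0\<close>. But \<open>br y1 v\<close> is a multiple of \<open>e\<close>,
    on which \<open>br x\<close> is injective.\<close>
  have zero: "br y1 v = 0" if v: "v = x \<or> v = y1" for v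
  proof -
    obtain k where k: "br y1 v = scale k e" using in_e[OF v] by blast
    have "br y1 (br x v) = 0"
      using v xy1 by (auto simp: t br_simps y1e)
    moreover have "br (br x y1) v = 0" by (simp add: xy1 br_simps)
    ultimately have "br x (br y1 v) = 0" using left_leibniz[of x y1 v] by simp
    then have "scale (k * f) e = 0" by (simp add: k br_simps t)
    then show ?thesis using n e0 k by simp
  qed
  \<comment> \<open>The factor \<open>1 / f\<close> makes \<open>br x1 e = e\<close>; the square is
    then \<open>p / f\<^sup>2\<close> plus the coefficient of \<open>e\<close>, which is chosen to
    give the sum \<open>1\<close>.\<close>
  define x1 where "x1 = scale (1 / f) x + scale 0 y1 + scale (1 - p / f\<^sup>2) e"
  have i2: "indep3 x1 y1 e" using indep3_replace1[OF i1 _ x1_def] n by simp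
  have "br x1 e = e" using n by (simp add: x1_def br_simps c t)
  moreover have "br x1 x1 = e"
    using n by (simp add: x1_def br_simps c t y1e scale_left_diff_distrib scale_right_diff_distrib
        power2_eq_square)
  moreover have "br x1 y1 = 0" by (simp add: x1_def br_simps c xy1)
  moreover have "br y1 x1 = 0" by (simp add: x1_def br_simps zero y1e)
  ultimately show ?thesis
    by (intro has_typeI[of L9, OF _ i2]) (simp_all add: table_simps c zero y1e)
qed

text \<open>The relation between \<open>m\<close> and \<open>r\<close> leaves \<open>m = 0\<close>
  or \<open>r = 2\<close>. If \<open>r \<noteq> 0\<close>, adding a multiple of \<open>e\<close> to
  \<open>x\<close> gives \<open>br x x\<close> any value on the line; if \<open>r = 0\<close>, it
  changes nothing. So for \<open>r = 0\<close> the coefficient \<open>l\<close> is absorbed into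
  \<open>e\<close> (\<open>L7\<close>) or, in characteristic 2 with \<open>m \<noteq> 0\<close>,
  remains as the parameter of \<open>L8\<close>.\<close>

lemma has_type_nonabelian_normalized:
  assumes i: "indep3 x y e" and c: "\<And>v. br e v = 0" "br y e = 0"
    and t: "br x x = scale l e" "br x y = y" "br y x = - y" "br y y = scale m e"
      "br x e = scale r e"
    and n: "l \<noteq> 0 \<or> m \<noteq> 0 \<or> r \<noteq> 0" and mr: "m * r = 2 * m"
  shows has_type
proof (cases "m = 0")
  case m: True
  show ?thesis
  proof (cases "r = 0")
    case True
    define e' where "e' = scale 0 x + scale 0 y + scale l e"
    have l: "l \<noteq> 0" using n m True by simp
    have i': "indep3 x y e'" by (rule indep3_replace3[OF i l e'_def])
    show ?thesis
      by (rule has_typeI[of L7, OF _ i'])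
        (simp_all add: table_simps e'_def br_simps c t m True)
  next
    case False
    define x' where "x' = scale 1 x + scale 0 y + scale ((1 - l) / r) e"
    have i': "indep3 x' y e" using indep3_replace1[OF i _ x'_def] by simp
    show ?thesis
      by (rule has_typeI[of "L10 r", OF _ i'])
        (use False in \<open>simp_all add: table_simps x'_def br_simps c t m scale_left_diff_distrib\<close>)
  qed
next
  case m: False
  then have r: "r = 2" using mr by simp
  define e' where "e' = scale 0 x + scale 0 y + scale m e"
  have i': "indep3 x y e'" by (rule indep3_replace3[OF i m e'_def])
  show ?thesis
  proof (cases "CHAR('a) = 2")
    case True
    then have 2: "2 = (0::'a)" by (simp add: two_eq_0_iff_CHAR)
    have "y + y = scale 2 y" by (metis one_add_one scale_left_distrib scale_one)
    then have yy: "- y = y" by (simp add: 2 neg_eq_iff_add_eq_0)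
    show ?thesis
      by (rule has_typeI[of "L8 (l / m)", OF _ i'])
        (use m in \<open>simp_all add: True table_simps e'_def br_simps c t yy r 2\<close>)
  next
    case False
    then have 2: "2 \<noteq> (0::'a)" by (simp add: two_eq_0_iff_CHAR)
    define x' where "x' = scale 1 x + scale 0 y + scale (- l / (2 * m)) e'"
    have i2: "indep3 x' y e'" using indep3_replace1[OF i' _ x'_def] by simp
    show ?thesis
      by (rule has_typeI[of L11, OF _ i2])
        (use m 2 False in \<open>simp_all add: table_simps x'_def e'_def br_simps c t r\<close>)
  qed
qed

lemma has_type_nonabelian:
  assumes i: "indep3 x y e" and c: "\<And>v. br e v = 0"
    and sq: "\<And>v. \<exists>k. br v v = scale k e" and e: "e = br w w"
    and xy: "br x y = scale \<alpha> x + scale \<beta> y + scale s e" and \<beta>: "\<beta> \<noteq> 0"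
  shows has_type
proof -
  have e0: "e \<noteq> 0" using indep3D(3)[OF i, of 0 0 1] by auto
  have sym: "\<exists>k. br u v + br v u = scale k e" for u v
  proof -
    obtain k1 k2 k3 where "br (u + v) (u + v) = scale k1 e" "br u u = scale k2 e"
      "br v v = scale k3 e"
      using sq by metis
    then have "br u v + br v u = scale (k1 - k2 - k3) e"
      using square_add[of u v] by (simp add: scale_left_diff_distrib algebra_simps)
    then show ?thesis ..
  qed
  have re: "\<exists>k. br v e = scale k e" for v using sym[of v e] c by simp
  \<comment> \<open>\<open>y1\<close> is \<open>br x y\<close>, which modulo \<open>e\<close> spans
    the derived algebra of the quotient. Division of \<open>x\<close> by \<open>\<beta>\<close>
    makes it act there as the identity.\<close>
  define y1 where "y1 = scale \<alpha> x + scale \<beta> y + scale s e"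
  define x1 where "x1 = scale (1 / \<beta>) x + scale 0 y + scale 0 e"
  have x1: "br x1 v = scale (1 / \<beta>) (br x v)" for v by (simp add: x1_def br_simps)
  have "\<exists>k. br x1 y1 = y1 + scale k e"
  proof -
    obtain p f where pf: "br x x = scale p e" "br x e = scale f e" using sq re by metis
    have "br x y1 = scale \<beta> y1 + scale (\<alpha> * p + s * f) e"
      by (simp add: y1_def br_simps pf xy scale_left_distrib ac_simps)
    then have "br x1 y1 = y1 + scale ((\<alpha> * p + s * f) / \<beta>) e"
      using \<beta> by (simp add: x1 scale_right_distrib)
    then show ?thesis ..
  qed
  then obtain k where k: "br x1 y1 = y1 + scale k e" ..
  obtain k' where "br x1 y1 + br y1 x1 = scale k' e" using sym by blast
  then have "br y1 x1 = scale (k' - k) e - y1"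
    by (simp add: k scale_left_diff_distrib algebra_simps)
  \<comment> \<open>This choice gives \<open>br y2 x1 = - y2\<close> exactly, not only modulo \<open>e\<close>; the Leibniz
    identity then forces \<open>br x1 y2 = y2\<close>.\<close>
  define y2 where "y2 = y1 - scale (k' - k) e"
  have y2': "y2 = scale (\<alpha> * \<beta>) x1 + scale \<beta> y + scale (s - (k' - k)) e"
    using \<beta> by (simp add: y2_def y1_def x1_def scale_left_diff_distrib)
  have i1: "indep3 x1 y e" using indep3_replace1[OF i _ x1_def] \<beta> by simp
  have i2: "indep3 x1 y2 e" by (rule indep3_replace2[OF i1 \<beta> y2'])
  have y2x1: "br y2 x1 = - y2"
    using \<open>br y1 x1 = scale (k' - k) e - y1\<close> by (simp add: y2_def br_simps c)
  obtain l m r g where lmrg: "br x1 x1 = scale l e" "br y2 y2 = scale m e" "br x1 e = scale r e"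
    "br y2 e = scale g e"
    using sq re by metis
  define k2 where "k2 = k - (k' - k) * r + (k' - k)"
  have x1y2: "br x1 y2 = y2 + scale k2 e"
    by (simp add: y2_def k2_def br_simps k lmrg scale_left_diff_distrib scale_left_distrib
        left_diff_distrib)
  \<comment> \<open>\<open>br x1\<close> is a derivation that fixes \<open>y2\<close> modulo
    \<open>e\<close>. Applied to \<open>br y2 e\<close> it gives \<open>g = 0\<close>, to
    \<open>br y2 x1\<close> it gives \<open>k2 = 0\<close>, and to \<open>br y2 y2\<close>, of
    weight \<open>2\<close>, it gives \<open>m * r = 2 * m\<close>.\<close>
  have "scale g e = 0"
    using left_leibniz[of x1 y2 e] by (simp add: lmrg br_simps x1y2 c mult.commute)
  then have g: "br y2 e = 0" by (simp add: lmrg)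
  have "scale k2 e = 0"
    using left_leibniz[of x1 y2 x1] by (simp add: y2x1 x1y2 br_simps lmrg(1-3) c g)
  then have x1y2: "br x1 y2 = y2" by (simp add: x1y2)
  have "scale (m * r) e = scale m e + scale m e"
    using left_leibniz[of x1 y2 y2] by (simp only: lmrg(1-3) br_simps x1y2 scale_scale)
  also have "\<dots> = scale (2 * m) e" by (simp only: mult_2 scale_left_distrib)
  finally have "scale (m * r) e = scale (2 * m) e" .
  then have mr: "m * r = 2 * m" using e0 by (simp only: scale_cancel_right) simp
  obtain a b d where w: "w = scale a x1 + scale b y2 + scale d e" using indep3_coords[OF i2] .
  \<comment> \<open>Since \<open>e\<close> is itself the square of \<open>w\<close>, this expansion
    shows that the coefficients cannot all vanish.\<close>
  have "br w w = scale (a * a * l + b * b * m + a * d * r) e"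
    by (simp add: w br_simps c lmrg(1-3) g x1y2 y2x1 scale_left_distrib scale_right_distrib
        scale_right_diff_distrib algebra_simps)
  then have "l \<noteq> 0 \<or> m \<noteq> 0 \<or> r \<noteq> 0" using e e0 by auto
  then show ?thesis
    by (rule has_type_nonabelian_normalized[OF i2 c g lmrg(1) x1y2 y2x1 lmrg(2,3) _ mr])
qed

lemma has_type_squares_dim_1:
  assumes e0: "e \<noteq> 0" and e: "e = br w w" and sq: "\<And>v. \<exists>k. br v v = scale k e"
  shows has_type
proof -
  have c: "br e v = 0" for v using left_center_square e by simp
  obtain x y where i: "indep3 x y e" by (rule indep3_extend1[OF e0])
  obtain p s where ps: "br x x = scale p e" "br y y = scale s e" using sq by metis
  \<comment> \<open>Polarization of the square of \<open>x + e\<close>: as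
    \<open>br e x = 0\<close>, the mixed term is \<open>br x e\<close> alone.\<close>
  obtain f where f: "br x e = scale f e"
    using sq[of "x + e"] square_add[of x e] ps c
    by (metis add.right_neutral add_diff_cancel_left' scale_left_diff_distrib)
  obtain g where g: "br y e = scale g e"
    using sq[of "y + e"] square_add[of y e] ps c
    by (metis add.right_neutral add_diff_cancel_left' scale_left_diff_distrib)
  obtain \<alpha> \<beta> q where xy: "br x y = scale \<alpha> x + scale \<beta> y + scale q e"
    using indep3_coords[OF i] .
  obtain k where "br (x + y) (x + y) = scale k e" using sq by blast
  then have "br x y + br y x = scale k e - scale p e - scale s e"
    using square_add[of x y] ps by (simp add: algebra_simps)
  then have yx: "br y x = scale (- \<beta>) y + scale (- \<alpha>) x + scale (k - p - s - q) e"
    by (simp add: xy scale_left_diff_distrib algebra_simps)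
  consider "\<beta> \<noteq> 0" | "\<alpha> \<noteq> 0" | "\<alpha> = 0" "\<beta> = 0" by blast
  then show ?thesis
  proof cases
    case 1
    show ?thesis by (rule has_type_nonabelian[OF i c sq e xy 1])
  next
    case 2
    show ?thesis by (rule has_type_nonabelian[OF indep3_swap12[OF i] c sq e yx]) (use 2 in simp)
  next
    case 3
    define r where "r = k - p - s - q"
    have xy: "br x y = scale q e" and yx: "br y x = scale r e"
      using xy yx 3 by (simp_all add: r_def)
    consider "f \<noteq> 0" | "g \<noteq> 0" | "f = 0" "g = 0" by blast
    then show ?thesis
    proof cases
      case 1
      show ?thesis by (rule has_type_L9[OF i c ps(1) xy yx ps(2) f g 1])
    next
      case 2
      show ?thesis by (rule has_type_L9[OF indep3_swap12[OF i] c ps(2) yx xy ps(1) g f 2])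
    next
      case 3
      then have 0: "br x e = 0" "br y e = 0" using f g by simp_all
      obtain a b d where w: "w = scale a x + scale b y + scale d e" using indep3_coords[OF i] .
      have "br w w = scale (a * a * p + b * b * s + a * b * (q + r)) e"
        by (simp add: w br_simps c 0 ps xy yx scale_left_distrib scale_right_distrib distrib_left
            ac_simps)
      then have "p \<noteq> 0 \<or> s \<noteq> 0 \<or> q + r \<noteq> 0" using e e0 by auto
      then show ?thesis by (rule has_type_form[OF i c 0 ps(1) xy yx ps(2)])
    qed
  qed
qed

text \<open>The left center contains \<open>p\<close> and \<open>q\<close> and is not everything,
  because the nonzero \<open>p\<close> is a product; so it is exactly their span, and it is
  preserved by \<open>br x\<close>.\<close>

lemma has_type_squares_dim_2:
  assumes p: "p = br u u" and q: "q = br v v"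
    and ind: "\<And>a b. scale a p + scale b q = 0 \<Longrightarrow> a = 0 \<and> b = 0"
  shows has_type
proof -
  have c: "br p z = 0" "br q z = 0" for z using left_center_square p q by simp_all
  obtain x where i: "indep3 x p q" by (rule indep3_extend2[OF ind])
  have p0: "p \<noteq> 0" using ind[of 1 0] by auto
  have central: "\<exists>b d. z = scale b p + scale d q" if z: "\<And>v. br z v = 0" for z
  proof -
    obtain a b d where zc: "z = scale a x + scale b p + scale d q" using indep3_coords[OF i] .
    have "a = 0"
    proof (rule ccontr)
      assume a: "a \<noteq> 0"
      have "scale a (br x v) = 0" for v using z[of v] by (simp add: zc br_simps c)
      then have x0: "br x v = 0" for v using a by simp
      obtain a' b' d' where "u = scale a' x + scale b' p + scale d' q" using indep3_coords[OF i] .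
      then have "br u v = 0" for v by (simp add: br_simps c x0)
      then show False using p0 p by simp
    qed
    then show ?thesis using zc by auto
  qed
  have br_central: "br (br x z) v = 0" if "\<And>v. br z v = 0" for z v
    using left_leibniz[of x z v] that by (simp add: br_simps)
  obtain c1 c2 where xx: "br x x = scale c1 p + scale c2 q"
    using central[of "br x x"] left_center_square by blast
  obtain a1 a2 where xp: "br x p = scale a1 p + scale a2 q"
    using central[of "br x p"] br_central[of p] c by blast
  obtain b1 b2 where xq: "br x q = scale b1 p + scale b2 q"
    using central[of "br x q"] br_central[of q] c by blast
  show ?thesis
  proof (rule has_type_left_center_dim_2[OF i c xx xp xq])
    fix z assume "\<And>v. br z v = 0"
    then obtain b d where z: "z = scale b p + scale d q" using central by blast
    obtain a1 b1 d1 where u: "u = scale a1 x + scale b1 p + scale d1 q" using indep3_coords[OF i] .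
    obtain a2 b2 d2 where v: "v = scale a2 x + scale b2 p + scale d2 q" using indep3_coords[OF i] .
    \<comment> \<open>\<open>u\<close> differs from \<open>a1 x\<close> by a left central vector, so
      its square is \<open>br (a1 x) u\<close>. This places both squares in the image of
      \<open>br x\<close>.\<close>
    have "p = br x (scale a1 u)" by (subst p, subst (1) u) (simp add: br_simps c)
    moreover have "q = br x (scale a2 v)" by (subst q, subst (1) v) (simp add: br_simps c)
    ultimately have "z = br x (scale b (scale a1 u) + scale d (scale a2 v))"
      by (simp only: z br_add_right br_scale_right)
    then show "z \<in> range (br x)" by blast
  qed
qed

theorem has_type_non_Lie:
  assumes "non_Lie br"
  shows has_type
proof -
  obtain w where w: "br w w \<noteq> 0" using assms by (auto simp: non_Lie_def)
  show ?thesis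
  proof (cases "\<forall>v. \<exists>k. br v v = scale k (br w w)")
    case True
    then show ?thesis using has_type_squares_dim_1[OF w refl] by blast
  next
    case False
    then obtain v where v: "\<And>k. br v v \<noteq> scale k (br w w)" by blast
    have "a = 0 \<and> b = 0" if *: "scale a (br w w) + scale b (br v v) = 0" for a b
    proof -
      have "b = 0"
      proof (rule ccontr)
        assume "b \<noteq> 0"
        have "scale b (br v v) = scale (- a) (br w w)"
          using * by (simp add: eq_neg_iff_add_eq_0 add.commute)
        then have "scale (1 / b) (scale b (br v v)) = scale (1 / b) (scale (- a) (br w w))" by simp
        then have "br v v = scale (- a / b) (br w w)" using \<open>b \<noteq> 0\<close> by simp
        then show False using v by blast
      qed
      then show ?thesis using * w by simp
    qed
    then show ?thesis by (rule has_type_squares_dim_2[OF refl refl])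
  qed
qed

end

theorem theorem1p1:
  fixes scale :: "'a::field \<Rightarrow> 'v::ab_group_add \<Rightarrow> 'v"
    and br :: "'v \<Rightarrow> 'v \<Rightarrow> 'v"
  shows "(left_leibniz_algebra scale br \<and> vector_space.dim scale UNIV = 3 \<and> non_Lie br \<longrightarrow>
           (\<exists>T b. admissible T \<and> nonassoc_algebra.ordered_basis scale b \<and>
                  nonassoc_algebra.has_mult_table scale br b (mult_table T))) \<and>
         (nonassoc_algebra scale br \<longrightarrow>
           (\<forall>T b. admissible T \<and> nonassoc_algebra.ordered_basis scale b \<and>
                  nonassoc_algebra.has_mult_table scale br b (mult_table T) \<longrightarrow>
                  der_description T (nonassoc_algebra.Der_matrices scale br b)))"
proof (intro conjI impI allI)
  assume L: "left_leibniz_algebra scale br \<and> vector_space.dim scale UNIV = 3 \<and> non_Lie br"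
  then interpret leibniz_algebra_dim_3 scale br
    by (simp add: leibniz_algebra_dim_3_def leibniz_algebra_dim_3_axioms_def)
  show "\<exists>T b. admissible T \<and> ordered_basis b \<and> has_mult_table b (mult_table T)"
    using has_type_non_Lie L unfolding has_type_def by blast
next
  fix T :: "'a leibniz_type" and b :: "3 \<Rightarrow> 'v"
  assume "nonassoc_algebra scale br"
  then interpret nonassoc_algebra scale br .
  assume "admissible T \<and> ordered_basis b \<and> has_mult_table b (mult_table T)"
  then show "der_description T (Der_matrices b)"
    using Der_matrices_eq der_description_derivation_matrices by metis
qed

end
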